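(* Let $(M,J)$ be a compact $2n$-dimensional almost complex manifold and let $\omega$ be a strongly Gauduchon metric on $(M,J)$. Then $$\int_M\partial\eta\wedge\omega^{n-1}=0$$ for every $\eta\in\mathcal{H}^{0,1}_{\overline\partial}(M)$.
   Context: Let $(M,J)$ be an almost complex manifold of real dimension $2n$ ($J$ not necessarily integrable). $J$ induces a bigrading $A^{\bullet}(M)=\bigoplus_{p+q=\bullet}A^{p,q}(M)$ on smooth complex-valued forms, and $d=\mu+\partial+\overline\partial+\overline\mu$, where on $A^{p,q}(M)$ the operators $\mu,\partial,\overline\partial,\overline\mu$ are the components of $d$ with values in $A^{p+2,q-1}$, $A^{p+1,q}$, $A^{p,q+1}$, $A^{p-1,q+2}$ respectively. A Hermitian metric $g$ is a $J$-invariant Riemannian metric; it is identified with its fundamental form $\omega(u,v)=g(Ju,v)$. A Hermitian metric $\omega$ is Gauduchon if $\partial\overline\partial\omega^{n-1}=0$. A Hermitian metric $\omega$ on an almost complex manifold is strongly Gauduchon if it is Gauduchon and in addition $\partial\omega^{n-1}$ is $\overline\partial$-exact, i.e. $\partial\omega^{n-1}=\overline\partial\lambda$ for some $\lambda\in A^{n,n-2}(M)$. Let $\overline\partial^*$ denote the formal $L^2$-adjoint of $\overline\partial$ with respect to $\omega$ and $\Delta_{\overline\partial}=\overline\partial\,\overline\partial^*+\overline\partial^*\overline\partial$; $\mathcal{H}^{0,1}_{\overline\partial}(M)$ is the kernel of $\Delta_{\overline\partial}$ on $A^{0,1}(M)$. On a compact $M$, a form $\eta\in A^{0,1}(M)$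 lies in this space if and only if $\overline\partial\eta=0$ and $\partial *\eta=0$, where $*$ is the $\mathbb{C}$-linear Hodge star of $\omega$. *)

theory Defs
  imports "HOL-Analysis.Analysis"
begin

section \<open>Smooth manifolds\<close>

primrec Ck_on :: "nat \<Rightarrow> 'a::real_normed_vector set \<Rightarrow> ('a \<Rightarrow> 'b::real_normed_vector) \<Rightarrow> bool" where
  "Ck_on 0 S f \<longleftrightarrow> continuous_on S f"
| "Ck_on (Suc k) S f \<longleftrightarrow> (\<forall>x\<in>S. f differentiable (at x)) \<and>
     (\<forall>v. Ck_on k S (\<lambda>x. frechet_derivative f (at x) v))"

text \<open>\<open>C\<^sup>\<infinity>\<close> on an open subset of a finite-dimensional space.\<close>

definition smooth_on :: "'a::real_normed_vector set \<Rightarrow> ('a \<Rightarrow> 'b::real_normed_vector) \<Rightarrow> bool" where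
  "smooth_on S f \<longleftrightarrow> (\<forall>k. Ck_on k S f)"

text \<open>
  A manifold is a Hausdorff, second countable type \<open>'m\<close> with an atlas of charts
  \<open>(U, \<phi>)\<close> into \<open>real ^ 'd\<close>; only the restriction of \<open>\<phi>\<close> to \<open>U\<close> matters.
  The order on the index type \<open>'d\<close> is used for nothing but to list the standard basis.
\<close>

type_synonym ('m, 'd) chart = "'m set \<times> ('m \<Rightarrow> real ^ 'd)"

definition chart_image :: "('m, 'd) chart \<Rightarrow> (real ^ 'd) set" where
  "chart_image c = snd c ` fst c"

definition chart_inv :: "('m, 'd) chart \<Rightarrow> real ^ 'd \<Rightarrow> 'm" where
  "chart_inv c = inv_into (fst c) (snd c)"

definition is_chart :: "('m::topological_space, 'd::finite) chart \<Rightarrow> bool" where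
  "is_chart c \<longleftrightarrow> open (fst c) \<and> open (chart_image c) \<and>
     homeomorphism (fst c) (chart_image c) (snd c) (chart_inv c)"

definition transition :: "('m, 'd) chart \<Rightarrow> ('m, 'd) chart \<Rightarrow> real ^ 'd \<Rightarrow> real ^ 'd" where
  "transition c c' = snd c' \<circ> chart_inv c"

definition smooth_compatible :: "('m, 'd::finite) chart \<Rightarrow> ('m, 'd) chart \<Rightarrow> bool" where
  "smooth_compatible c c' \<longleftrightarrow>
     smooth_on (snd c ` (fst c \<inter> fst c')) (transition c c') \<and>
     smooth_on (snd c' ` (fst c \<inter> fst c')) (transition c' c)"

definition smooth_atlas :: "('m::topological_space, 'd::finite) chart set \<Rightarrow> bool" where
  "smooth_atlas A \<longleftrightarrow> (\<forall>c\<in>A. is_chart c) \<and> (\<Union>c\<in>A. fst c) = UNIV \<and>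
     (\<forall>c\<in>A. \<forall>c'\<in>A. smooth_compatible c c')"

definition maximal_atlas :: "('m::topological_space, 'd::finite) chart set \<Rightarrow> ('m, 'd) chart set" where
  "maximal_atlas A = {c. is_chart c \<and> (\<forall>c'\<in>A. smooth_compatible c c')}"

text \<open>
  The tangent space at a point \<open>p\<close> is represented by the model space \<open>real ^ 'd\<close>: a tangent
  vector is given by its coordinates in the preferred chart at \<open>p\<close>, an arbitrary
  but fixed chart of the atlas around \<open>p\<close>. Tensor fields are therefore plain functions
  of \<open>p\<close>, and all pointwise linear algebra takes place on \<open>real ^ 'd\<close>. No regularity in \<open>p\<close>
  of the choice is needed, because smoothness and derivatives always refer to the
  representation of a field in a single chart.
\<close>

definition chart_at :: "('m, 'd) chart set \<Rightarrow> 'm \<Rightarrow> ('m, 'd) chart" where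
  "chart_at A p = (SOME c. c \<in> A \<and> p \<in> fst c)"

text \<open>
  \<open>to_tangent A c x\<close> sends the coordinates of a tangent vector in the chart \<open>c\<close> at the point
  with coordinates \<open>x\<close> to the tangent vector itself, \<open>of_tangent A c x\<close> is its inverse.
\<close>

definition to_tangent ::
  "('m, 'd::finite) chart set \<Rightarrow> ('m, 'd) chart \<Rightarrow> real ^ 'd \<Rightarrow> real ^ 'd \<Rightarrow> real ^ 'd" where
  "to_tangent A c x =
     frechet_derivative (transition c (chart_at A (chart_inv c x))) (at x)"

definition of_tangent ::
  "('m, 'd::finite) chart set \<Rightarrow> ('m, 'd) chart \<Rightarrow> real ^ 'd \<Rightarrow> real ^ 'd \<Rightarrow> real ^ 'd" where
  "of_tangent A c x = (let p = chart_inv c x; c\<^sub>p = chart_at A p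
     in frechet_derivative (transition c\<^sub>p c) (at (snd c\<^sub>p p)))"

definition smooth_function :: "('m, 'd::finite) chart set \<Rightarrow> ('m \<Rightarrow> real) \<Rightarrow> bool" where
  "smooth_function A f \<longleftrightarrow> (\<forall>c\<in>A. smooth_on (chart_image c) (f \<circ> chart_inv c))"


section \<open>Exterior algebra of a vector space\<close>

text \<open>
  An element of the exterior algebra of complex-valued forms on \<open>'v\<close> is a function on lists
  of vectors; its part of degree \<open>k\<close> is its restriction to lists of length \<open>k\<close>.
\<close>

type_synonym 'v cform = "'v list \<Rightarrow> complex"

definition alternating :: "nat \<Rightarrow> 'v::real_vector cform \<Rightarrow> bool" where
  "alternating k a \<longleftrightarrow>
     (\<forall>vs. length vs \<noteq> k \<longrightarrow> a vs = 0) \<and>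
     (\<forall>vs i. length vs = k \<longrightarrow> i < k \<longrightarrow> linear (\<lambda>v. a (vs[i := v]))) \<and>
     (\<forall>vs i j. length vs = k \<longrightarrow> i < j \<longrightarrow> j < k \<longrightarrow> vs ! i = vs ! j \<longrightarrow> a vs = 0)"

text \<open>
  The wedge product is the signed sum over all shuffles, so that
  \<open>(a \<and> b)(u, v) = a u * b v - a v * b u\<close> for 1-forms. The set \<open>I\<close> holds the positions
  of the arguments passed to the first factor.
\<close>

definition shuffle_sign :: "nat set \<Rightarrow> nat \<Rightarrow> complex" where
  "shuffle_sign I m = (- 1) ^ card {(i, j). i \<in> I \<and> j \<in> {..<m} - I \<and> j < i}"

definition wedge :: "'v cform \<Rightarrow> 'v cform \<Rightarrow> 'v cform" where
  "wedge a b = (\<lambda>vs. \<Sum>I\<in>Pow {..<length vs}.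
     shuffle_sign I (length vs) * a (nths vs I) * b (nths vs (- I)))"

definition wedge_one :: "'v cform" where
  "wedge_one = (\<lambda>vs. if vs = [] then 1 else 0)"

definition wedge_power :: "'v cform \<Rightarrow> nat \<Rightarrow> 'v cform" where
  "wedge_power a k = (wedge a ^^ k) wedge_one"

definition wedge_list :: "'v cform list \<Rightarrow> 'v cform" where
  "wedge_list as = foldr wedge as wedge_one"

text \<open>
  For a complex structure \<open>J\<close> on \<open>'v\<close>, the forms of bidegree \<open>(p, q)\<close> are the complex linear
  combinations of products of \<open>p\<close> covectors of type \<open>(1, 0)\<close> and \<open>q\<close> covectors of
  type \<open>(0, 1)\<close>. Bidegrees are integers, and there are only zero forms in negative bidegrees.
\<close>

definition covector10 :: "('v \<Rightarrow> 'v) \<Rightarrow> 'v::real_vector cform \<Rightarrow> bool" where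
  "covector10 J a \<longleftrightarrow> alternating 1 a \<and> (\<forall>v. a [J v] = \<i> * a [v])"

definition covector01 :: "('v \<Rightarrow> 'v) \<Rightarrow> 'v::real_vector cform \<Rightarrow> bool" where
  "covector01 J a \<longleftrightarrow> alternating 1 a \<and> (\<forall>v. a [J v] = - \<i> * a [v])"

inductive bidegree :: "('v \<Rightarrow> 'v) \<Rightarrow> int \<Rightarrow> int \<Rightarrow> 'v::real_vector cform \<Rightarrow> bool"
  for J :: "'v \<Rightarrow> 'v" and p q :: int where
  zero: "bidegree J p q (\<lambda>vs. 0)"
| add_product: "bidegree J p q b \<Longrightarrow> int (length as) = p \<Longrightarrow> int (length bs) = q \<Longrightarrow>
     \<forall>a\<in>set as. covector10 J a \<Longrightarrow> \<forall>a\<in>set bs. covector01 J a \<Longrightarrow>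
     bidegree J p q (\<lambda>vs. z * wedge_list (as @ bs) vs + b vs)"

text \<open>The component of bidegree \<open>(p, q)\<close> of a form \<open>a\<close> of degree \<open>p + q\<close>.\<close>

definition component :: "('v \<Rightarrow> 'v) \<Rightarrow> int \<Rightarrow> int \<Rightarrow> 'v::real_vector cform \<Rightarrow> 'v cform" where
  "component J p q a = (THE b. bidegree J p q b \<and>
     (\<exists>D. (\<forall>r\<in>{0..p + q}. bidegree J r (p + q - r) (D r)) \<and> D p = b \<and>
          a = (\<lambda>vs. \<Sum>r\<in>{0..p + q}. D r vs)))"


section \<open>Differential forms\<close>

type_synonym ('m, 'd) endo_field = "'m \<Rightarrow> real ^ 'd \<Rightarrow> real ^ 'd"
type_synonym ('m, 'd) metric_field = "'m \<Rightarrow> real ^ 'd \<Rightarrow> real ^ 'd \<Rightarrow> real"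
type_synonym ('m, 'd) form = "'m \<Rightarrow> (real ^ 'd) cform"

definition local_form ::
  "('m, 'd::finite) chart set \<Rightarrow> ('m, 'd) chart \<Rightarrow> ('m, 'd) form \<Rightarrow> real ^ 'd \<Rightarrow> (real ^ 'd) cform" where
  "local_form A c \<alpha> x vs = \<alpha> (chart_inv c x) (map (to_tangent A c x) vs)"

definition smooth_form :: "('m, 'd::finite) chart set \<Rightarrow> nat \<Rightarrow> ('m, 'd) form \<Rightarrow> bool" where
  "smooth_form A k \<alpha> \<longleftrightarrow> (\<forall>p. alternating k (\<alpha> p)) \<and>
     (\<forall>c\<in>A. \<forall>vs. smooth_on (chart_image c) (\<lambda>x. local_form A c \<alpha> x vs))"

definition zero_form :: "('m, 'd) form" where
  "zero_form = (\<lambda>p vs. 0)"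

definition form_wedge :: "('m, 'd) form \<Rightarrow> ('m, 'd) form \<Rightarrow> ('m, 'd) form" where
  "form_wedge \<alpha> \<beta> = (\<lambda>p. wedge (\<alpha> p) (\<beta> p))"

definition form_power :: "('m, 'd) form \<Rightarrow> nat \<Rightarrow> ('m, 'd) form" where
  "form_power \<alpha> k = (\<lambda>p. wedge_power (\<alpha> p) k)"

text \<open>
  The usual coordinate formula for the exterior derivative, evaluated at constant vector
  fields on \<open>real ^ 'd\<close>. On the manifold it is applied in the preferred chart at the point
  under consideration, in which tangent vectors coincide with their coordinates.
\<close>

definition local_ext_deriv ::
  "(real ^ 'd::finite \<Rightarrow> (real ^ 'd) cform) \<Rightarrow> real ^ 'd \<Rightarrow> (real ^ 'd) cform" where
  "local_ext_deriv a x vs = (\<Sum>i<length vs. (- 1) ^ i *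
     frechet_derivative (\<lambda>y. a y (take i vs @ drop (Suc i) vs)) (at x) (vs ! i))"

definition ext_deriv :: "('m, 'd::finite) chart set \<Rightarrow> ('m, 'd) form \<Rightarrow> ('m, 'd) form" where
  "ext_deriv A \<alpha> p = (let c = chart_at A p in local_ext_deriv (local_form A c \<alpha>) (snd c p))"


section \<open>Almost complex structures and the bigrading\<close>

definition local_endo ::
  "('m, 'd::finite) chart set \<Rightarrow> ('m, 'd) chart \<Rightarrow> ('m, 'd) endo_field \<Rightarrow>
   real ^ 'd \<Rightarrow> real ^ 'd \<Rightarrow> real ^ 'd" where
  "local_endo A c J x v = of_tangent A c x (J (chart_inv c x) (to_tangent A c x v))"

definition almost_complex ::
  "('m, 'd::finite) chart set \<Rightarrow> ('m, 'd) endo_field \<Rightarrow> bool" where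
  "almost_complex A J \<longleftrightarrow> (\<forall>p. linear (J p) \<and> (\<forall>v. J p (J p v) = - v)) \<and>
     (\<forall>c\<in>A. \<forall>v. smooth_on (chart_image c) (\<lambda>x. local_endo A c J x v))"

text \<open>The space \<open>A\<^sup>p\<^sup>,\<^sup>q(M)\<close>, which is zero if \<open>p\<close> or \<open>q\<close> is negative.\<close>

definition forms_pq ::
  "('m, 'd::finite) chart set \<Rightarrow> ('m, 'd) endo_field \<Rightarrow> int \<Rightarrow> int \<Rightarrow> ('m, 'd) form set" where
  "forms_pq A J p q = {\<alpha>. smooth_form A (nat (p + q)) \<alpha> \<and> (\<forall>x. bidegree (J x) p q (\<alpha> x))}"

text \<open>The operators \<open>\<partial>\<close> and its conjugate on \<open>A\<^sup>p\<^sup>,\<^sup>q(M)\<close>.\<close>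

definition del ::
  "('m, 'd::finite) chart set \<Rightarrow> ('m, 'd) endo_field \<Rightarrow> int \<Rightarrow> int \<Rightarrow>
   ('m, 'd) form \<Rightarrow> ('m, 'd) form" where
  "del A J p q \<alpha> = (\<lambda>x. component (J x) (p + 1) q (ext_deriv A \<alpha> x))"

definition delbar ::
  "('m, 'd::finite) chart set \<Rightarrow> ('m, 'd) endo_field \<Rightarrow> int \<Rightarrow> int \<Rightarrow>
   ('m, 'd) form \<Rightarrow> ('m, 'd) form" where
  "delbar A J p q \<alpha> = (\<lambda>x. component (J x) p (q + 1) (ext_deriv A \<alpha> x))"


section \<open>Integration\<close>

definition standard_frame :: "(real ^ 'd::{finite,wellorder}) list" where
  "standard_frame = map (\<lambda>i. axis i 1) (sorted_list_of_set UNIV)"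

definition frame_det :: "(real ^ 'd::{finite,wellorder}) list \<Rightarrow> real" where
  "frame_det vs = det (\<chi> i j. (vs ! card {k. k < j}) $ i)"

text \<open>
  The manifold carries the orientation induced by \<open>J\<close>, for which every frame of the form
  \<open>(u\<^sub>1, J u\<^sub>1, \<dots>, u\<^sub>n, J u\<^sub>n)\<close> is positive.
\<close>

definition positive_chart ::
  "('m, 'd::{finite,wellorder}) chart set \<Rightarrow> ('m, 'd) endo_field \<Rightarrow> ('m, 'd) chart \<Rightarrow> bool" where
  "positive_chart A J c \<longleftrightarrow> (\<forall>x\<in>chart_image c. \<exists>us. 2 * length us = CARD('d) \<and>
     0 < frame_det (concat (map (\<lambda>u. [u, local_endo A c J x u]) us)))"

definition partition_of_unity ::
  "('m::topological_space, 'd::{finite,wellorder}) chart set \<Rightarrow> ('m, 'd) endo_field \<Rightarrow>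
   (('m, 'd) chart \<times> ('m \<Rightarrow> real)) set \<Rightarrow> bool" where
  "partition_of_unity A J P \<longleftrightarrow> finite P \<and>
     (\<forall>(c, \<rho>)\<in>P. c \<in> maximal_atlas A \<and> positive_chart A J c \<and> smooth_function A \<rho> \<and>
        (\<forall>p. 0 \<le> \<rho> p) \<and> closure {p. \<rho> p \<noteq> 0} \<subseteq> fst c) \<and>
     (\<forall>p. (\<Sum>(c, \<rho>)\<in>P. \<rho> p) = 1)"

text \<open>
  The integral of a top-degree form over a compact manifold. Smooth forms have the same
  integral for all finite partitions of unity subordinate to positive charts, so any one
  of them may be selected.
\<close>

definition form_integral ::
  "('m::topological_space, 'd::{finite,wellorder}) chart set \<Rightarrow> ('m, 'd) endo_field \<Rightarrow>
   ('m, 'd) form \<Rightarrow> complex" where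
  "form_integral A J \<beta> = (\<Sum>(c, \<rho>)\<in>(SOME P. partition_of_unity A J P).
     integral (chart_image c)
       (\<lambda>x. complex_of_real (\<rho> (chart_inv c x)) * local_form A c \<beta> x standard_frame))"


section \<open>Hermitian metrics\<close>

definition hermitian_metric ::
  "('m, 'd::finite) chart set \<Rightarrow> ('m, 'd) endo_field \<Rightarrow>
   ('m, 'd) metric_field \<Rightarrow> bool" where
  "hermitian_metric A J g \<longleftrightarrow>
     (\<forall>p. bilinear (g p) \<and> (\<forall>u v. g p u v = g p v u) \<and> (\<forall>u. u \<noteq> 0 \<longrightarrow> 0 < g p u u) \<and>
          (\<forall>u v. g p (J p u) (J p v) = g p u v)) \<and>
     (\<forall>c\<in>A. \<forall>u v. smooth_on (chart_image c)
        (\<lambda>x. g (chart_inv c x) (to_tangent A c x u) (to_tangent A c x v)))"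

definition fundamental_form ::
  "('m, 'd) endo_field \<Rightarrow> ('m, 'd) metric_field \<Rightarrow> ('m, 'd) form" where
  "fundamental_form J g p vs =
     (if length vs = 2 then complex_of_real (g p (J p (vs ! 0)) (vs ! 1)) else 0)"

definition gauduchon ::
  "('m, 'd::finite) chart set \<Rightarrow> ('m, 'd) endo_field \<Rightarrow>
   ('m, 'd) metric_field \<Rightarrow> nat \<Rightarrow> bool" where
  "gauduchon A J g n \<longleftrightarrow> hermitian_metric A J g \<and>
     del A J (int n - 1) (int n) (delbar A J (int n - 1) (int n - 1)
       (form_power (fundamental_form J g) (n - 1))) = zero_form"

definition strongly_gauduchon ::
  "('m, 'd::finite) chart set \<Rightarrow> ('m, 'd) endo_field \<Rightarrow>
   ('m, 'd) metric_field \<Rightarrow> nat \<Rightarrow> bool" where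
  "strongly_gauduchon A J g n \<longleftrightarrow> gauduchon A J g n \<and>
     (\<exists>\<nu>\<in>forms_pq A J (int n) (int n - 2).
        del A J (int n - 1) (int n - 1) (form_power (fundamental_form J g) (n - 1)) =
        delbar A J (int n) (int n - 2) \<nu>)"


section \<open>Harmonic forms\<close>

definition orthonormal_frame :: "(real ^ 'd::finite \<Rightarrow> real ^ 'd \<Rightarrow> real) \<Rightarrow> (real ^ 'd) list \<Rightarrow> bool" where
  "orthonormal_frame h es \<longleftrightarrow> length es = CARD('d) \<and>
     (\<forall>i<CARD('d). \<forall>j<CARD('d). h (es ! i) (es ! j) = (if i = j then 1 else 0))"

text \<open>
  The inner product on forms induced by the inner product \<open>h\<close> on vectors: for an
  orthonormal frame, the products of distinct elements of the dual frame (in increasing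
  order) are orthonormal. It does not depend on the frame.
\<close>

definition cform_inner ::
  "(real ^ 'd::finite \<Rightarrow> real ^ 'd \<Rightarrow> real) \<Rightarrow> (real ^ 'd) cform \<Rightarrow> (real ^ 'd) cform \<Rightarrow> complex" where
  "cform_inner h a b = (let es = (SOME es. orthonormal_frame h es)
     in \<Sum>I\<in>Pow {..<CARD('d)}. a (nths es I) * cnj (b (nths es I)))"

text \<open>The \<open>L\<^sup>2\<close> inner product with respect to the Riemannian volume form \<open>\<omega>\<^sup>n / n!\<close>.\<close>

definition L2_inner ::
  "('m::topological_space, 'd::{finite,wellorder}) chart set \<Rightarrow> ('m, 'd) endo_field \<Rightarrow>
   ('m, 'd) metric_field \<Rightarrow> ('m, 'd) form \<Rightarrow> ('m, 'd) form \<Rightarrow> complex" where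
  "L2_inner A J g \<alpha> \<beta> = (let n = CARD('d) div 2 in
     form_integral A J (\<lambda>p vs. cform_inner (g p) (\<alpha> p) (\<beta> p) *
       (form_power (fundamental_form J g) n p vs / fact n)))"

text \<open>
  \<open>is_delbar_adjoint A J g p q \<beta> \<gamma>\<close> says that \<open>\<gamma>\<close> is the image of \<open>\<beta>\<close> in \<open>A\<^sup>p\<^sup>,\<^sup>q\<^sup>+\<^sup>1(M)\<close> under the
  formal \<open>L\<^sup>2\<close>-adjoint of the operator \<open>delbar A J p q\<close>. The adjoint is rendered as the graph of
  an operator: \<open>\<gamma>\<close> is determined by \<open>\<beta>\<close> since the \<open>L\<^sup>2\<close> inner product is definite on smooth
  forms. As the manifold is compact, all smooth forms are admissible test forms.
\<close>

definition is_delbar_adjoint ::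
  "('m::topological_space, 'd::{finite,wellorder}) chart set \<Rightarrow> ('m, 'd) endo_field \<Rightarrow>
   ('m, 'd) metric_field \<Rightarrow> int \<Rightarrow> int \<Rightarrow> ('m, 'd) form \<Rightarrow> ('m, 'd) form \<Rightarrow> bool" where
  "is_delbar_adjoint A J g p q \<beta> \<gamma> \<longleftrightarrow> \<beta> \<in> forms_pq A J p (q + 1) \<and> \<gamma> \<in> forms_pq A J p q \<and>
     (\<forall>\<alpha>\<in>forms_pq A J p q.
        L2_inner A J g (delbar A J p q \<alpha>) \<beta> = L2_inner A J g \<alpha> \<gamma>)"

text \<open>
  The kernel on \<open>A\<^sup>p\<^sup>,\<^sup>q(M)\<close> of the Laplacian, the sum of \<open>delbar\<close> applied to the adjoint
  \<open>\<gamma>\<close> of \<open>\<eta>\<close> and of the adjoint \<open>\<delta>\<close> of \<open>delbar\<close> applied to \<open>\<eta>\<close>.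
\<close>

definition delbar_harmonic ::
  "('m::topological_space, 'd::{finite,wellorder}) chart set \<Rightarrow> ('m, 'd) endo_field \<Rightarrow>
   ('m, 'd) metric_field \<Rightarrow> int \<Rightarrow> int \<Rightarrow> ('m, 'd) form set" where
  "delbar_harmonic A J g p q = {\<eta> \<in> forms_pq A J p q. \<exists>\<gamma> \<delta>.
     is_delbar_adjoint A J g p (q - 1) \<eta> \<gamma> \<and>
     is_delbar_adjoint A J g p q (delbar A J p q \<eta>) \<delta> \<and>
     (\<lambda>x vs. delbar A J p (q - 1) \<gamma> x vs + \<delta> x vs) = zero_form}"

end

theory Submission
  imports Defs
begin

text \<open>
  A form of top degree whose bidegree is not \<open>(n, n)\<close> vanishes. Hence, if \<open>\<partial>\<omega>\<^sup>n\<^sup>-\<^sup>1\<close> is the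
  \<open>(n, n - 1)\<close>-part of \<open>d\<nu>\<close> with \<open>\<nu>\<close> of bidegree \<open>(n, n - 2)\<close>, only one component of each exterior
  derivative survives in
  \<open>d(\<eta> \<and> \<omega>\<^sup>n\<^sup>-\<^sup>1) = \<partial>\<eta> \<and> \<omega>\<^sup>n\<^sup>-\<^sup>1 - \<eta> \<and> \<partial>\<omega>\<^sup>n\<^sup>-\<^sup>1\<close>, and \<open>d(\<eta> \<and> \<nu>) = - \<eta> \<and> \<partial>\<omega>\<^sup>n\<^sup>-\<^sup>1\<close> because the
  \<open>(0, 2)\<close>-part of \<open>d\<eta>\<close> is zero for harmonic \<open>\<eta>\<close>. So the integrand is the exact form
  \<open>d(\<eta> \<and> \<omega>\<^sup>n\<^sup>-\<^sup>1 - \<eta> \<and> \<nu>)\<close>, and Stokes' theorem applies.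
\<close>

section \<open>Exterior algebra\<close>

text \<open>Choices made by the definitions shape the work. \<open>component\<close> is a definite
  description, so nothing can be said about \<partial> before the bidegree decomposition is known to
  exist and to be unique. Uniqueness comes from the circle action \<open>rot\<close>: bidegree
  \<open>(p, q)\<close> has weight \<open>p - q\<close>, and different weights are independent. The
  same weights make top forms vanish, and they stand in for the type of the power of \<omega>: only
  its weight 0 is used, never an expansion into covectors. \<open>cform_inner\<close> picks an
  orthonormal frame separately at each point, so the continuity behind the definiteness of
  \<open>L2_inner\<close> has to be recovered through the inverse Gram matrix. Exterior derivatives
  refer to a preferred chart chosen point by point, whereas integrals use charts of the maximal
  atlas; facts known on \<open>A\<close> must therefore be carried over to
  \<open>maximal_atlas A\<close>. Degrees are hidden in the lengths of lists. Most identities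
  between products and derivatives are cast as recursions that remove the first argument, which
  keeps shuffle signs out of most arguments.\<close>

definition contract :: "'v \<Rightarrow> 'v cform \<Rightarrow> 'v cform" where
  "contract v a = (\<lambda>vs. a (v # vs))"

text \<open>The grading involution. It supplies the sign of the Leibniz rule without mention of a
  degree, so that \<open>wedge_Cons\<close> holds for arbitrary functions on lists, alternating or
  not.\<close>

definition twist :: "'v cform \<Rightarrow> 'v cform" where
  "twist a = (\<lambda>vs. (- 1) ^ length vs * a vs)"

lemma twist_twist [simp]: "twist (twist a) = a"
  by (simp add: twist_def fun_eq_iff flip: mult.assoc power_add)

lemma contract_twist: "contract v (twist a) = (\<lambda>vs. - twist (contract v a) vs)"
  by (simp add: twist_def contract_def fun_eq_iff)

lemma finite_shuffle_pairs: "finite {(i, j). i \<in> I \<and> j \<in> {..<m::nat} - I \<and> j < i}" if "I \<subseteq> {..<m}"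
  by (rule finite_subset[of _ "{..<m} \<times> {..<m}"]) (use that in auto)

text \<open>The new position 0 lies below all others. Given to the second factor it forms an
  inversion with every element of \<open>I\<close>, whence the factor \<open>(- 1) ^ card I\<close>;
  given to the first factor it forms none.\<close>

lemma shuffle_sign_Suc:
  assumes "I \<subseteq> {..<m}"
  shows "shuffle_sign (Suc ` I) (Suc m) = (- 1) ^ card I * shuffle_sign I m"
    and "shuffle_sign (insert 0 (Suc ` I)) (Suc m) = shuffle_sign I m"
proof -
  let ?S = "{(i, j). i \<in> I \<and> j \<in> {..<m} - I \<and> j < i}"
  have fI: "finite I" using assms finite_subset by blast
  have inj: "inj_on (map_prod Suc Suc) ?S" by (auto simp: inj_on_def)
  have A: "{(i, j). i \<in> Suc ` I \<and> j \<in> {..<Suc m} - Suc ` I \<and> j < i}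
      = (\<lambda>i. (Suc i, 0)) ` I \<union> map_prod Suc Suc ` ?S" (is "?L = ?R")
  proof (rule equalityI; rule subsetI)
    fix x assume "x \<in> ?L"
    then obtain i j where x: "x = (Suc i, j)" "i \<in> I" "j < Suc m" "j \<notin> Suc ` I" "j < Suc i" by auto
    show "x \<in> ?R"
    proof (cases j)
      case 0 then show ?thesis using x by auto
    next
      case (Suc j') then have "(i, j') \<in> ?S" using x by auto
      then show ?thesis using x Suc by (force simp: image_iff)
    qed
  qed auto
  have B: "{(i, j). i \<in> insert 0 (Suc ` I) \<and> j \<in> {..<Suc m} - insert 0 (Suc ` I) \<and> j < i}
      = map_prod Suc Suc ` ?S" (is "?L = ?R")
  proof (rule equalityI; rule subsetI)
    fix x assume "x \<in> ?L"
    then obtain i j where x: "x = (i, j)" "i = 0 \<or> i \<in> Suc ` I" "j < Suc m" "j \<notin> Suc ` I" "j < i" "j \<noteq> 0" by auto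
    then obtain i' j' where "i = Suc i'" "j = Suc j'" using x(5,6) by (cases i; cases j) auto
    with x have "(i', j') \<in> ?S" by auto
    then show "x \<in> ?R" using x \<open>i = Suc i'\<close> \<open>j = Suc j'\<close> by (force simp: image_iff)
  qed auto
  have fS: "finite ?S" using assms by (rule finite_shuffle_pairs)
  have "card ((\<lambda>i. (Suc i, 0::nat)) ` I \<union> map_prod Suc Suc ` ?S) = card I + card ?S"
    by (subst card_Un_disjoint) (use fI fS inj in \<open>auto simp: card_image inj_on_def\<close>)
  then show "shuffle_sign (Suc ` I) (Suc m) = (- 1) ^ card I * shuffle_sign I m"
    unfolding shuffle_sign_def A by (simp add: power_add)
  show "shuffle_sign (insert 0 (Suc ` I)) (Suc m) = shuffle_sign I m"
    unfolding shuffle_sign_def B using inj by (simp add: card_image)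
qed

lemma Pow_lessThan_Suc:
  "Pow {..<Suc m} = (\<lambda>I. insert 0 (Suc ` I)) ` Pow {..<m} \<union> (\<lambda>I. Suc ` I) ` Pow {..<m}"
proof (rule equalityI; rule subsetI)
  fix S assume S: "S \<in> Pow {..<Suc m}"
  let ?I = "{j. Suc j \<in> S}"
  have I: "?I \<in> Pow {..<m}" using S by auto
  have "S = (if 0 \<in> S then insert 0 (Suc ` ?I) else Suc ` ?I)"
  proof (rule set_eqI)
    fix x show "x \<in> S \<longleftrightarrow> x \<in> (if 0 \<in> S then insert 0 (Suc ` ?I) else Suc ` ?I)"
      by (cases x) auto
  qed
  then show "S \<in> (\<lambda>I. insert 0 (Suc ` I)) ` Pow {..<m} \<union> (\<lambda>I. Suc ` I) ` Pow {..<m}"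
    using I by (metis UnCI imageI)
qed auto

section \<open>The wedge product by recursion on the arguments\<close>

lemma wedge_Nil: "wedge a b [] = a [] * b []"
  by (simp add: wedge_def shuffle_sign_def)

lemma sum_Pow_lessThan_Suc:
  "(\<Sum>I\<in>Pow {..<Suc m}. f I) =
   (\<Sum>I\<in>Pow {..<m}. f (insert 0 (Suc ` I))) + (\<Sum>I\<in>Pow {..<m}. (f (Suc ` I) :: 'a::comm_monoid_add))"
proof -
  have 1: "inj_on (\<lambda>I. insert 0 (Suc ` I)) (Pow {..<m})"
    by (rule inj_onI) (auto simp: set_eq_iff image_iff)
  have 2: "inj_on (\<lambda>I. Suc ` I) (Pow {..<m})"
    by (rule inj_onI) (auto simp: set_eq_iff image_iff)
  have "(\<lambda>I. insert 0 (Suc ` I)) ` Pow {..<m} \<inter> (\<lambda>I. Suc ` I) ` Pow {..<m} = {}" by auto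
  then show ?thesis unfolding Pow_lessThan_Suc
    by (simp add: sum.union_disjoint sum.reindex[OF 1] sum.reindex[OF 2] o_def)
qed

text \<open>The Leibniz rule for contractions, as a recursion on the argument list: together with
  \<open>wedge_Nil\<close> it lets every identity between products be proved by induction on that list.\<close>

lemma wedge_Cons:
  "wedge a b (v # vs) = wedge (contract v a) b vs + wedge (twist a) (contract v b) vs"
proof -
  let ?m = "length vs"
  have 1: "{j. Suc j \<in> insert 0 (Suc ` I)} = I" "{j. Suc j \<in> Suc ` I} = I" for I :: "nat set"
    by auto
  have n1: "nths (v # vs) (insert 0 (Suc ` I)) = v # nths vs I"
    "nths (v # vs) (Suc ` I) = nths vs I"
    "nths (v # vs) (- insert 0 (Suc ` I)) = nths vs (- I)"
    "nths (v # vs) (- Suc ` I) = v # nths vs (- I)" for I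
    by (simp_all add: nths_Cons 1 Compl_eq inj_image_mem_iff)
  have len: "length (nths vs I) = card I" if "I \<in> Pow {..<?m}" for I
    using that by (auto simp: length_nths intro!: arg_cong[where f=card])
  have "wedge a b (v # vs) = (\<Sum>I\<in>Pow {..<?m}. shuffle_sign I ?m * a (v # nths vs I) * b (nths vs (- I)))
     + (\<Sum>I\<in>Pow {..<?m}. ((- 1) ^ card I * shuffle_sign I ?m) * a (nths vs I) * b (v # nths vs (- I)))"
    unfolding wedge_def length_Cons sum_Pow_lessThan_Suc n1
    by (intro arg_cong2[where f="(+)"] sum.cong refl) (auto simp: shuffle_sign_Suc)
  also have "(\<Sum>I\<in>Pow {..<?m}. ((- 1) ^ card I * shuffle_sign I ?m) * a (nths vs I) * b (v # nths vs (- I)))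
     = wedge (twist a) (contract v b) vs"
    unfolding wedge_def by (rule sum.cong) (auto simp: twist_def contract_def len)
  finally show ?thesis by (simp add: wedge_def contract_def)
qed

lemma contract_wedge:
  "contract v (wedge a b) = (\<lambda>vs. wedge (contract v a) b vs + wedge (twist a) (contract v b) vs)"
  by (simp add: contract_def[of v "wedge a b"] wedge_Cons)

lemma wedge_add_left: "wedge (\<lambda>vs. a vs + b vs) c vs = wedge a c vs + wedge b c vs"
  by (simp add: wedge_def sum.distrib algebra_simps)

lemma wedge_add_right: "wedge a (\<lambda>vs. b vs + c vs) vs = wedge a b vs + wedge a c vs"
  by (simp add: wedge_def sum.distrib algebra_simps)

lemma wedge_scale_left: "wedge (\<lambda>vs. z * a vs) c vs = z * wedge a c vs"
  by (simp add: wedge_def sum_distrib_left algebra_simps)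

lemma wedge_scale_right: "wedge a (\<lambda>vs. z * c vs) vs = z * wedge a c vs"
  by (simp add: wedge_def sum_distrib_left algebra_simps)

lemma wedge_minus_left: "wedge (\<lambda>vs. - a vs) c vs = - wedge a c vs"
  by (simp add: wedge_def sum_negf)

lemma wedge_minus_right: "wedge a (\<lambda>vs. - c vs) vs = - wedge a c vs"
  by (simp add: wedge_def sum_negf)

lemma wedge_zero_left [simp]: "wedge (\<lambda>vs. 0) c = (\<lambda>vs. 0)"
  by (simp add: wedge_def)

lemma wedge_zero_right [simp]: "wedge a (\<lambda>vs. 0) = (\<lambda>vs. 0)"
  by (simp add: wedge_def)

lemma wedge_sum_left: "wedge (\<lambda>vs. \<Sum>i\<in>I. a i vs) c vs = (\<Sum>i\<in>I. wedge (a i) c vs)"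
  by (induction I rule: infinite_finite_induct) (auto simp: wedge_add_left)

lemma wedge_sum_right: "wedge c (\<lambda>vs. \<Sum>i\<in>I. a i vs) vs = (\<Sum>i\<in>I. wedge c (a i) vs)"
  by (induction I rule: infinite_finite_induct) (auto simp: wedge_add_right)

lemma wedge_map: "wedge a b (map f vs) = wedge (\<lambda>vs. a (map f vs)) (\<lambda>vs. b (map f vs)) vs"
  by (simp add: wedge_def nths_map)

lemma twist_wedge: "twist (wedge a b) = wedge (twist a) (twist b)"
proof
  fix vs show "twist (wedge a b) vs = wedge (twist a) (twist b) vs"
  proof (induction vs arbitrary: a b)
    case Nil show ?case by (simp add: twist_def wedge_Nil)
  next
    case (Cons v vs)
    have "twist (wedge a b) (v # vs) = - (twist (wedge (contract v a) b) vs + twist (wedge (twist a) (contract v b)) vs)"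
      by (simp add: twist_def wedge_Cons algebra_simps)
    then show ?case by (simp add: Cons wedge_Cons contract_twist wedge_minus_left wedge_minus_right)
  qed
qed

text \<open>Contracting either side gives the same three Leibniz terms, the last with
  \<open>twist a\<close> and \<open>twist b\<close> in front. With the factors left arbitrary,
  induction on the list needs neither degrees nor triple shuffles.\<close>

lemma wedge_assoc: "wedge (wedge a b) c = wedge a (wedge b c)"
proof
  fix vs show "wedge (wedge a b) c vs = wedge a (wedge b c) vs"
  proof (induction vs arbitrary: a b c)
    case Nil show ?case by (simp add: wedge_Nil)
  next
    case (Cons v vs)
    show ?case
      by (simp add: wedge_Cons contract_wedge wedge_add_left wedge_add_right twist_wedge Cons)
  qed
qed

lemma twist_one [simp]: "twist wedge_one = wedge_one"
  by (auto simp: twist_def wedge_one_def)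

lemma contract_one [simp]: "contract v wedge_one = (\<lambda>vs. 0)"
  by (simp add: contract_def wedge_one_def)

lemma wedge_one_left [simp]: "wedge wedge_one a = a"
proof
  fix vs show "wedge wedge_one a vs = a vs"
  proof (induction vs arbitrary: a)
    case Nil show ?case by (simp add: wedge_Nil wedge_one_def)
  next
    case (Cons v vs) show ?case by (simp add: wedge_Cons Cons) (simp add: contract_def)
  qed
qed

lemma wedge_one_right [simp]: "wedge a wedge_one = a"
proof
  fix vs show "wedge a wedge_one vs = a vs"
  proof (induction vs arbitrary: a)
    case Nil show ?case by (simp add: wedge_Nil wedge_one_def)
  next
    case (Cons v vs) show ?case by (simp add: wedge_Cons Cons) (simp add: contract_def)
  qed
qed

lemma wedge_power_0 [simp]: "wedge_power a 0 = wedge_one"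
  and wedge_power_Suc: "wedge_power a (Suc k) = wedge a (wedge_power a k)"
  by (simp_all add: wedge_power_def)

lemma wedge_list_Nil [simp]: "wedge_list [] = wedge_one"
  and wedge_list_Cons [simp]: "wedge_list (a # as) = wedge a (wedge_list as)"
  by (simp_all add: wedge_list_def)


section \<open>Alternating forms\<close>

lemma alternating_length: "alternating k a \<Longrightarrow> length vs \<noteq> k \<Longrightarrow> a vs = 0"
  by (simp add: alternating_def)

lemma alternating_linear:
  "alternating k a \<Longrightarrow> length vs = k \<Longrightarrow> i < k \<Longrightarrow> linear (\<lambda>v. a (vs[i := v]))"
  by (simp add: alternating_def)

lemma alternating_eq:
  "alternating k a \<Longrightarrow> length vs = k \<Longrightarrow> i < j \<Longrightarrow> j < k \<Longrightarrow> vs ! i = vs ! j \<Longrightarrow> a vs = 0"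
  by (simp add: alternating_def)

lemma alternating_swap:
  assumes a: "alternating k a" and l: "length vs = k" and ij: "i < j" "j < k"
  shows "a (vs[i := u, j := w]) = - a (vs[i := w, j := u])"
proof -
  have li: "linear (\<lambda>v. a (vs[j := x, i := v]))" for x
    by (rule alternating_linear[OF a]) (use l ij in auto)
  have lj: "linear (\<lambda>v. a (vs[i := x, j := v]))" for x
    by (rule alternating_linear[OF a]) (use l ij in auto)
  have sw: "vs[j := x, i := y] = vs[i := y, j := x]" for x y
    using ij by (simp add: list_update_swap)
  have z: "a (vs[i := x, j := x]) = 0" for x
    using ij l by (intro alternating_eq[OF a, of _ i j]) auto
  have "a (vs[i := u + w, j := u + w]) = a (vs[i := u + w, j := u]) + a (vs[i := u + w, j := w])"
    using linear_add[OF lj] by blast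
  also have "\<dots> = a (vs[i := w, j := u]) + a (vs[i := u, j := w])"
    using linear_add[OF li, of _ u w] by (simp add: sw z)
  finally show ?thesis using z by (simp add: eq_neg_iff_add_eq_0 add.commute)
qed

lemma alternating_0: "alternating 0 a \<longleftrightarrow> (\<forall>vs. vs \<noteq> [] \<longrightarrow> a vs = 0)"
  by (auto simp: alternating_def)

lemma alternating_contract:
  assumes "alternating (Suc k) a" shows "alternating k (contract v a)"
  unfolding alternating_def contract_def
proof (intro conjI allI impI)
  fix vs :: "'a list" assume "length vs \<noteq> k" then show "a (v # vs) = 0"
    by (intro alternating_length[OF assms]) auto
next
  fix vs :: "'a list" and i assume "length vs = k" "i < k"
  then show "linear (\<lambda>u. a (v # vs[i := u]))"
    using alternating_linear[OF assms, of "v # vs" "Suc i"] by simp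
next
  fix vs :: "'a list" and i j assume "length vs = k" "i < j" "j < k" "vs ! i = vs ! j"
  then show "a (v # vs) = 0"
    by (intro alternating_eq[OF assms, of _ "Suc i" "Suc j"]) auto
qed

lemma alternating_contract_gen:
  assumes "alternating k a" shows "alternating (k - 1) (contract v a)"
proof (cases k)
  case 0 then have "contract v a = (\<lambda>vs. 0)" using assms by (simp add: alternating_0 contract_def)
  then show ?thesis using 0 by (simp add: alternating_0)
next
  case (Suc l) then show ?thesis using alternating_contract assms by auto
qed

lemma alternating_linear_head:
  assumes "alternating k a" shows "linear (\<lambda>v. a (v # vs))"
proof (cases "Suc (length vs) = k")
  case True then show ?thesis using alternating_linear[OF assms, of "undefined # vs" 0] by auto
next
  case False then have "(\<lambda>v. a (v # vs)) = (\<lambda>v. 0)" using alternating_length[OF assms] by auto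
  then show ?thesis by (simp add: linear_zero)
qed

lemma alternating_swap_head:
  assumes "alternating k a" shows "a (u # w # vs) = - a (w # u # vs)"
proof (cases "Suc (Suc (length vs)) = k")
  case True then show ?thesis using alternating_swap[OF assms, of "u # w # vs" 0 1 u w] by auto
next
  case False then show ?thesis using alternating_length[OF assms] by auto
qed

lemma alternating_head_eq:
  assumes "alternating k a" shows "a (u # u # vs) = 0"
  using alternating_swap_head[OF assms, of u u vs] by simp

lemma alternating_SucI:
  assumes n: "a [] = 0" and c: "\<And>v. alternating k (contract v a)"
    and l: "\<And>vs. linear (\<lambda>v. a (v # vs))" and e: "\<And>v vs. a (v # v # vs) = 0"
  shows "alternating (Suc k) a"
  unfolding alternating_def
proof (intro conjI allI impI)
  fix vs :: "'a list" assume "length vs \<noteq> Suc k" then show "a vs = 0"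
    using n alternating_length[OF c] by (cases vs) (auto simp: contract_def)
next
  fix vs :: "'a list" and i assume *: "length vs = Suc k" "i < Suc k"
  then obtain u us where vs: "vs = u # us" by (cases vs) auto
  show "linear (\<lambda>v. a (vs[i := v]))"
  proof (cases i)
    case 0 then show ?thesis using l vs by simp
  next
    case (Suc i') then show ?thesis using vs * alternating_linear[OF c[of u], of us i'] by (simp add: contract_def)
  qed
next
  have sw: "a (u # w # vs) = - a (w # u # vs)" for u w vs
  proof -
    have "a ((u + w) # (u + w) # vs) = a (u # (u + w) # vs) + a (w # (u + w) # vs)"
      using linear_add[OF l, of u w] by simp
    also have "\<dots> = a (u # w # vs) + a (w # u # vs)"
    proof -
      have "a (x # (u + w) # vs) = a (x # u # vs) + a (x # w # vs)" for x
        using linear_add[OF alternating_linear_head[OF c[of x], of vs], of u w] by (simp add: contract_def)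
      then show ?thesis by (simp add: e)
    qed
    finally show ?thesis by (simp add: e eq_neg_iff_add_eq_0)
  qed
  fix vs :: "'a list" and i j assume *: "length vs = Suc k" "i < j" "j < Suc k" "vs ! i = vs ! j"
  then obtain u us where vs: "vs = u # us" by (cases vs) auto
  from * obtain j' where j: "j = Suc j'" by (cases j) auto
  show "a vs = 0"
  proof (cases i)
    case (Suc i') then show ?thesis using vs j * alternating_eq[OF c[of u], of us i' j'] by (simp add: contract_def)
  next
    case 0
    then have u: "us ! j' = u" using * vs j by simp
    have len: "length us = k" "j' < k" using * vs j by auto
    show ?thesis
    proof (cases j')
      case 0 then show ?thesis using vs u len e by (cases us) auto
    next
      case (Suc j'')
      \<comment> \<open>The second copy of \<open>u\<close> sits further down the tail. Exchanging
        it with the first entry of the tail, at the cost of a sign, puts it next to the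
        head.\<close>
      have us: "us = us[0 := us ! 0, j' := u]" by (simp add: u[symmetric])
      have "a (u # us) = - a (u # us[0 := u, j' := us ! 0])"
        using alternating_swap[OF c[of u], of us 0 j' "us ! 0" u] len Suc us by (simp add: contract_def)
      moreover obtain w ws where "us = w # ws" using len by (cases us) auto
      ultimately show ?thesis using vs Suc e by simp
    qed
  qed
qed

lemma alternating_add: "alternating k a \<Longrightarrow> alternating k b \<Longrightarrow> alternating k (\<lambda>vs. a vs + b vs)"
  by (auto simp: alternating_def intro!: linear_compose_add)

lemma alternating_scale: "alternating k a \<Longrightarrow> alternating k (\<lambda>vs. z * a vs)"
  unfolding alternating_def
  using linear_compose[OF _ bounded_linear.linear[OF bounded_linear_mult_right[of z]]] by (auto simp: o_def)

lemma alternating_minus: "alternating k a \<Longrightarrow> alternating k (\<lambda>vs. - a vs)"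
  using alternating_scale[of k a "-1"] by simp

lemma alternating_zero [simp]: "alternating k (\<lambda>vs. 0)"
  by (simp add: alternating_def linear_zero)

lemma alternating_twist: "alternating k a \<Longrightarrow> twist a = (\<lambda>vs. (- 1) ^ k * a vs)"
  unfolding twist_def using alternating_length by (metis mult_zero_right)

lemma alternating_map:
  assumes "alternating k a" "linear f" shows "alternating k (\<lambda>vs. a (map f vs))"
proof -
  have "linear (\<lambda>v. a (map f (vs[i := v])))" if "length vs = k" "i < k" for vs i
    using linear_compose[OF assms(2) alternating_linear[OF assms(1), of "map f vs" i]] that
    by (simp add: map_update o_def)
  then show ?thesis using assms(1) unfolding alternating_def by auto
qed

lemma wedge_linear_head:
  assumes "\<And>vs. linear (\<lambda>v. a (v # vs))" "\<And>vs. linear (\<lambda>v. b (v # vs))"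
  shows "linear (\<lambda>v. wedge a b (v # vs))"
proof -
  have "wedge a b (v # vs) = (\<Sum>I\<in>Pow {..<length vs}. shuffle_sign I (length vs) * b (nths vs (- I)) * a (v # nths vs I))
    + (\<Sum>I\<in>Pow {..<length vs}. shuffle_sign I (length vs) * twist a (nths vs I) * b (v # nths vs (- I)))" for v
    unfolding wedge_Cons by (simp add: wedge_def contract_def mult_ac)
  moreover have "linear (\<lambda>v. z * f v)" if "linear f" for z and f :: "'a \<Rightarrow> complex"
    using linear_compose[OF that bounded_linear.linear[OF bounded_linear_mult_right[of z]]] by (simp add: o_def)
  ultimately show ?thesis
    using assms by (auto intro!: linear_compose_add linear_compose_sum)
qed

text \<open>Induction on the total degree, because each Leibniz term of a contraction lowers the
  degree of just one factor.\<close>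

lemma alternating_wedge:
  assumes "alternating k a" "alternating l b" shows "alternating (k + l) (wedge a b)"
  using assms
proof (induction "k + l" arbitrary: k l a b)
  case 0
  then have a: "alternating 0 a" "alternating 0 b" by auto
  then have "contract v a = (\<lambda>vs. 0)" "contract v b = (\<lambda>vs. 0)" for v
    by (auto simp: alternating_0 contract_def)
  then have "wedge a b (v # vs) = 0" for v vs by (simp add: wedge_Cons)
  then show ?case using 0 by (auto simp: alternating_0 neq_Nil_conv)
next
  case (Suc m)
  have tw: "alternating j (twist c)" if "alternating j c" for j and c :: "'a cform"
    using alternating_scale[OF that] by (simp add: alternating_twist[OF that])
  have c: "alternating m (contract v (wedge a b))" for v
  proof -
    have "alternating m (wedge (contract v a) b)"
    proof (cases k)
      case 0 then have "contract v a = (\<lambda>vs. 0)" using Suc.prems by (simp add: alternating_0 contract_def)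
      then show ?thesis by simp
    next
      case (Suc k') then show ?thesis
        using Suc.hyps(1)[of k' l "contract v a" b] Suc.hyps(2) Suc.prems alternating_contract by auto
    qed
    moreover have "alternating m (wedge (twist a) (contract v b))"
    proof (cases l)
      case 0 then have "contract v b = (\<lambda>vs. 0)" using Suc.prems by (simp add: alternating_0 contract_def)
      then show ?thesis by simp
    next
      case (Suc l') then show ?thesis
        using Suc.hyps(1)[of k l' "twist a" "contract v b"] Suc.hyps(2) Suc.prems alternating_contract tw by auto
    qed
    ultimately show ?thesis unfolding contract_wedge by (rule alternating_add)
  qed
  have "alternating (Suc m) (wedge a b)"
  proof (rule alternating_SucI[OF _ c])
    have "k \<noteq> 0 \<or> l \<noteq> 0" using Suc.hyps(2) by auto
    then show "wedge a b [] = 0" using Suc.prems alternating_length[of k a "[]"] alternating_length[of l b "[]"]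
      by (auto simp: wedge_Nil)
    show "linear (\<lambda>v. wedge a b (v # vs))" for vs
      using Suc.prems by (intro wedge_linear_head alternating_linear_head)
    \<comment> \<open>The two mixed terms carry \<open>twist (contract v a)\<close> and
      \<open>contract v (twist a)\<close>, which differ by a sign, and cancel.\<close>
    show "wedge a b (v # v # vs) = 0" for v vs
    proof -
      have z: "contract v (contract v a) = (\<lambda>vs. 0)" "contract v (contract v b) = (\<lambda>vs. 0)"
        using Suc.prems by (auto simp: contract_def alternating_head_eq)
      show ?thesis
        by (simp add: wedge_Cons contract_wedge z wedge_add_left contract_twist wedge_minus_left)
    qed
  qed
  then show ?case using Suc.hyps(2) by simp
qed

lemma alternating_one [simp]: "alternating 0 wedge_one"
  by (simp add: alternating_0 wedge_one_def)

lemma alternating_wedge_power: "alternating k a \<Longrightarrow> alternating (m * k) (wedge_power a m)"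
  by (induction m) (auto simp: wedge_power_Suc intro: alternating_wedge)

lemma alternating_move:
  assumes "alternating k a" "i < length vs"
  shows "a (u # take i vs @ drop (Suc i) vs) = (- 1) ^ i * a (vs[i := u])"
  using assms
proof (induction i arbitrary: k a vs)
  case 0 then show ?case by (cases vs) auto
next
  case (Suc i)
  then obtain w ws where vs: "vs = w # ws" by (cases vs) auto
  have "a (u # take (Suc i) vs @ drop (Suc (Suc i)) vs) = - contract w a (u # take i ws @ drop (Suc i) ws)"
    using alternating_swap_head[OF Suc.prems(1), of u w] vs by (simp add: contract_def)
  also have "\<dots> = - ((- 1) ^ i * contract w a (ws[i := u]))"
    using Suc.IH[OF alternating_contract_gen[OF Suc.prems(1)], of ws w] Suc.prems vs by simp
  finally show ?case using vs by (simp add: contract_def)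
qed

subsection \<open>Bidegrees\<close>

lemma alternating_head_add:
  "alternating k a \<Longrightarrow> a ((u + v) # vs) = a (u # vs) + a (v # vs)"
  using linear_add[OF alternating_linear_head] by blast

lemma alternating_head_scale:
  "alternating k a \<Longrightarrow> a ((c *\<^sub>R v) # vs) = c *\<^sub>R a (v # vs)"
  using linear_cmul[OF alternating_linear_head] by blast

lemma alternating_head_sum:
  "alternating k a \<Longrightarrow> a (sum f I # vs) = (\<Sum>i\<in>I. a (f i # vs))"
  using linear_sum[OF alternating_linear_head] by blast

definition covec :: "('v \<Rightarrow> complex) \<Rightarrow> 'v cform" where
  "covec f vs = (case vs of [v] \<Rightarrow> f v | _ \<Rightarrow> 0)"

lemma covec_simps [simp]:
  "covec f [] = 0" "covec f [v] = f v" "covec f (u # v # vs) = 0"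
  by (simp_all add: covec_def)

lemma covec_length: "length vs \<noteq> 1 \<Longrightarrow> covec f vs = 0"
  by (auto simp: covec_def split: list.split)

lemma alternating_1: "alternating 1 a \<longleftrightarrow> (\<forall>vs. length vs \<noteq> 1 \<longrightarrow> a vs = 0) \<and> linear (\<lambda>v. a [v])"
proof
  assume a: "alternating 1 a"
  then show "(\<forall>vs. length vs \<noteq> 1 \<longrightarrow> a vs = 0) \<and> linear (\<lambda>v. a [v])"
    using alternating_linear_head[OF a, of "[]"] alternating_length[OF a] by auto
next
  assume a: "(\<forall>vs. length vs \<noteq> 1 \<longrightarrow> a vs = 0) \<and> linear (\<lambda>v. a [v])"
  have "linear (\<lambda>v. a (v # vs))" for vs
    using a by (cases vs) (auto simp: linear_zero)
  then have "alternating (Suc 0) a"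
    using a by (intro alternating_SucI) (auto simp: alternating_0 contract_def)
  then show "alternating 1 a" by simp
qed

lemma alternating_covec: "linear f \<Longrightarrow> alternating 1 (covec f)"
  unfolding alternating_1 by (auto simp: covec_length)

lemma wedge_covectors_swap:
  assumes a: "alternating 1 a" and b: "alternating 1 b"
  shows "wedge a b vs = - wedge b a vs"
proof (cases "length vs = 2")
  case True
  then obtain u v where vs: "vs = [u, v]" by (metis (no_types, lifting) One_nat_def Suc_1 length_0_conv length_Suc_conv)
  have z: "a [] = 0" "b [] = 0" "a [x, y] = 0" "b [x, y] = 0" for x y
    using alternating_length[OF a] alternating_length[OF b] by auto
  show ?thesis by (simp add: vs wedge_Cons wedge_Nil contract_def twist_def z)
next
  case False
  then show ?thesis
    using alternating_length[OF alternating_wedge[OF a b]] alternating_length[OF alternating_wedge[OF b a]] by simp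
qed

lemma alternating_wedge_list:
  "\<forall>a\<in>set as. alternating 1 a \<Longrightarrow> alternating (length as) (wedge_list as)"
proof (induction as)
  case (Cons a as)
  then show ?case using alternating_wedge[of 1 a "length as" "wedge_list as"] by simp
qed simp

text \<open>\<open>bidegree\<close> lists the covectors of type (1, 0) first, so a further covector
  of type (0, 1) has to be carried past them.\<close>

lemma wedge_covector_list:
  assumes "alternating 1 c" "\<forall>a\<in>set as. alternating 1 a"
  shows "wedge c (wedge_list (as @ bs)) = (\<lambda>vs. (- 1) ^ length as * wedge_list (as @ c # bs) vs)"
  using assms(2)
proof (induction as)
  case (Cons a as)
  have "wedge c a = (\<lambda>vs. - wedge a c vs)"
    using wedge_covectors_swap[OF assms(1), of a] Cons.prems by auto
  then have "wedge c (wedge_list ((a # as) @ bs)) = wedge (\<lambda>vs. - wedge a c vs) (wedge_list (as @ bs))"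
    by (simp add: wedge_assoc[symmetric])
  also have "\<dots> = (\<lambda>vs. - wedge a (wedge c (wedge_list (as @ bs))) vs)"
    by (simp add: wedge_minus_left wedge_assoc fun_eq_iff)
  also have "\<dots> = (\<lambda>vs. (- 1) ^ length (a # as) * wedge_list ((a # as) @ c # bs) vs)"
    using Cons by (simp add: wedge_scale_right)
  finally show ?case .
qed simp

lemma bidegree_add:
  assumes "bidegree J p q a" "bidegree J p q b" shows "bidegree J p q (\<lambda>vs. a vs + b vs)"
  using assms(1)
proof induction
  case zero then show ?case using assms(2) by simp
next
  case (add_product a as bs z)
  then show ?case using bidegree.add_product[of J p q "\<lambda>vs. a vs + b vs" as bs z] by (simp add: add.assoc)
qed

lemma bidegree_scale:
  assumes "bidegree J p q a" shows "bidegree J p q (\<lambda>vs. c * a vs)"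
  using assms
proof induction
  case zero then show ?case using bidegree.zero by simp
next
  case (add_product a as bs z)
  then show ?case using bidegree.add_product[of J p q "\<lambda>vs. c * a vs" as bs "c * z"]
    by (simp add: algebra_simps)
qed

lemma bidegree_wedge_list:
  assumes "\<forall>a\<in>set as. covector10 J a" "\<forall>a\<in>set bs. covector01 J a"
  shows "bidegree J (int (length as)) (int (length bs)) (\<lambda>vs. z * wedge_list (as @ bs) vs)"
  using bidegree.add_product[OF bidegree.zero refl refl assms, of z] by simp

lemma bidegree_wedge_covector10:
  assumes "bidegree J p q b" "covector10 J a" shows "bidegree J (p + 1) q (wedge a b)"
  using assms(1)
proof induction
  case zero then show ?case using bidegree.zero by simp
next
  case (add_product b as bs z)
  then show ?case using bidegree.add_product[of J "p + 1" q "wedge a b" "a # as" bs z] assms(2)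
    by (simp add: wedge_add_right wedge_scale_right fun_eq_iff)
qed

lemma bidegree_wedge_covector01:
  assumes "bidegree J p q b" "covector01 J a" shows "bidegree J p (q + 1) (wedge a b)"
  using assms(1)
proof induction
  case zero then show ?case using bidegree.zero by simp
next
  case (add_product b as bs z)
  have "wedge a (wedge_list (as @ bs)) = (\<lambda>vs. (- 1) ^ length as * wedge_list (as @ a # bs) vs)"
    by (rule wedge_covector_list) (use assms(2) add_product in \<open>auto simp: covector01_def covector10_def\<close>)
  then show ?case
    using bidegree.add_product[of J p "q + 1" "wedge a b" as "a # bs" "z * (- 1) ^ length as"] assms(2) add_product
    by (simp add: wedge_add_right wedge_scale_right fun_eq_iff algebra_simps)
qed

lemma bidegree_alternating: "bidegree J p q a \<Longrightarrow> alternating (nat (p + q)) a"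
proof (induction rule: bidegree.induct)
  case (add_product b as bs z)
  have "alternating (length (as @ bs)) (wedge_list (as @ bs))"
    by (rule alternating_wedge_list) (use add_product in \<open>auto simp: covector01_def covector10_def\<close>)
  moreover have "length (as @ bs) = nat (p + q)" using add_product by auto
  ultimately show ?case using add_product by (auto intro!: alternating_add alternating_scale)
qed simp

section \<open>The circle action and its weights\<close>

text \<open>Multiplication by \<open>cis \<theta>\<close>, with \<open>J\<close> in the role of the
  imaginary unit.\<close>

definition rot :: "('v \<Rightarrow> 'v) \<Rightarrow> real \<Rightarrow> 'v \<Rightarrow> 'v::real_vector" where
  "rot J \<theta> v = cos \<theta> *\<^sub>R v + sin \<theta> *\<^sub>R J v"

text \<open>Forms of bidegree \<open>(p, q)\<close> are eigenvectors of weight \<open>p - q\<close> of the circle action.\<close>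

definition weight :: "('v \<Rightarrow> 'v) \<Rightarrow> int \<Rightarrow> 'v::real_vector cform \<Rightarrow> bool" where
  "weight J w a \<longleftrightarrow> (\<forall>\<theta> vs. a (map (rot J \<theta>) vs) = cis (of_int w * \<theta>) * a vs)"

lemma weight_one: "weight J 0 wedge_one"
  by (auto simp: weight_def wedge_one_def)

lemma weight_add: "weight J w a \<Longrightarrow> weight J w b \<Longrightarrow> weight J w (\<lambda>vs. a vs + b vs)"
  by (simp add: weight_def algebra_simps)

lemma weight_scale: "weight J w a \<Longrightarrow> weight J w (\<lambda>vs. z * a vs)"
  by (simp add: weight_def algebra_simps)

lemma weight_zero [simp]: "weight J w (\<lambda>vs. 0)"
  by (simp add: weight_def)

lemma weight_wedge:
  assumes "weight J w a" "weight J w' b" shows "weight J (w + w') (wedge a b)"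
  unfolding weight_def
proof (intro allI)
  fix \<theta> :: real and vs :: "'a list"
  have "wedge a b (map (rot J \<theta>) vs) = wedge (\<lambda>vs. cis (w * \<theta>) * a vs) (\<lambda>vs. cis (w' * \<theta>) * b vs) vs"
    using assms by (simp add: wedge_map weight_def)
  also have "\<dots> = cis (w * \<theta>) * cis (w' * \<theta>) * wedge a b vs"
    by (simp add: wedge_scale_left wedge_scale_right)
  also have "cis (w * \<theta>) * cis (w' * \<theta>) = cis (of_int (w + w') * \<theta>)"
    by (simp add: cis_mult algebra_simps)
  finally show "wedge a b (map (rot J \<theta>) vs) = cis (of_int (w + w') * \<theta>) * wedge a b vs" .
qed

lemma weight_covector10: assumes "covector10 J a" shows "weight J 1 a"
  unfolding weight_def
proof (intro allI)
  fix \<theta> vs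
  have a: "alternating 1 a" using assms by (simp add: covector10_def)
  show "a (map (rot J \<theta>) vs) = cis (of_int 1 * \<theta>) * a vs"
  proof (cases "length vs = 1")
    case True then obtain v where vs: "vs = [v]" by (cases vs) auto
    have "a [rot J \<theta> v] = cos \<theta> *\<^sub>R a [v] + sin \<theta> *\<^sub>R a [J v]"
      unfolding rot_def by (simp add: alternating_head_add[OF a] alternating_head_scale[OF a])
    also have "\<dots> = cis \<theta> * a [v]" using assms by (simp add: covector10_def cis.ctr complex_eq_iff)
    finally show ?thesis by (simp add: vs)
  next
    case False then show ?thesis using a alternating_1[of a] by simp
  qed
qed

lemma weight_covector01: assumes "covector01 J a" shows "weight J (- 1) a"
  unfolding weight_def
proof (intro allI)
  fix \<theta> vs
  have a: "alternating 1 a" using assms by (simp add: covector01_def)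
  show "a (map (rot J \<theta>) vs) = cis (of_int (- 1) * \<theta>) * a vs"
  proof (cases "length vs = 1")
    case True then obtain v where vs: "vs = [v]" by (cases vs) auto
    have "a [rot J \<theta> v] = cos \<theta> *\<^sub>R a [v] + sin \<theta> *\<^sub>R a [J v]"
      unfolding rot_def by (simp add: alternating_head_add[OF a] alternating_head_scale[OF a])
    also have "\<dots> = cis (- \<theta>) * a [v]" using assms by (simp add: covector01_def cis.ctr complex_eq_iff)
    finally show ?thesis by (simp add: vs)
  next
    case False then show ?thesis using a alternating_1[of a] by simp
  qed
qed

lemma weight_wedge_list10: "\<forall>a\<in>set as. covector10 J a \<Longrightarrow> weight J (int (length as)) (wedge_list as)"
  by (induction as) (auto simp: weight_one dest!: weight_covector10 intro: weight_wedge)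

lemma weight_wedge_list01: "\<forall>a\<in>set as. covector01 J a \<Longrightarrow> weight J (- int (length as)) (wedge_list as)"
proof (induction as)
  case (Cons a as)
  then show ?case using weight_wedge[of J "-1" a "- int (length as)" "wedge_list as"] weight_covector01[of J a] by simp
qed (simp add: weight_one)

lemma wedge_list_append: "wedge_list (as @ bs) = wedge (wedge_list as) (wedge_list bs)"
  by (induction as) (auto simp: wedge_assoc)

lemma bidegree_weight: "bidegree J p q a \<Longrightarrow> weight J (p - q) a"
proof (induction rule: bidegree.induct)
  case (add_product b as bs z)
  then have "weight J (p - q) (wedge_list (as @ bs))"
    using weight_wedge[OF weight_wedge_list10 weight_wedge_list01, of as J bs] by (simp add: wedge_list_append)
  with add_product show ?case by (intro weight_add weight_scale)
qed simp

lemma infinite_unit_circle: "infinite (range (\<lambda>\<theta>. cis (2 * \<theta>)))"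
proof
  assume "finite (range (\<lambda>\<theta>. cis (2 * \<theta>)))"
  then have "finite (Re ` range (\<lambda>\<theta>. cis (2 * \<theta>)))" by simp
  moreover have "{-1..1} \<subseteq> Re ` range (\<lambda>\<theta>. cis (2 * \<theta>))"
  proof
    fix x :: real assume "x \<in> {-1..1}"
    then have "x = Re (cis (2 * (arccos x / 2)))" by simp
    then show "x \<in> Re ` range (\<lambda>\<theta>. cis (2 * \<theta>))" by blast
  qed
  ultimately show False using finite_subset[of "{-1..1::real}"] infinite_Icc[of "-1::real" 1] by simp
qed

text \<open>At arguments rotated by \<open>\<theta>\<close>, and after multiplication by
  \<open>cis (k * \<theta>)\<close>, the sum becomes a polynomial of degree at most \<open>k\<close>
  in \<open>z = cis (2 * \<theta>)\<close> with the values \<open>D r vs\<close> as coefficients. It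
  has infinitely many zeros, so its coefficients vanish.\<close>

lemma weights_independent:
  assumes D: "\<And>r. r \<in> {0..int k} \<Longrightarrow> weight J (2 * r - int k) (D r)"
    and s: "\<And>vs. (\<Sum>r\<in>{0..int k}. D r vs) = 0" and r: "r \<in> {0..int k}"
  shows "D r vs = 0"
proof -
  have bij: "bij_betw int {..k} {0..int k}"
    by (rule bij_betwI[where g=nat]) auto
  have "(\<Sum>i\<le>k. D (int i) vs * z ^ i) = 0" if "z \<in> range (\<lambda>\<theta>. cis (2 * \<theta>))" for z
  proof -
    obtain \<theta> where z: "z = cis (2 * \<theta>)" using \<open>z \<in> _\<close> by auto
    have "(\<Sum>i\<le>k. D (int i) vs * z ^ i) = (\<Sum>i\<le>k. cis (k * \<theta>) * D (int i) (map (rot J \<theta>) vs))"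
    proof (rule sum.cong)
      fix i assume "i \<in> {..k}"
      then have "D (int i) (map (rot J \<theta>) vs) = cis (of_int (2 * int i - int k) * \<theta>) * D (int i) vs"
        using D[of "int i"] by (simp add: weight_def)
      then show "D (int i) vs * z ^ i = cis (k * \<theta>) * D (int i) (map (rot J \<theta>) vs)"
        by (simp add: z Complex.DeMoivre cis_mult flip: mult.assoc) (simp add: algebra_simps)
    qed simp
    also have "\<dots> = cis (k * \<theta>) * (\<Sum>r\<in>{0..int k}. D r (map (rot J \<theta>) vs))"
      using sum.reindex_bij_betw[OF bij, of "\<lambda>r. D r (map (rot J \<theta>) vs)"] by (simp flip: sum_distrib_left)
    finally show ?thesis using s by simp
  qed
  then have "range (\<lambda>\<theta>. cis (2 * \<theta>)) \<subseteq> {z. (\<Sum>i\<le>k. D (int i) vs * z ^ i) = 0}" by auto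
  then have "infinite {z. (\<Sum>i\<le>k. D (int i) vs * z ^ i) = 0}"
    using infinite_unit_circle finite_subset by blast
  then have "\<forall>i\<le>k. D (int i) vs = 0" using polyfun_finite_roots[of "\<lambda>i. D (int i) vs" k] by auto
  moreover have "nat r \<le> k" "r = int (nat r)" using r by auto
  ultimately show ?thesis by metis
qed

section \<open>Existence and uniqueness of the bidegree decomposition\<close>

text \<open>The witnesses over which the definite description in \<open>component\<close> ranges,
  kept apart so that their existence and their uniqueness can be proved separately.\<close>

definition bidegree_parts :: "('v \<Rightarrow> 'v) \<Rightarrow> nat \<Rightarrow> 'v::real_vector cform \<Rightarrow> (int \<Rightarrow> 'v cform) \<Rightarrow> bool" where
  "bidegree_parts J k a D \<longleftrightarrow> (\<forall>r\<in>{0..int k}. bidegree J r (int k - r) (D r)) \<and>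
     a = (\<lambda>vs. \<Sum>r\<in>{0..int k}. D r vs)"

lemma bidegree_parts_unique:
  assumes "bidegree_parts J k a D" "bidegree_parts J k a D'" "r \<in> {0..int k}"
  shows "D r = D' r"
proof
  fix vs
  have *: "2 * r - int k = r - (int k - r)" for r by simp
  have w: "weight J (2 * r - int k) (D r)" "weight J (2 * r - int k) (D' r)" if "r \<in> {0..int k}" for r
    unfolding *
    using assms(1,2) that bidegree_weight[of J r "int k - r"] by (auto simp: bidegree_parts_def)
  have "D r vs + (- 1) * D' r vs = 0"
  proof (rule weights_independent[where J=J and D="\<lambda>r vs. D r vs + (- 1) * D' r vs", OF _ _ assms(3)])
    show "(\<Sum>r\<in>{0..int k}. D r vs + (- 1) * D' r vs) = 0" for vs
      using assms(1,2) by (simp add: bidegree_parts_def sum_subtractf fun_eq_iff)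
  qed (intro weight_add weight_scale w)
  then show "D r vs = D' r vs" by simp
qed

lemma component_eq:
  assumes D: "bidegree_parts J k a D" and p: "p \<in> {0..int k}" "p + q = int k"
  shows "component J p q a = D p"
  unfolding component_def
proof (rule the_equality)
  show "bidegree J p q (D p) \<and> (\<exists>D'. (\<forall>r\<in>{0..p + q}. bidegree J r (p + q - r) (D' r)) \<and>
          D' p = D p \<and> a = (\<lambda>vs. \<Sum>r\<in>{0..p + q}. D' r vs))"
  proof -
    have q: "q = int k - p" using p by simp
    have "bidegree J p q (D p)" unfolding q using D p by (auto simp: bidegree_parts_def)
    then show ?thesis unfolding p(2) using D by (auto simp: bidegree_parts_def intro!: exI[of _ D])
  qed
next
  fix b assume "bidegree J p q b \<and> (\<exists>D'. (\<forall>r\<in>{0..p + q}. bidegree J r (p + q - r) (D' r)) \<and>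
          D' p = b \<and> a = (\<lambda>vs. \<Sum>r\<in>{0..p + q}. D' r vs))"
  then obtain D' where "bidegree_parts J k a D'" "D' p = b" unfolding bidegree_parts_def p(2) by auto
  then show "b = D p" using bidegree_parts_unique[OF D] p by auto
qed

lemma bidegree_parts_add:
  "bidegree_parts J k a D \<Longrightarrow> bidegree_parts J k b E \<Longrightarrow>
   bidegree_parts J k (\<lambda>vs. a vs + b vs) (\<lambda>r vs. D r vs + E r vs)"
  by (auto simp: bidegree_parts_def sum.distrib intro: bidegree_add)

lemma bidegree_parts_scale:
  "bidegree_parts J k a D \<Longrightarrow> bidegree_parts J k (\<lambda>vs. z * a vs) (\<lambda>r vs. z * D r vs)"
  by (auto simp: bidegree_parts_def sum_distrib_left intro: bidegree_scale)

lemma bidegree_parts_sum: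
  "(\<And>i. i \<in> I \<Longrightarrow> \<exists>D. bidegree_parts J k (a i) D) \<Longrightarrow> \<exists>D. bidegree_parts J k (\<lambda>vs. \<Sum>i\<in>I. a i vs) D"
proof (induction I rule: infinite_finite_induct)
  case (insert i I)
  then show ?case using bidegree_parts_add[of J k "a i" _ "\<lambda>vs. \<Sum>i\<in>I. a i vs"] by fastforce
qed (auto simp: bidegree_parts_def intro!: exI[of _ "\<lambda>r vs. 0"] bidegree.zero)

lemma bidegree_parts_wedge10:
  assumes "bidegree_parts J k a D" "covector10 J e"
  shows "bidegree_parts J (Suc k) (wedge e a) (\<lambda>r. if 1 \<le> r then wedge e (D (r - 1)) else (\<lambda>vs. 0))"
  unfolding bidegree_parts_def
proof (intro conjI ballI ext)
  fix r assume r: "r \<in> {0..int (Suc k)}"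
  show "bidegree J r (int (Suc k) - r) (if 1 \<le> r then wedge e (D (r - 1)) else (\<lambda>vs. 0))"
  proof (cases "1 \<le> r")
    case True
    have "bidegree J (r - 1) (int k - (r - 1)) (D (r - 1))"
      using assms(1) r True by (auto simp: bidegree_parts_def)
    from bidegree_wedge_covector10[OF this assms(2)] show ?thesis using True by (simp add: algebra_simps)
  qed (simp add: bidegree.zero)
next
  fix vs
  have "{0..int (Suc k)} = insert 0 ((\<lambda>r. r + 1) ` {0..int k})"
    by (auto simp: image_add_atLeastAtMost')
  moreover have "inj_on (\<lambda>r. r + 1) {0..int k}" "0 \<notin> (\<lambda>r. r + 1) ` {0..int k}" by (auto simp: inj_on_def)
  ultimately show "wedge e a vs = (\<Sum>r\<in>{0..int (Suc k)}. (if 1 \<le> r then wedge e (D (r - 1)) else (\<lambda>vs. 0)) vs)"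
    using assms(1) by (simp add: sum.reindex bidegree_parts_def wedge_sum_right del: image_add_atLeastAtMost')
qed

lemma bidegree_parts_wedge01:
  assumes "bidegree_parts J k a D" "covector01 J e"
  shows "bidegree_parts J (Suc k) (wedge e a) (\<lambda>r. if r \<le> int k then wedge e (D r) else (\<lambda>vs. 0))"
  unfolding bidegree_parts_def
proof (intro conjI ballI ext)
  fix r assume r: "r \<in> {0..int (Suc k)}"
  show "bidegree J r (int (Suc k) - r) (if r \<le> int k then wedge e (D r) else (\<lambda>vs. 0))"
    using assms(1) r bidegree_wedge_covector01[OF _ assms(2), of r "int k - r" "D r"]
    by (auto simp: bidegree_parts_def algebra_simps intro: bidegree.zero)
next
  fix vs
  have "{0..int (Suc k)} = insert (int k + 1) {0..int k}" by auto
  then show "wedge e a vs = (\<Sum>r\<in>{0..int (Suc k)}. (if r \<le> int k then wedge e (D r) else (\<lambda>vs. 0)) vs)"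
    using assms(1) by (simp add: bidegree_parts_def wedge_sum_right)
qed

text \<open>Contracting with a basis vector and multiplying by its dual covector, summed over the
  basis, is the operator that counts the degree. It writes a form of positive degree as a
  combination of covectors times forms of lower degree.\<close>

lemma euler_contract:
  fixes a :: "'v::euclidean_space cform"
  assumes "alternating k a"
  shows "(\<Sum>e\<in>Basis. wedge (covec (\<lambda>v. complex_of_real (v \<bullet> e))) (contract e a) vs) = of_nat k * a vs"
  using assms
proof (induction vs arbitrary: k a)
  case Nil then show ?case using alternating_length[of k a "[]"] by (cases k) (auto simp: wedge_Nil)
next
  case (Cons v vs)
  let ?E = "\<lambda>e. covec (\<lambda>v. complex_of_real (v \<bullet> e))"
  have cE: "contract v (?E e) = (\<lambda>vs. complex_of_real (v \<bullet> e) * wedge_one vs)" for e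
    by (auto simp: contract_def wedge_one_def covec_def fun_eq_iff split: list.split)
  have tE: "twist (?E e) = (\<lambda>vs. - ?E e vs)" for e
    by (auto simp: twist_def covec_def fun_eq_iff split: list.split)
  have cc: "contract v (contract e a) = (\<lambda>vs. - contract e (contract v a) vs)" for e
    unfolding contract_def using alternating_swap_head[OF Cons.prems, of e v] by auto
  \<comment> \<open>Either the covector meets \<open>v\<close>, and the sum over \<open>e\<close>
    restores \<open>a (v # vs)\<close>, or it does not: then the sign from \<open>twist\<close> and
    the one from exchanging the contractions cancel, and the identity in degree \<open>k - 1\<close>
    applies to \<open>contract v a\<close>.\<close>
  have "wedge (?E e) (contract e a) (v # vs) = (v \<bullet> e) * a (e # vs) + wedge (?E e) (contract e (contract v a)) vs" for e
    by (simp add: wedge_Cons cE tE cc wedge_scale_left wedge_minus_left wedge_minus_right) (simp add: contract_def)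
  then have "(\<Sum>e\<in>Basis. wedge (?E e) (contract e a) (v # vs))
     = (\<Sum>e\<in>Basis. (v \<bullet> e) * a (e # vs)) + of_nat (k - 1) * contract v a vs"
    using Cons.IH[OF alternating_contract_gen[OF Cons.prems]] by (simp add: sum.distrib)
  also have "(\<Sum>e\<in>Basis. (v \<bullet> e) * a (e # vs)) = a ((\<Sum>e\<in>Basis. (v \<bullet> e) *\<^sub>R e) # vs)"
    by (simp add: alternating_head_sum[OF Cons.prems] alternating_head_scale[OF Cons.prems] scaleR_conv_of_real)
  also have "\<dots> = a (v # vs)" by (simp add: euclidean_representation)
  finally show ?case
    using alternating_length[OF Cons.prems, of "v # vs"] by (cases k) (auto simp: contract_def algebra_simps)
qed

text \<open>The projections of a complex-valued covector to the eigenspaces of composition with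
  \<open>J\<close>, for the eigenvalues \<open>\<i>\<close> and \<open>- \<i>\<close>.\<close>

lemma covec_split:
  assumes "linear J" "\<And>v. J (J v) = - v" and f: "linear (f :: 'v::real_vector \<Rightarrow> complex)"
  shows "covector10 J (covec (\<lambda>v. (f v - \<i> * f (J v)) / 2))"
    and "covector01 J (covec (\<lambda>v. (f v + \<i> * f (J v)) / 2))"
proof -
  have fJ: "linear (\<lambda>v. f (J v))" using linear_compose[OF assms(1) f] by (simp add: o_def)
  have m: "linear (\<lambda>v. c * g v)" if "linear g" for c and g :: "'v \<Rightarrow> complex"
    using linear_compose[OF that bounded_linear.linear[OF bounded_linear_mult_right[of c]]] by (simp add: o_def)
  have "linear (\<lambda>v. (1/2) * f v + (- \<i>/2) * f (J v))" "linear (\<lambda>v. (1/2) * f v + (\<i>/2) * f (J v))"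
    by (intro linear_compose_add m f fJ)+
  then have "linear (\<lambda>v. (f v - \<i> * f (J v)) / 2)" "linear (\<lambda>v. (f v + \<i> * f (J v)) / 2)"
    by (simp_all add: diff_divide_distrib add_divide_distrib)
  then show "covector10 J (covec (\<lambda>v. (f v - \<i> * f (J v)) / 2))"
    "covector01 J (covec (\<lambda>v. (f v + \<i> * f (J v)) / 2))"
    using linear_neg[OF f] unfolding covector10_def covector01_def
    by (simp_all add: alternating_covec assms(2) diff_divide_distrib add_divide_distrib ring_distribs del: One_nat_def)
qed

text \<open>By \<open>euler_contract\<close> a form of degree \<open>Suc k\<close> is, up to the
  factor \<open>Suc k\<close>, a sum of covectors times forms of degree \<open>k\<close>. Splitting
  each covector by type raises the bidegrees of the parts of the contracted form by one in
  \<open>p\<close> or in \<open>q\<close>.\<close>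

lemma bidegree_parts_exists:
  fixes a :: "'v::euclidean_space cform"
  assumes J: "linear J" "\<And>v. J (J v) = - v" and "alternating k a"
  shows "\<exists>D. bidegree_parts J k a D"
  using assms(3)
proof (induction k arbitrary: a)
  case 0
  have "a = (\<lambda>vs. a [] * wedge_one vs)" using 0 by (auto simp: alternating_0 wedge_one_def)
  moreover have "bidegree J 0 0 (\<lambda>vs. a [] * wedge_one vs)"
    using bidegree_wedge_list[of "[]" J "[]" "a []"] by simp
  ultimately show ?case by (intro exI[of _ "\<lambda>r. a"]) (simp add: bidegree_parts_def)
next
  case (Suc k)
  let ?E = "\<lambda>e. covec (\<lambda>v. complex_of_real (v \<bullet> e))"
  have "\<exists>D. bidegree_parts J (Suc k) (wedge (?E e) (contract e a)) D" for e
  proof -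
    let ?f = "\<lambda>v. complex_of_real (v \<bullet> e)"
    have f: "linear ?f"
      by (intro linearI) (auto simp: inner_add_left scaleR_conv_of_real)
    define e10 where "e10 = covec (\<lambda>v. (?f v - \<i> * ?f (J v)) / 2)"
    define e01 where "e01 = covec (\<lambda>v. (?f v + \<i> * ?f (J v)) / 2)"
    have E: "?E e = (\<lambda>vs. e10 vs + e01 vs)"
      unfolding e10_def e01_def by (auto simp: fun_eq_iff covec_def field_simps split: list.split)
    have "covector10 J e10" "covector01 J e01"
      using covec_split[OF J f] unfolding e10_def e01_def by auto
    moreover obtain D where "bidegree_parts J k (contract e a) D"
      using Suc.IH[OF alternating_contract[OF Suc.prems]] by blast
    ultimately have "bidegree_parts J (Suc k) (\<lambda>vs. wedge e10 (contract e a) vs + wedge e01 (contract e a) vs)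
      (\<lambda>r vs. (if 1 \<le> r then wedge e10 (D (r - 1)) else (\<lambda>vs. 0)) vs + (if r \<le> int k then wedge e01 (D r) else (\<lambda>vs. 0)) vs)"
      by (intro bidegree_parts_add bidegree_parts_wedge10 bidegree_parts_wedge01)
    moreover have "(\<lambda>vs. wedge e10 (contract e a) vs + wedge e01 (contract e a) vs) = wedge (?E e) (contract e a)"
      unfolding E by (simp add: wedge_add_left fun_eq_iff)
    ultimately show ?thesis by auto
  qed
  then obtain D where "bidegree_parts J (Suc k) (\<lambda>vs. \<Sum>e\<in>Basis. wedge (?E e) (contract e a) vs) D"
    using bidegree_parts_sum[of Basis J "Suc k" "\<lambda>e. wedge (?E e) (contract e a)"] by blast
  from bidegree_parts_scale[OF this, of "1 / of_nat (Suc k)"]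
  show ?case unfolding euler_contract[OF Suc.prems] by (auto simp del: of_nat_Suc)
qed

lemma component_parts:
  fixes a :: "'v::euclidean_space cform"
  assumes "linear J" "\<And>v. J (J v) = - v" and "alternating k a"
  obtains D where "bidegree_parts J k a D"
    "\<And>p q. 0 \<le> p \<Longrightarrow> 0 \<le> q \<Longrightarrow> p + q = int k \<Longrightarrow> component J p q a = D p"
proof -
  obtain D where D: "bidegree_parts J k a D" using bidegree_parts_exists[OF assms] by blast
  show ?thesis by (rule that[OF D], rule component_eq[OF D]) auto
qed

subsection \<open>Forms of top degree\<close>

lemma alternating_expand:
  assumes T: "alternating k T" and ws: "length ws = k" "m < k"
  shows "T (ws[m := (\<Sum>l<k. c l *\<^sub>R ws ! l)]) = c m *\<^sub>R T ws"
proof -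
  have lin: "linear (\<lambda>v. T (ws[m := v]))" using alternating_linear[OF T] ws by auto
  have "T (ws[m := ws ! l]) = (if l = m then T ws else 0)" if "l < k" for l
  proof (cases "l = m")
    case False
    consider "l < m" | "m < l" using False by linarith
    then have "T (ws[m := ws ! l]) = 0"
    proof cases
      case 1 then show ?thesis using ws that by (intro alternating_eq[OF T, of _ l m]) auto
    next
      case 2 then show ?thesis using ws that by (intro alternating_eq[OF T, of _ m l]) auto
    qed
    then show ?thesis using False by simp
  qed simp
  then have "(\<Sum>l<k. c l *\<^sub>R T (ws[m := ws ! l])) = (\<Sum>l<k. if l = m then c m *\<^sub>R T ws else 0)"
    by (intro sum.cong) auto
  then show ?thesis
    using ws linear_sum[OF lin, of "\<lambda>l. c l *\<^sub>R ws ! l" "{..<k}"] linear_cmul[OF lin] by simp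
qed

lemma alternating_scale_list:
  assumes "alternating k T"
  shows "T (map (\<lambda>i. c i *\<^sub>R g i) xs) = (\<Prod>i\<leftarrow>xs. c i) *\<^sub>R T (map g xs)"
  using assms
proof (induction xs arbitrary: k T)
  case (Cons x xs)
  have "T (map (\<lambda>i. c i *\<^sub>R g i) (x # xs)) = c x *\<^sub>R T (g x # map (\<lambda>i. c i *\<^sub>R g i) xs)"
    using alternating_head_scale[OF Cons.prems] by simp
  also have "T (g x # map (\<lambda>i. c i *\<^sub>R g i) xs) = (\<Prod>i\<leftarrow>xs. c i) *\<^sub>R T (g x # map g xs)"
    using Cons.IH[OF alternating_contract_gen[OF Cons.prems]] by (simp add: contract_def)
  finally show ?case by simp
qed simp

abbreviation idx :: "'d::{finite,wellorder} list" where
  "idx \<equiv> sorted_list_of_set UNIV"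

lemma idx_position: obtains l where "l < CARD('d)" "idx ! l = (j :: 'd::{finite,wellorder})"
proof -
  have "j \<in> set idx" by simp
  then show ?thesis using that unfolding in_set_conv_nth by auto
qed

lemma length_frame [simp]: "length (standard_frame :: (real ^ 'd::{finite,wellorder}) list) = CARD('d)"
  by (simp add: standard_frame_def)

text \<open>\<open>frame_det\<close> addresses a list by the number of smaller indices,
  \<open>standard_frame\<close> by the position in the sorted list of indices; here the two
  numberings are matched.\<close>

lemma idx_nth_card: "idx ! card {k. k < j} = (j :: 'd::{finite,wellorder})"
proof -
  obtain l where l: "l < CARD('d)" "idx ! l = j" by (rule idx_position)
  have mono: "idx ! a < (idx ! b :: 'd) \<longleftrightarrow> a < b" if "a < CARD('d)" "b < CARD('d)" for a b
  proof -
    have "idx ! x < (idx ! y :: 'd)" if "x < y" "y < CARD('d)" for x y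
      using that sorted_wrt_nth_less[of "(<)" "idx :: 'd list" x y] by simp
    then show ?thesis using that by (metis linorder_neq_iff order_less_asym)
  qed
  have "{k. k < j} = (!) idx ` {..<l}"
  proof (rule equalityI; rule subsetI)
    fix k assume k: "k \<in> {k. k < j}"
    obtain m where m: "m < CARD('d)" "idx ! m = k" by (rule idx_position)
    then show "k \<in> (!) idx ` {..<l}" using mono[of m l] k l by auto
  qed (use mono[of _ l] l in auto)
  moreover have "inj_on ((!) (idx :: 'd list)) {..<l}"
    using l by (auto intro!: inj_on_nth)
  ultimately show ?thesis using l by (simp add: card_image)
qed

lemma bij_idx: "bij_betw ((!) (idx :: 'd::{finite,wellorder} list)) {..<CARD('d)} UNIV"
  by (rule bij_betw_nth) auto

lemma frame_nth: "l < CARD('d) \<Longrightarrow> standard_frame ! l = (axis (idx ! l) 1 :: real ^ 'd::{finite,wellorder})"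
  by (simp add: standard_frame_def)

lemma sum_frame: "(\<Sum>l<CARD('d). x $ (idx ! l) *\<^sub>R standard_frame ! l) = (x :: real ^ 'd::{finite,wellorder})"
proof -
  have "(\<Sum>l<CARD('d). x $ (idx ! l) *\<^sub>R standard_frame ! l) = (\<Sum>i\<in>UNIV. x $ i *\<^sub>R axis i 1)"
    using sum.reindex_bij_betw[OF bij_idx, of "\<lambda>i. x $ i *\<^sub>R axis i (1::real)"] by (simp add: frame_nth)
  then show ?thesis using basis_expansion[of x] by (simp add: scalar_mult_eq_scaleR)
qed

lemma top_expand:
  fixes T :: "(real ^ 'd::{finite,wellorder}) cform"
    and f :: "real ^ 'd::{finite,wellorder} \<Rightarrow> real ^ 'd::{finite,wellorder}"
  assumes T: "alternating CARD('d) T" and f: "linear f" and m: "m < CARD('d)"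
  shows "T ((map f standard_frame)[m := f x]) = x $ (idx ! m) *\<^sub>R T (map f standard_frame)"
proof -
  have "f x = (\<Sum>l<CARD('d). x $ (idx ! l) *\<^sub>R (map f standard_frame ! l))"
    using arg_cong[OF sum_frame[of x], of f] by (simp add: linear_sum[OF f] linear_cmul[OF f])
  then show ?thesis using alternating_expand[OF T, of "map f standard_frame" m "\<lambda>l. x $ (idx ! l)"] m by simp
qed

text \<open>Reduction to generators of the linear maps: compositions, maps with a zero coordinate,
  diagonal maps, transpositions and shears. On each of these both the determinant and the effect of
  alternation are explicit.\<close>

lemma top_map_det_frame:
  fixes T :: "(real ^ 'd::{finite,wellorder}) cform"
  assumes "alternating CARD('d) T" "linear f"
  shows "T (map f standard_frame) = det (matrix f) *\<^sub>R T standard_frame"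
proof -
  \<comment> \<open>\<open>T\<close> is quantified because the hypothesis for the inner map of a
    composition is applied to the pullback of \<open>T\<close> along the outer one.\<close>
  let ?P = "\<lambda>f. \<forall>T. alternating CARD('d) T \<longrightarrow> T (map f standard_frame) = det (matrix f) *\<^sub>R T (standard_frame :: (real ^ 'd::{finite,wellorder}) list)"
  have "?P f"
  proof (rule induct_linear_elementary[OF assms(2)], intro allI impI)
    fix f g :: "(real, 'd) vec \<Rightarrow> (real, 'd) vec" and T :: "((real, 'd) vec) cform"
    assume lin: "linear f" "linear g" and P: "?P f" "?P g" and T: "alternating CARD('d) T"
    have "T (map (f \<circ> g) standard_frame) = det (matrix g) *\<^sub>R T (map f standard_frame)"
      using P(2)[rule_format, OF alternating_map[OF T lin(1)]] by simp
    then show "T (map (f \<circ> g) standard_frame) = det (matrix (f \<circ> g)) *\<^sub>R T standard_frame"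
      using P(1)[rule_format, OF T] lin by (simp add: matrix_compose det_mul mult.commute)
  next
    fix f :: "(real, 'd) vec \<Rightarrow> (real, 'd) vec" and i assume f: "linear f" and z: "\<And>x. f x $ i = 0"
    have "\<not> surj f"
    proof
      assume "surj f" then obtain x where "f x = axis i 1" by (metis surjD)
      then show False using z[of x] by (simp add: axis_def)
    qed
    then have ninj: "\<not> inj f" using linear_injective_imp_surjective[OF f] by blast
    \<comment> \<open>A kernel vector with a nonzero coordinate \<open>j\<close>: replacing the
      image of \<open>axis j 1\<close> by \<open>f x = 0\<close> multiplies the value of
      \<open>T\<close> by \<open>x $ j\<close>, so this value is zero.\<close>
    then obtain x where x: "f x = 0" "x \<noteq> 0" using linear_injective_0[OF f] by auto
    then obtain j where j: "x $ j \<noteq> 0" by (auto simp: vec_eq_iff)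
    obtain m where m: "m < CARD('d)" "idx ! m = j" by (rule idx_position)
    have "det (matrix f) = 0" using ninj by (metis det_nz_iff_inj f)
    moreover have "T (map f standard_frame) = 0" if T: "alternating CARD('d) T" for T
    proof -
      have "linear (\<lambda>v. T ((map f standard_frame)[m := v]))" using alternating_linear[OF T] m by auto
      then have "T ((map f standard_frame)[m := 0]) = 0" using linear_0 by blast
      then show ?thesis using top_expand[OF T f m(1), of x] x(1) j m by simp
    qed
    ultimately show "?P f" by auto
  next
    fix c :: "'d \<Rightarrow> real"
    let ?f = "\<lambda>x::(real, 'd) vec. \<chi> i. c i * x $ i"
    have fr: "map ?f standard_frame = map (\<lambda>i. c i *\<^sub>R axis i 1) idx"
      by (auto simp: standard_frame_def vec_eq_iff axis_def)
    have "(\<Prod>i\<leftarrow>idx. c i) = prod c UNIV"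
      using prod.distinct_set_conv_list[of "idx :: 'd list" c] by simp
    moreover have "matrix ?f = (\<chi> i j. if i = j then c i else 0)"
      by (auto simp: matrix_def axis_def vec_eq_iff)
    then have "det (matrix ?f) = prod c UNIV" by (simp add: det_diagonal)
    ultimately show "?P ?f"
      unfolding fr using alternating_scale_list[of "CARD('d)" _ c "\<lambda>i. axis i (1::real)" idx] by (simp add: standard_frame_def)
  next
    fix m n :: 'd assume mn: "m \<noteq> n"
    let ?f = "\<lambda>x::(real, 'd) vec. \<chi> i. x $ Transposition.transpose m n i"
    obtain a where a: "a < CARD('d)" "idx ! a = m" by (rule idx_position)
    obtain b where b: "b < CARD('d)" "idx ! b = n" by (rule idx_position)
    have ab: "a \<noteq> b" using a b mn by auto
    have fa: "?f (axis j 1) = axis (Transposition.transpose m n j) 1" for j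
      by (auto simp: vec_eq_iff axis_def Transposition.transpose_def)
    have inj: "idx ! l = (idx ! l' :: 'd) \<longleftrightarrow> l = l'" if "l < CARD('d)" "l' < CARD('d)" for l l'
      using that by (auto simp: nth_eq_iff_index_eq)
    have eq: "map ?f standard_frame = (standard_frame :: ((real, 'd) vec) list)[a := standard_frame ! b, b := standard_frame ! a]"
      (is "?L = ?R")
    proof (rule nth_equalityI)
      fix l assume "l < length ?L"
      then have l: "l < CARD('d)" by simp
      have "?L ! l = axis (Transposition.transpose m n (idx ! l)) 1" using l by (simp add: frame_nth fa)
      also have "\<dots> = ?R ! l"
        using l a b inj[of l a] inj[of l b] by (auto simp: nth_list_update frame_nth Transposition.transpose_def)
      finally show "?L ! l = ?R ! l" .
    qed simp
    have T: "T (map ?f standard_frame) = - T standard_frame" if "alternating CARD('d) T" for T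
    proof -
      consider "a < b" | "b < a" using ab by linarith
      then show ?thesis
      proof cases
        case 1 then show ?thesis unfolding eq using a b alternating_swap[OF that, of standard_frame a b] by simp
      next
        case 2 then show ?thesis unfolding eq list_update_swap[OF ab]
          using a b alternating_swap[OF that, of standard_frame b a] by simp
      qed
    qed
    have "matrix ?f = (\<chi> i. (mat 1 :: ((real, 'd) vec, 'd) vec) $ Transposition.transpose m n i)"
      by (auto simp: matrix_def axis_def vec_eq_iff mat_def)
    then have "det (matrix ?f) = - 1"
      using mn by (simp add: det_permute_rows permutes_swap_id sign_swap_id)
    then show "?P ?f" using T by simp
  next
    fix m n :: 'd assume mn: "m \<noteq> n"
    let ?f = "\<lambda>x::(real, 'd) vec. \<chi> i. if i = m then x $ m + x $ n else x $ i"
    obtain b where b: "b < CARD('d)" "idx ! b = n" by (rule idx_position)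
    have inj: "idx ! l = (idx ! l' :: 'd) \<longleftrightarrow> l = l'" if "l < CARD('d)" "l' < CARD('d)" for l l'
      using that by (auto simp: nth_eq_iff_index_eq)
    \<comment> \<open>Only \<open>axis n 1\<close> moves. The added \<open>axis m 1\<close> is
      another vector of the frame and contributes nothing.\<close>
    have eq: "map ?f standard_frame = (map id standard_frame)[b := id (axis n 1 + axis m 1)]" (is "?L = ?R")
    proof (rule nth_equalityI)
      fix l assume "l < length ?L"
      then have l: "l < CARD('d)" by simp
      show "?L ! l = ?R ! l"
        using l b mn inj[of l b] by (auto simp: nth_list_update frame_nth vec_eq_iff axis_def)
    qed simp
    have "T (map ?f standard_frame) = T standard_frame" if T: "alternating CARD('d) T" for T
      unfolding eq using top_expand[OF T linear_id b(1), of "axis n 1 + axis m 1"] b mn by (simp add: axis_def)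
    moreover have "det (matrix ?f) = 1"
    proof -
      have "matrix ?f = (\<chi> k. if k = m then row m (mat 1 :: ((real, 'd) vec, 'd) vec) + 1 *s row n (mat 1) else row k (mat 1))"
        using mn by (auto simp: matrix_def axis_def vec_eq_iff row_def mat_def)
      then show ?thesis by (simp only: det_row_operation[OF mn] det_I)
    qed
    ultimately show "?P ?f" by simp
  qed
  then show ?thesis using assms by blast
qed

lemma list_as_frame_image:
  fixes vs :: "(real ^ 'd::{finite,wellorder}) list"
  assumes "length vs = CARD('d)"
  defines "h \<equiv> \<lambda>x::real ^ 'd::{finite,wellorder}. \<Sum>j\<in>UNIV. x $ j *\<^sub>R (vs ! card {k. k < j})"
  shows "linear h" "map h standard_frame = vs" "det (matrix h) = frame_det vs"
proof -
  show lin: "linear h" unfolding h_def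
    by (intro linear_compose_sum ballI linearI) (auto simp: scaleR_add_left)
  have ax: "h (axis j 1) = vs ! card {k. k < j}" for j
    unfolding h_def axis_def by (simp add: if_distrib[where f="\<lambda>x. x *\<^sub>R _"] cong: if_cong)
  have inj: "idx ! l = (idx ! l' :: 'd) \<longleftrightarrow> l = l'" if "l < CARD('d)" "l' < CARD('d)" for l l'
    using that by (auto simp: nth_eq_iff_index_eq)
  have "card {k. k < (j::'d)} < CARD('d)" for j by (rule psubset_card_mono) auto
  then have "card {k. k < (idx ! l :: 'd)} = l" if "l < CARD('d)" for l
    using inj[THEN iffD1, OF _ that idx_nth_card] by blast
  then show "map h standard_frame = vs"
    using assms(1) by (intro nth_equalityI) (auto simp: frame_nth ax)
  show "det (matrix h) = frame_det vs"
    by (simp add: matrix_def ax frame_det_def)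
qed

lemma top_frame_det:
  fixes T :: "(real ^ 'd::{finite,wellorder}) cform"
  assumes "alternating CARD('d) T" "length vs = CARD('d)"
  shows "T vs = frame_det vs *\<^sub>R T standard_frame"
  using top_map_det_frame[OF assms(1) list_as_frame_image(1)[OF assms(2)]] list_as_frame_image(2,3)[OF assms(2)] by simp

lemma top_map_det:
  fixes T :: "(real ^ 'd::{finite,wellorder}) cform"
    and f :: "real ^ 'd::{finite,wellorder} \<Rightarrow> real ^ 'd::{finite,wellorder}"
  assumes T: "alternating CARD('d) T" and f: "linear f"
  shows "T (map f vs) = det (matrix f) *\<^sub>R T vs"
proof (cases "length vs = CARD('d)")
  case True
  then have "T (map f vs) = frame_det vs *\<^sub>R T (map f standard_frame)"
    using top_frame_det[OF alternating_map[OF T f], of vs] by simp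
  then show ?thesis using top_map_det_frame[OF T f] top_frame_det[OF T True] by (simp add: mult.commute)
next
  case False then show ?thesis using alternating_length[OF T] by simp
qed

text \<open>On a top form \<open>rot J \<theta>\<close> acts by a determinant, which is real, while
  weight \<open>w\<close> demands the factor \<open>cis (w * \<theta>)\<close>. The angle
  \<open>pi / (2 * w)\<close> makes this factor \<open>\<i>\<close>, so the two can agree only on
  zero.\<close>

lemma top_form_weight:
  fixes T :: "(real ^ 'd::{finite,wellorder}) cform"
  assumes T: "alternating CARD('d) T" and w: "weight J w T" "w \<noteq> 0" and J: "linear J"
  shows "T = (\<lambda>vs. 0)"
proof
  fix vs
  let ?\<theta> = "pi / (2 * of_int w)"
  have "linear (rot J ?\<theta>)" unfolding rot_def
    by (intro linear_compose_add linear_compose_scale_right linear_id[unfolded id_def] J)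
  then have "det (matrix (rot J ?\<theta>)) *\<^sub>R T vs = cis (of_int w * ?\<theta>) * T vs"
    using top_map_det[OF T, of "rot J ?\<theta>" vs] w(1) by (simp add: weight_def)
  also have "cis (of_int w * ?\<theta>) = \<i>" using w(2) by (simp add: complex_eq_iff)
  finally have "(complex_of_real (det (matrix (rot J ?\<theta>))) - \<i>) * T vs = 0"
    by (simp add: scaleR_conv_of_real algebra_simps)
  moreover have "complex_of_real (det (matrix (rot J ?\<theta>))) - \<i> \<noteq> 0" by (simp add: complex_eq_iff)
  ultimately show "T vs = 0" by simp
qed

subsection \<open>Powers of the fundamental form\<close>

definition hermitian_inner :: "('v \<Rightarrow> 'v) \<Rightarrow> ('v::real_vector \<Rightarrow> 'v \<Rightarrow> real) \<Rightarrow> bool" where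
  "hermitian_inner J h \<longleftrightarrow> linear J \<and> (\<forall>v. J (J v) = - v) \<and> bilinear h \<and> (\<forall>u v. h u v = h v u) \<and>
     (\<forall>u. u \<noteq> 0 \<longrightarrow> 0 < h u u) \<and> (\<forall>u v. h (J u) (J v) = h u v)"

definition fundamental_cform :: "('v \<Rightarrow> 'v) \<Rightarrow> ('v \<Rightarrow> 'v \<Rightarrow> real) \<Rightarrow> 'v cform" where
  "fundamental_cform J h vs = (if length vs = 2 then complex_of_real (h (J (vs ! 0)) (vs ! 1)) else 0)"

lemma fundamental_form_eq: "fundamental_form J g p = fundamental_cform (J p) (g p)"
  by (simp add: fundamental_form_def fundamental_cform_def fun_eq_iff)

text \<open>Orthogonality to the whole plane spanned by \<open>u\<close> and \<open>J u\<close>,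
  hence orthogonality for the Hermitian form that belongs to \<open>h\<close>.\<close>

definition J_orth :: "('v \<Rightarrow> 'v) \<Rightarrow> ('v \<Rightarrow> 'v \<Rightarrow> real) \<Rightarrow> 'v \<Rightarrow> 'v \<Rightarrow> bool" where
  "J_orth J h u w \<longleftrightarrow> h u w = 0 \<and> h (J u) w = 0"

definition J_frame :: "('v \<Rightarrow> 'v) \<Rightarrow> 'v list \<Rightarrow> 'v list" where
  "J_frame J us = concat (map (\<lambda>u. [u, J u]) us)"

lemma J_frame_simps [simp]: "J_frame J [] = []" "J_frame J (u # us) = u # J u # J_frame J us"
  by (simp_all add: J_frame_def)

lemma length_J_frame [simp]: "length (J_frame J us) = 2 * length us"
  by (induction us) auto

lemma set_J_frame: "set (J_frame J us) = set us \<union> J ` set us"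
  by (auto simp: J_frame_def)

fun J_orthogonal :: "('v::real_vector \<Rightarrow> 'v) \<Rightarrow> ('v \<Rightarrow> 'v \<Rightarrow> real) \<Rightarrow> 'v list \<Rightarrow> bool" where
  "J_orthogonal J h [] = True"
| "J_orthogonal J h (u # us) = (u \<noteq> 0 \<and> (\<forall>w\<in>set us. J_orth J h u w) \<and> J_orthogonal J h us)"

context
  fixes J :: "'v::real_vector \<Rightarrow> 'v" and h
  assumes hJ: "hermitian_inner J h"
begin

lemma hermitian_simps:
  shows "linear J" and JJ: "J (J v) = - v" and "bilinear h" and sym: "h u v = h v u"
    and pos: "u \<noteq> 0 \<Longrightarrow> 0 < h u u" and inv: "h (J u) (J v) = h u v"
  using hJ by (auto simp: hermitian_inner_def)

lemma J_skew: "h (J u) v = - h u (J v)"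
  using inv[of "J u" v] JJ bilinear_lneg[OF hermitian_simps(3)] by simp

lemma J_self: "h (J u) u = 0" "h u (J u) = 0"
  using J_skew[of u u] sym by auto

abbreviation "\<Omega> \<equiv> fundamental_cform J h"

lemma alternating_fundamental: "alternating 2 \<Omega>"
proof -
  have "alternating (Suc (Suc 0)) \<Omega>"
  proof (rule alternating_SucI)
    show "\<Omega> [] = 0" by (simp add: fundamental_cform_def)
    show "alternating (Suc 0) (contract v \<Omega>)" for v
    proof -
      have "linear (\<lambda>w. complex_of_real (h (J v) w))"
        using hermitian_simps(3) by (intro linearI) (auto simp: bilinear_radd bilinear_rmul scaleR_conv_of_real)
      then have "alternating 1 (contract v \<Omega>)"
        unfolding alternating_1 by (auto simp: contract_def fundamental_cform_def)
      then show ?thesis by simp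
    qed
    show "linear (\<lambda>v. \<Omega> (v # vs))" for vs
    proof -
      have "linear (\<lambda>v. complex_of_real (h (J v) w))" for w
        using hermitian_simps(1,3)
        by (intro linearI) (auto simp: bilinear_ladd bilinear_lmul linear_add linear_cmul scaleR_conv_of_real)
      then show ?thesis by (cases "length vs = 1") (auto simp: fundamental_cform_def linear_zero)
    qed
    show "\<Omega> (v # v # vs) = 0" for v vs
      by (simp add: fundamental_cform_def J_self)
  qed
  then show ?thesis by (simp add: numeral_2_eq_2)
qed

lemma alternating_fundamental_power: "alternating (2 * k) (wedge_power \<Omega> k)"
  using alternating_wedge_power[OF alternating_fundamental, of k] by (simp add: mult.commute)

lemma weight_fundamental: "weight J 0 \<Omega>"
proof -
  have "h (J (rot J \<theta> u)) (rot J \<theta> v) = h (J u) v" for \<theta> u v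
  proof -
    note lin = bilinear_ladd[OF hermitian_simps(3)] bilinear_lmul[OF hermitian_simps(3)]
      bilinear_radd[OF hermitian_simps(3)] bilinear_rmul[OF hermitian_simps(3)] bilinear_lneg[OF hermitian_simps(3)]
      bilinear_lsub[OF hermitian_simps(3)] bilinear_rsub[OF hermitian_simps(3)] linear_add[OF hermitian_simps(1)] linear_cmul[OF hermitian_simps(1)]
    have *: "cos \<theta> * (cos \<theta> * x) + sin \<theta> * (sin \<theta> * x) = x" for x
      by (simp flip: mult.assoc distrib_right)
    show ?thesis
      unfolding rot_def by (simp add: lin JJ inv J_skew[of u v] algebra_simps) (simp add: *)
  qed
  then show ?thesis by (auto simp: weight_def fundamental_cform_def)
qed

lemma weight_fundamental_power: "weight J 0 (wedge_power \<Omega> k)"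
proof (induction k)
  case (Suc k)
  then show ?case using weight_wedge[OF weight_fundamental Suc] by (simp add: wedge_power_Suc)
qed (simp add: weight_one)

lemma contract_fundamental:
  "contract v \<Omega> = covec (\<lambda>w. complex_of_real (h (J v) w))"
  by (auto simp: contract_def fundamental_cform_def covec_def fun_eq_iff split: list.split)

lemma twist_fundamental: "twist \<Omega> = \<Omega>"
  by (auto simp: twist_def fundamental_cform_def)

lemma covec_wedge_vanish:
  assumes "\<forall>w\<in>set ws. f w = 0" shows "wedge (covec f) b ws = 0"
  using assms
proof (induction ws arbitrary: b)
  case Nil show ?case by (simp add: wedge_Nil)
next
  case (Cons w ws)
  have "contract w (covec f) = (\<lambda>vs. f w * wedge_one vs)"
    by (auto simp: contract_def wedge_one_def covec_def fun_eq_iff split: list.split)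
  moreover have "twist (covec f) = (\<lambda>vs. - covec f vs)"
    by (auto simp: twist_def covec_def fun_eq_iff split: list.split)
  ultimately show ?case using Cons by (simp add: wedge_Cons wedge_minus_left)
qed

text \<open>One of the \<open>Suc k\<close> factors must take both \<open>u\<close> and
  \<open>J u\<close>, and it yields \<open>h u u\<close>. A factor that takes only one of them
  becomes a covector that vanishes on \<open>ws\<close>.\<close>

lemma fundamental_power_split:
  assumes "\<forall>w\<in>set ws. J_orth J h u w"
  shows "wedge_power \<Omega> (Suc k) (u # J u # ws) = of_nat (Suc k) * complex_of_real (h u u) * wedge_power \<Omega> k ws"
  using assms
proof (induction k arbitrary: ws)
  have cu: "contract (J u) (covec (\<lambda>w. complex_of_real (h (J u) w))) = (\<lambda>vs. complex_of_real (h u u) * wedge_one vs)"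
    by (auto simp: contract_def wedge_one_def covec_def fun_eq_iff inv split: list.split)
  have tc: "twist (covec f) = (\<lambda>vs. - covec f vs)" for f :: "'v \<Rightarrow> complex"
    by (auto simp: twist_def covec_def fun_eq_iff split: list.split)
  {
    fix ws b assume o: "\<forall>w\<in>set ws. J_orth J h u w"
    have z1: "wedge (covec (\<lambda>w. complex_of_real (h (J u) w))) c ws = 0" for c
      by (rule covec_wedge_vanish) (use o in \<open>auto simp: J_orth_def\<close>)
    have z2: "wedge (covec (\<lambda>w. complex_of_real (h (J (J u)) w))) c ws = 0" for c
      by (rule covec_wedge_vanish) (use o in \<open>auto simp: J_orth_def JJ bilinear_lneg[OF hermitian_simps(3)]\<close>)
    have "wedge \<Omega> b (u # J u # ws) = complex_of_real (h u u) * b ws + wedge \<Omega> (contract (J u) (contract u b)) ws"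
      by (simp add: wedge_Cons contract_wedge twist_fundamental contract_fundamental wedge_add_left wedge_add_right
          cu tc z1 z2 wedge_minus_left wedge_scale_left)
  } note step = this
  {
    case 0
    have "wedge_one (u # J u # ws) = 0" for u and ws :: "'v list" by (simp add: wedge_one_def)
    moreover have "contract (J u) (contract u wedge_one) = (\<lambda>vs. 0)" by (simp add: contract_def wedge_one_def)
    ultimately show ?case using step[OF 0, of wedge_one] by (simp add: wedge_power_Suc)
  next
    case (Suc k)
    \<comment> \<open>The induction hypothesis is available only on lists orthogonal to
      \<open>u\<close>, so it is no equation between forms; it is applied under the shuffle sum, to
      the sublists of \<open>ws\<close>.\<close>
    have "wedge \<Omega> (contract (J u) (contract u (wedge_power \<Omega> (Suc k)))) ws
        = wedge \<Omega> (\<lambda>vs. of_nat (Suc k) * complex_of_real (h u u) * wedge_power \<Omega> k vs) ws"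
      unfolding wedge_def
    proof (rule sum.cong)
      fix I assume "I \<in> Pow {..<length ws}"
      have "\<forall>w\<in>set (nths ws (- I)). J_orth J h u w" using Suc.prems by (auto dest: in_set_nthsD)
      from Suc.IH[OF this]
      show "shuffle_sign I (length ws) * \<Omega> (nths ws I) * contract (J u) (contract u (wedge_power \<Omega> (Suc k))) (nths ws (- I))
        = shuffle_sign I (length ws) * \<Omega> (nths ws I) * (of_nat (Suc k) * complex_of_real (h u u) * wedge_power \<Omega> k (nths ws (- I)))"
        by (simp add: contract_def del: of_nat_Suc)
    qed simp
    also have "\<dots> = of_nat (Suc k) * complex_of_real (h u u) * wedge_power \<Omega> (Suc k) ws"
      by (simp add: wedge_scale_right wedge_power_Suc del: of_nat_Suc)
    finally show ?case
      using step[OF Suc.prems, of "wedge_power \<Omega> (Suc k)"] by (simp add: wedge_power_Suc algebra_simps)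
  }
qed

lemma J_orth_J: "J_orth J h u w \<Longrightarrow> J_orth J h u (J w)"
  using J_skew[of u w] inv[of u w] by (auto simp: J_orth_def)

lemma alternating_shift_list:
  fixes a :: "'v cform"
  assumes "alternating k a" "\<And>x. f x = x + c x *\<^sub>R u + d x *\<^sub>R v"
  shows "a (u # v # map f ws) = a (u # v # ws)"
  using assms(1)
proof (induction ws arbitrary: k a)
  case (Cons w ws)
  have eq: "a (u # v # x # zs) = a (x # u # v # zs)" if "alternating k a" for a :: "'v cform" and k x zs
  proof -
    have "a (u # v # x # zs) = - a (u # x # v # zs)"
      using alternating_swap_head[OF alternating_contract_gen[OF that, of u], of v x zs] by (simp add: contract_def)
    then show ?thesis using alternating_swap_head[OF that, of u x "v # zs"] by simp
  qed
  have z: "a (u # u # v # zs) = 0" "a (v # u # v # zs) = 0" for zs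
    using alternating_head_eq[OF Cons.prems] alternating_swap_head[OF Cons.prems, of v u "v # zs"]
      alternating_head_eq[OF alternating_contract_gen[OF Cons.prems, of u], of v zs] by (auto simp: contract_def)
  have "a (u # v # map f (w # ws)) = contract (f w) a (u # v # map f ws)"
    using eq[OF Cons.prems] by (simp add: contract_def)
  also have "\<dots> = a (f w # u # v # ws)"
    using Cons.IH[OF alternating_contract_gen[OF Cons.prems]] by (simp add: contract_def)
  also have "\<dots> = a (w # u # v # ws)"
    unfolding assms(2) by (simp add: alternating_head_add[OF Cons.prems] alternating_head_scale[OF Cons.prems] z)
  finally show ?case using eq[OF Cons.prems, of w ws] by simp
qed simp

text \<open>The vectors need not be independent, so only weak positivity can hold. Removing from the
  later vectors their components along \<open>u\<close> and \<open>J u\<close> leaves the value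
  unchanged, by alternation, and then \<open>fundamental_power_split\<close> extracts the factor
  \<open>h u u\<close>.\<close>

lemma fundamental_power_nonneg:
  "\<exists>r\<ge>0. wedge_power \<Omega> (length us) (J_frame J us) = complex_of_real r"
proof (induction "length us" arbitrary: us)
  case 0 then show ?case by (auto simp: wedge_one_def intro!: exI[of _ 1])
next
  case (Suc k)
  then obtain u us' where us: "us = u # us'" by (cases us) auto
  let ?A = "wedge_power \<Omega> (Suc k)"
  show ?case
  proof (cases "u = 0")
    case True
    have "?A (0 # vs) = 0" for vs
      using alternating_head_scale[OF alternating_fundamental_power[of "Suc k"], of 0 u vs] by simp
    then show ?thesis using True us Suc(2) by (auto intro!: exI[of _ 0])
  next
    case False
    \<comment> \<open>The coefficients of a Gram-Schmidt step against \<open>u\<close> and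
      \<open>J u\<close>, which are orthogonal and both have square length
      \<open>h u u\<close>.\<close>
    define c where "c x = - h u x / h u u" for x
    define d where "d x = - h (J u) x / h u u" for x
    define f where "f x = x + c x *\<^sub>R u + d x *\<^sub>R J u" for x
    have p: "h u u > 0" using pos[OF False] .
    note lin = bilinear_radd[OF hermitian_simps(3)] bilinear_rmul[OF hermitian_simps(3)] bilinear_rsub[OF hermitian_simps(3)]
    have o: "J_orth J h u (f x)" for x
      unfolding J_orth_def f_def using p by (simp add: lin J_self inv c_def d_def)
    \<comment> \<open>Since \<open>f\<close> commutes with \<open>J\<close>, it maps a
      \<open>J_frame\<close> to a \<open>J_frame\<close>, to which the induction hypothesis
      applies.\<close>
    have "f (J x) = J (f x)" for x
    proof -
      have "c (J x) = - d x" "d (J x) = c x"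
        using J_skew[of u x] by (simp_all add: c_def d_def inv)
      then show ?thesis
        unfolding f_def using linear_add[OF hermitian_simps(1)] linear_cmul[OF hermitian_simps(1)] JJ by simp
    qed
    then have mf: "map f (J_frame J us') = J_frame J (map f us')" by (induction us') auto
    have "?A (J_frame J us) = ?A (u # J u # map f (J_frame J us'))"
      unfolding us using alternating_shift_list[OF alternating_fundamental_power f_def] by simp
    also have "\<dots> = of_nat (Suc k) * complex_of_real (h u u) * wedge_power \<Omega> k (J_frame J (map f us'))"
      unfolding mf
      by (rule fundamental_power_split) (use o J_orth_J in \<open>auto simp: set_J_frame\<close>)
    finally have "?A (J_frame J us) = of_nat (Suc k) * complex_of_real (h u u) * wedge_power \<Omega> k (J_frame J (map f us'))" .
    moreover obtain r where "r \<ge> 0" "wedge_power \<Omega> k (J_frame J (map f us')) = complex_of_real r"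
      using Suc(1)[of "map f us'"] Suc(2) us by auto
    ultimately have "?A (J_frame J us) = complex_of_real (Suc k * h u u * r)" "Suc k * h u u * r \<ge> 0"
      using p by auto
    then show ?thesis using Suc(2) by metis
  qed
qed

lemma fundamental_power_orthogonal:
  "J_orthogonal J h us \<Longrightarrow> wedge_power \<Omega> (length us) (J_frame J us) \<noteq> 0"
proof (induction us)
  case Nil then show ?case by (simp add: wedge_one_def)
next
  case (Cons u us)
  then have "\<forall>w\<in>set (J_frame J us). J_orth J h u w" using J_orth_J by (auto simp: set_J_frame)
  then show ?case using Cons pos[of u] by (simp add: fundamental_power_split del: of_nat_Suc)
qed

lemma J_orth_scale: "J_orth J h u w \<Longrightarrow> J_orth J h (a *\<^sub>R u) (b *\<^sub>R w)"
  by (simp add: J_orth_def linear_cmul[OF hermitian_simps(1)] bilinear_lmul[OF hermitian_simps(3)] bilinear_rmul[OF hermitian_simps(3)])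

end

text \<open>A dimension count: the conditions imposed by the \<open>k\<close> vectors found so far
  and by their images under \<open>J\<close> leave a nonzero vector as long as
  \<open>2 * k < DIM('v)\<close>.\<close>

lemma J_orthogonal_exists:
  fixes J :: "'v::euclidean_space \<Rightarrow> 'v"
  assumes hJ: "hermitian_inner J h"
  shows "2 * k \<le> DIM('v) \<Longrightarrow> \<exists>us. length us = k \<and> J_orthogonal J h us \<and> (\<forall>u\<in>set us. h u u = 1)"
proof (induction k)
  case 0 then show ?case by (auto intro!: exI[of _ "[]"])
next
  case (Suc k)
  note hs = hermitian_simps[OF hJ]
  obtain us where us: "length us = k" "J_orthogonal J h us" "\<forall>u\<in>set us. h u u = 1" using Suc by auto
  \<comment> \<open>\<open>G w\<close> represents \<open>\<lambda>v. h v w\<close> in the standard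
    inner product, so that Euclidean orthogonality to the vectors \<open>G w\<close> is
    orthogonality for \<open>h\<close> to the vectors \<open>w\<close>.\<close>
  define G where "G w = (\<Sum>b\<in>Basis. h b w *\<^sub>R b)" for w
  have G: "h v w = v \<bullet> G w" for v w
  proof -
    have lin: "linear (\<lambda>v. h v w)" using hs(3) by (simp add: bilinear_def)
    have "h (\<Sum>b\<in>Basis. (v \<bullet> b) *\<^sub>R b) w = (\<Sum>b\<in>Basis. (v \<bullet> b) * h b w)"
      using linear_sum[OF lin, of "\<lambda>b. (v \<bullet> b) *\<^sub>R b" Basis] linear_cmul[OF lin] by simp
    then show ?thesis by (simp add: G_def inner_sum_right euclidean_representation mult.commute)
  qed
  let ?S = "set (map G (J_frame J us))"
  have "dim ?S \<le> card ?S" by (rule dim_le_card') simp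
  also have "\<dots> \<le> 2 * k" using card_length[of "map G (J_frame J us)"] us(1) hJ by (simp add: length_J_frame)
  also have "\<dots> < DIM('v)" using Suc.prems by simp
  finally obtain x where x: "x \<noteq> 0" "\<And>y. y \<in> span ?S \<Longrightarrow> orthogonal x y"
    using orthogonal_to_subspace_exists by blast
  have hx: "h x w = 0" if "w \<in> set (J_frame J us)" for w
    using x(2)[OF span_base, of "G w"] that by (simp add: G orthogonal_def)
  define u where "u = (1 / sqrt (h x x)) *\<^sub>R x"
  have px: "h x x > 0" using hs(5) x(1) by blast
  have "h u u = 1"
    using px by (simp add: u_def bilinear_lmul[OF hs(3)] bilinear_rmul[OF hs(3)] flip: power2_eq_square)
  moreover have "u \<noteq> 0" using px x(1) by (simp add: u_def)
  moreover have "J_orth J h u w" if "w \<in> set us" for w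
  proof -
    have "J_orth J h x w"
      using hx[of w] hx[of "J w"] that J_skew[OF hJ, of x w] by (auto simp: J_orth_def set_J_frame)
    then show ?thesis using J_orth_scale[OF hJ, of x w _ 1] by (simp add: u_def)
  qed
  ultimately show ?case using us hJ by (intro exI[of _ "u # us"]) auto
qed

lemma J_frame_inner:
  assumes hJ: "hermitian_inner J h" and "J_orthogonal J h us" "\<forall>u\<in>set us. h u u = 1" "i < 2 * length us" "j < 2 * length us"
  shows "h (J_frame J us ! i) (J_frame J us ! j) = (if i = j then 1 else 0)"
  using assms(2-)
proof (induction us arbitrary: i j)
  case (Cons u us)
  note hs = hermitian_simps[OF hJ]
  have o: "h u w = 0" "h (J u) w = 0" "h w u = 0" "h w (J u) = 0" if "w \<in> set (J_frame J us)" for w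
    using that Cons.prems(1) J_orth_J[OF hJ, of u] hs(4)
    by (auto simp: set_J_frame J_orth_def hJ)
  have n: "J_frame J us ! m \<in> set (J_frame J us)" if "m < 2 * length us" for m
    using that by (simp add: length_J_frame)
  have u: "h u u = 1" using Cons.prems by simp
  have cases: "m = 0 \<or> m = 1 \<or> (\<exists>l. m = Suc (Suc l) \<and> l < 2 * length us)" if "m < 2 * length (u # us)" for m
    using that by (cases m; cases "m - 1") auto
  show ?case
    using cases[OF Cons.prems(3)] cases[OF Cons.prems(4)] Cons.prems(1,2) Cons.IH
    by (elim disjE exE conjE) (simp_all add: u o n hs(6) J_self[OF hJ])
qed simp

section \<open>Calculus on open sets\<close>

abbreviation dderiv :: "('a::real_normed_vector \<Rightarrow> 'b::real_normed_vector) \<Rightarrow> 'a \<Rightarrow> 'a \<Rightarrow> 'b" where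
  "dderiv f x v \<equiv> frechet_derivative f (at x) v"

lemma dderiv_eq: "(f has_derivative f') (at x) \<Longrightarrow> dderiv f x v = f' v"
  using frechet_derivative_at by metis

lemma has_dderiv: "f differentiable (at x) \<Longrightarrow> (f has_derivative frechet_derivative f (at x)) (at x)"
  by (simp add: frechet_derivative_works)

lemma linear_dderiv: "f differentiable (at x) \<Longrightarrow> linear (frechet_derivative f (at x))"
  by (rule linear_frechet_derivative)

lemma dderiv_cong:
  assumes "open S" "x \<in> S" "\<And>y. y \<in> S \<Longrightarrow> f y = g y" "f differentiable (at x)"
  shows "dderiv f x v = dderiv g x v" "g differentiable (at x)"
proof -
  have "(g has_derivative frechet_derivative f (at x)) (at x)"
    using has_derivative_transform_within_open[OF has_dderiv[OF assms(4)] assms(1,2)] assms(3) by blast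
  then show "dderiv f x v = dderiv g x v" "g differentiable (at x)"
    by (auto simp: dderiv_eq differentiable_def)
qed

lemma dderiv_add:
  "f differentiable (at x) \<Longrightarrow> g differentiable (at x) \<Longrightarrow> dderiv (\<lambda>y. f y + g y) x v = dderiv f x v + dderiv g x v"
  by (rule dderiv_eq[OF has_derivative_add[OF has_dderiv has_dderiv]])

lemma dderiv_bounded_linear:
  "bounded_linear L \<Longrightarrow> f differentiable (at x) \<Longrightarrow> dderiv (\<lambda>y. L (f y)) x v = L (dderiv f x v)"
  by (rule dderiv_eq[OF bounded_linear.has_derivative[OF _ has_dderiv]])

lemma differentiable_bounded_linear:
  "bounded_linear L \<Longrightarrow> f differentiable (at x) \<Longrightarrow> (\<lambda>y. L (f y)) differentiable (at x)"
  using bounded_linear.has_derivative[of L f _ "at x"] unfolding differentiable_def by blast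

lemma dderiv_cmult:
  fixes f :: "_ \<Rightarrow> 'b::real_normed_algebra"
  shows "f differentiable (at x) \<Longrightarrow> dderiv (\<lambda>y. c * f y) x v = c * dderiv f x v"
  by (rule dderiv_bounded_linear[OF bounded_linear_mult_right])

lemma dderiv_minus:
  "f differentiable (at x) \<Longrightarrow> dderiv (\<lambda>y. - f y) x v = - dderiv f x v"
  by (rule dderiv_bounded_linear[OF bounded_linear_minus[OF bounded_linear_ident]])

lemma dderiv_sum:
  assumes "\<And>i. i \<in> I \<Longrightarrow> f i differentiable (at x)"
  shows "dderiv (\<lambda>y. \<Sum>i\<in>I. f i y) x v = (\<Sum>i\<in>I. dderiv (f i) x v)"
  by (rule dderiv_eq[OF has_derivative_sum]) (use assms has_dderiv in blast)

lemma dderiv_bilinear: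
  assumes "bounded_bilinear P" "f differentiable (at x)" "g differentiable (at x)"
  shows "dderiv (\<lambda>y. P (f y) (g y)) x v = P (f x) (dderiv g x v) + P (dderiv f x v) (g x)"
    "(\<lambda>y. P (f y) (g y)) differentiable (at x)"
proof -
  note * = bounded_bilinear.FDERIV[OF assms(1) has_dderiv[OF assms(2)] has_dderiv[OF assms(3)]]
  show "dderiv (\<lambda>y. P (f y) (g y)) x v = P (f x) (dderiv g x v) + P (dderiv f x v) (g x)"
    by (rule dderiv_eq[OF *])
  show "(\<lambda>y. P (f y) (g y)) differentiable (at x)" using * by (auto simp: differentiable_def)
qed

lemma dderiv_mult:
  fixes f g :: "_ \<Rightarrow> 'b::real_normed_algebra"
  assumes "f differentiable (at x)" "g differentiable (at x)"
  shows "dderiv (\<lambda>y. f y * g y) x v = f x * dderiv g x v + dderiv f x v * g x"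
  by (rule dderiv_bilinear[OF bounded_bilinear_mult assms])

lemma dderiv_compose:
  assumes "g differentiable (at x)" "f differentiable (at (g x))"
  shows "dderiv (\<lambda>y. f (g y)) x v = dderiv f (g x) (dderiv g x v)"
  using frechet_derivative_compose[OF assms] by (simp add: o_def fun_eq_iff)

subsection \<open>Functions of class \<open>C\<^sup>k\<close>\<close>

lemma Ck_on_cong:
  assumes "open S" "\<And>x. x \<in> S \<Longrightarrow> f x = g x" "Ck_on k S f" shows "Ck_on k S g"
  using assms(2,3)
proof (induction k arbitrary: f g)
  case 0 then show ?case using continuous_on_cong[of S S f g] by simp
next
  case (Suc k)
  have d: "f differentiable (at x)" if "x \<in> S" for x using Suc.prems that by simp
  have "Ck_on k S (\<lambda>x. dderiv g x v)" for v
  proof (rule Suc.IH)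
    show "dderiv f x v = dderiv g x v" if "x \<in> S" for x
      using dderiv_cong(1)[OF assms(1) that _ d[OF that]] Suc.prems(1) by blast
  qed (use Suc.prems in auto)
  moreover have "g differentiable (at x)" if "x \<in> S" for x
    using dderiv_cong(2)[OF assms(1) that _ d[OF that]] Suc.prems(1) by blast
  ultimately show ?case by simp
qed

lemma Ck_on_subset: "Ck_on k S f \<Longrightarrow> T \<subseteq> S \<Longrightarrow> Ck_on k T f"
  by (induction k arbitrary: f) (auto intro: continuous_on_subset)

lemma Ck_on_local:
  assumes "\<And>x. x \<in> S \<Longrightarrow> \<exists>U. open U \<and> x \<in> U \<and> Ck_on k U f" shows "Ck_on k S f"
  using assms
proof (induction k arbitrary: f)
  case 0
  then have "isCont f x" if "x \<in> S" for x
    using that continuous_on_eq_continuous_at by fastforce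
  then show ?case by (simp add: continuous_at_imp_continuous_on)
next
  case (Suc k)
  have "Ck_on k S (\<lambda>x. dderiv f x v)" for v
    by (rule Suc.IH) (use Suc.prems in fastforce)
  then show ?case using Suc.prems by fastforce
qed

lemma Ck_on_SucI:
  assumes "open S" "\<And>x. x \<in> S \<Longrightarrow> (f has_derivative f' x) (at x)" "\<And>v. Ck_on k S (\<lambda>x. f' x v)"
  shows "Ck_on (Suc k) S f"
proof -
  have "Ck_on k S (\<lambda>x. dderiv f x v)" for v
    by (rule Ck_on_cong[OF assms(1) _ assms(3)[of v]]) (simp add: dderiv_eq[OF assms(2)])
  then show ?thesis using assms(2) by (auto simp: differentiable_def)
qed

lemma Ck_on_SucD: "Ck_on (Suc k) S f \<Longrightarrow> Ck_on k S f"
proof (induction k arbitrary: f)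
  case 0 then show ?case
    by (auto intro!: continuous_at_imp_continuous_on differentiable_imp_continuous_within)
next
  case (Suc k) then show ?case by (metis Ck_on.simps(2))
qed

lemma Ck_on_mono: "Ck_on l S f \<Longrightarrow> k \<le> l \<Longrightarrow> Ck_on k S f"
proof (induction l)
  case (Suc l) then show ?case using Ck_on_SucD by (metis le_Suc_eq)
qed simp

lemma Ck_on_continuous: "Ck_on k S f \<Longrightarrow> continuous_on S f"
  using Ck_on_mono[of k S f 0] by simp

lemma Ck_on_const [simp]: "Ck_on k S (\<lambda>x. c)"
  by (induction k arbitrary: c) auto

lemma Ck_on_linear: "open S \<Longrightarrow> bounded_linear f \<Longrightarrow> Ck_on k S f"
proof (cases k)
  case (Suc l)
  assume "open S" "bounded_linear f"
  then show ?thesis unfolding Suc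
    by (intro Ck_on_SucI[where f'="\<lambda>x. f"]) (auto intro: bounded_linear_imp_has_derivative)
qed (simp add: linear_continuous_on)

lemma Ck_on_bounded_linear:
  assumes "open S" "bounded_linear L" "Ck_on k S f" shows "Ck_on k S (\<lambda>x. L (f x))"
  using assms(3)
proof (induction k arbitrary: f)
  case 0 then show ?case using assms(2) by (simp add: bounded_linear.continuous_on)
next
  case (Suc k)
  show ?case
    by (rule Ck_on_SucI[OF assms(1), where f'="\<lambda>x v. L (dderiv f x v)"])
      (use Suc assms(2) in \<open>auto intro: bounded_linear.has_derivative has_dderiv\<close>)
qed

lemma Ck_on_add:
  assumes "open S" "Ck_on k S f" "Ck_on k S g" shows "Ck_on k S (\<lambda>x. f x + g x)"
  using assms(2,3)
proof (induction k arbitrary: f g)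
  case 0 then show ?case by (simp add: continuous_on_add)
next
  case (Suc k)
  show ?case
    by (rule Ck_on_SucI[OF assms(1), where f'="\<lambda>x v. dderiv f x v + dderiv g x v"])
      (use Suc in \<open>auto intro: has_derivative_add[OF has_dderiv has_dderiv]\<close>)
qed

lemma Ck_on_sum:
  assumes "open S" "\<And>i. i \<in> I \<Longrightarrow> Ck_on k S (f i)" shows "Ck_on k S (\<lambda>x. \<Sum>i\<in>I. f i x)"
  using assms(2) by (induction I rule: infinite_finite_induct) (auto intro: Ck_on_add[OF assms(1)])

lemma Ck_on_bilinear:
  assumes "open S" "bounded_bilinear P" "Ck_on k S f" "Ck_on k S g" shows "Ck_on k S (\<lambda>x. P (f x) (g x))"
  using assms(3,4)
proof (induction k arbitrary: f g)
  case 0 then show ?case using bounded_bilinear.continuous_on[OF assms(2)] by auto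
next
  case (Suc k)
  then have "Ck_on k S f" "Ck_on k S g" using Ck_on_SucD by blast+
  then show ?case
    by (intro Ck_on_SucI[OF assms(1), where f'="\<lambda>x v. P (f x) (dderiv g x v) + P (dderiv f x v) (g x)"])
      (use Suc in \<open>auto intro!: bounded_bilinear.FDERIV[OF assms(2)] has_dderiv Ck_on_add[OF assms(1)]\<close>)
qed

lemmas Ck_on_mult = Ck_on_bilinear[OF _ bounded_bilinear_mult]
lemmas Ck_on_scaleR = Ck_on_bilinear[OF _ bounded_bilinear_scaleR]

lemma Ck_on_compose:
  fixes g :: "'a::real_normed_vector \<Rightarrow> 'b::euclidean_space"
  assumes "open S" "open U" "Ck_on k U f" "Ck_on k S g" "g ` S \<subseteq> U"
  shows "Ck_on k S (\<lambda>x. f (g x))"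
  using assms(3,4)
proof (induction k arbitrary: f)
  case 0 then show ?case using assms(5) continuous_on_compose2 by fastforce
next
  case (Suc k)
  have gd: "(g has_derivative frechet_derivative g (at x)) (at x)" if "x \<in> S" for x
    using Suc.prems that by (intro has_dderiv) auto
  have fd: "(f has_derivative frechet_derivative f (at (g x))) (at (g x))" if "x \<in> S" for x
    using Suc.prems that assms(5) by (intro has_dderiv) auto
  show ?case
  \<comment> \<open>\<open>Ck_on\<close> speaks of derivatives in fixed directions, while in the
    chain rule the direction \<open>dderiv g x v\<close> varies with \<open>x\<close>; expanding it
    in \<open>Basis\<close> removes this dependence.\<close>
  proof (rule Ck_on_SucI[OF assms(1), where f'="\<lambda>x v. \<Sum>b\<in>Basis. (dderiv g x v \<bullet> b) *\<^sub>R dderiv f (g x) b"])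
    fix x assume x: "x \<in> S"
    have lin: "linear (frechet_derivative f (at (g x)))"
      using fd[OF x] has_derivative_linear by blast
    have "(\<Sum>b\<in>Basis. (dderiv g x v \<bullet> b) *\<^sub>R dderiv f (g x) b) = dderiv f (g x) (dderiv g x v)" for v
      using linear_sum[OF lin, of "\<lambda>b. (dderiv g x v \<bullet> b) *\<^sub>R b" Basis] linear_cmul[OF lin]
      by (simp add: euclidean_representation)
    then show "((\<lambda>x. f (g x)) has_derivative (\<lambda>v. \<Sum>b\<in>Basis. (dderiv g x v \<bullet> b) *\<^sub>R dderiv f (g x) b)) (at x)"
      using has_derivative_compose[OF gd[OF x] fd[OF x]] by simp
  next
    fix v
    have "Ck_on k S (\<lambda>x. dderiv f (g x) b)" for b
      using Suc.IH[of "\<lambda>y. dderiv f y b"] Suc.prems Ck_on_SucD by auto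
    moreover have "Ck_on k S (\<lambda>x. dderiv g x v \<bullet> b)" for b
      using Suc.prems by (intro Ck_on_bounded_linear[OF assms(1) bounded_linear_inner_left]) auto
    ultimately show "Ck_on k S (\<lambda>x. \<Sum>b\<in>Basis. (dderiv g x v \<bullet> b) *\<^sub>R dderiv f (g x) b)"
      by (intro Ck_on_sum Ck_on_scaleR assms(1))
  qed
qed

lemma Ck_on_inverse:
  fixes f :: "'a::real_normed_vector \<Rightarrow> real"
  assumes "open S" "Ck_on k S f" "\<And>x. x \<in> S \<Longrightarrow> f x \<noteq> 0"
  shows "Ck_on k S (\<lambda>x. inverse (f x))"
  using assms(2)
proof (induction k)
  case 0 then show ?case using assms(3) by (simp add: continuous_on_inverse)
next
  case (Suc k)
  then have IH: "Ck_on k S (\<lambda>x. inverse (f x))" using Ck_on_SucD by blast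
  show ?case
  proof (rule Ck_on_SucI[OF assms(1), where f'="\<lambda>x v. - 1 * (inverse (f x) * dderiv f x v * inverse (f x))"])
    fix x assume x: "x \<in> S"
    then have "(f has_derivative frechet_derivative f (at x)) (at x)" using Suc.prems by (intro has_dderiv) auto
    from Deriv.has_derivative_inverse[OF assms(3)[OF x] this]
    show "((\<lambda>x. inverse (f x)) has_derivative (\<lambda>v. - 1 * (inverse (f x) * dderiv f x v * inverse (f x)))) (at x)" by simp
  next
    show "Ck_on k S (\<lambda>x. - 1 * (inverse (f x) * dderiv f x v * inverse (f x)))" for v
      using Suc.prems by (intro Ck_on_mult[OF assms(1)] IH) auto
  qed
qed

text \<open>Both mixed derivatives are limits of the same second difference quotient.\<close>

lemma second_difference:
  fixes f :: "'a::real_normed_vector \<Rightarrow> real"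
  assumes C: "Ck_on (Suc (Suc 0)) S f" and S: "ball x r \<subseteq> S" and h: "h > 0" "h * (norm v + norm w) < r"
  shows "\<exists>p. norm (p - x) \<le> h * (norm v + norm w) \<and>
    f (x + h *\<^sub>R v + h *\<^sub>R w) - f (x + h *\<^sub>R v) - f (x + h *\<^sub>R w) + f x = h * h * dderiv (\<lambda>y. dderiv f y v) p w"
proof -
  have bnd: "norm (s *\<^sub>R v + t *\<^sub>R w) \<le> h * (norm v + norm w)" if "s \<in> {0..h}" "t \<in> {0..h}" for s t
  proof -
    have "norm (s *\<^sub>R v + t *\<^sub>R w) \<le> s * norm v + t * norm w"
      using norm_triangle_ineq[of "s *\<^sub>R v" "t *\<^sub>R w"] that by auto
    also have "\<dots> \<le> h * norm v + h * norm w" using that by (intro add_mono mult_right_mono) auto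
    finally show ?thesis by (simp add: algebra_simps)
  qed
  have inS: "x + s *\<^sub>R v + t *\<^sub>R w \<in> S" if "s \<in> {0..h}" "t \<in> {0..h}" for s t
  proof -
    have "norm (s *\<^sub>R v + t *\<^sub>R w) < r" using bnd[OF that] h(2) by linarith
    moreover have "x + s *\<^sub>R v + t *\<^sub>R w - x = s *\<^sub>R v + t *\<^sub>R w" by simp
    ultimately have "x + s *\<^sub>R v + t *\<^sub>R w \<in> ball x r" by (metis dist_commute dist_norm mem_ball)
    then show ?thesis using S by blast
  qed
  have dv: "((\<lambda>s. F (x + s *\<^sub>R v + t *\<^sub>R w)) has_real_derivative dderiv F (x + s *\<^sub>R v + t *\<^sub>R w) v) (at s)"
    if "F differentiable (at (x + s *\<^sub>R v + t *\<^sub>R w))" for F :: "'a \<Rightarrow> real" and s t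
  proof -
    have "((\<lambda>s. x + s *\<^sub>R v + t *\<^sub>R w) has_derivative (\<lambda>k. k *\<^sub>R v)) (at s)"
      by (auto intro!: derivative_eq_intros)
    from has_derivative_compose[OF this has_dderiv[OF that]]
    show ?thesis
      using linear_cmul[OF linear_dderiv[OF that]] by (simp add: has_field_derivative_def mult_commute_abs)
  qed
  have dw: "((\<lambda>t. F (x + s *\<^sub>R v + t *\<^sub>R w)) has_real_derivative dderiv F (x + s *\<^sub>R v + t *\<^sub>R w) w) (at t)"
    if "F differentiable (at (x + s *\<^sub>R v + t *\<^sub>R w))" for F :: "'a \<Rightarrow> real" and s t
  proof -
    have "((\<lambda>t. x + s *\<^sub>R v + t *\<^sub>R w) has_derivative (\<lambda>k. k *\<^sub>R w)) (at t)"
      by (auto intro!: derivative_eq_intros)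
    from has_derivative_compose[OF this has_dderiv[OF that]]
    show ?thesis
      using linear_cmul[OF linear_dderiv[OF that]] by (simp add: has_field_derivative_def mult_commute_abs)
  qed
  \<comment> \<open>The increment along \<open>h *\<^sub>R w\<close>, so that
    \<open>\<phi> h - \<phi> 0\<close> is the second difference. The mean value theorem is applied
    to it along \<open>v\<close> first and then along \<open>w\<close>; the term
    \<open>0 *\<^sub>R w\<close> gives both points the same shape.\<close>
  define \<phi> where "\<phi> s = f (x + s *\<^sub>R v + h *\<^sub>R w) - f (x + s *\<^sub>R v + 0 *\<^sub>R w)" for s
  have "\<exists>z>0. z < h \<and> \<phi> h - \<phi> 0 = (h - 0) * (dderiv f (x + z *\<^sub>R v + h *\<^sub>R w) v - dderiv f (x + z *\<^sub>R v + 0 *\<^sub>R w) v)"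
  proof (rule MVT2[OF h(1)])
    fix s assume "0 \<le> s" "s \<le> h"
    then show "(\<phi> has_real_derivative dderiv f (x + s *\<^sub>R v + h *\<^sub>R w) v - dderiv f (x + s *\<^sub>R v + 0 *\<^sub>R w) v) (at s)"
      unfolding \<phi>_def using C h(1) inS[of s h] inS[of s 0] by (intro DERIV_diff dv) auto
  qed
  then obtain z where z: "0 < z" "z < h"
    "\<phi> h - \<phi> 0 = h * (dderiv f (x + z *\<^sub>R v + h *\<^sub>R w) v - dderiv f (x + z *\<^sub>R v + 0 *\<^sub>R w) v)" by auto
  have "\<exists>y>0. y < h \<and> dderiv f (x + z *\<^sub>R v + h *\<^sub>R w) v - dderiv f (x + z *\<^sub>R v + 0 *\<^sub>R w) v
     = (h - 0) * dderiv (\<lambda>y. dderiv f y v) (x + z *\<^sub>R v + y *\<^sub>R w) w"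
  proof (rule MVT2[OF h(1)])
    fix t assume "0 \<le> t" "t \<le> h"
    then show "((\<lambda>t. dderiv f (x + z *\<^sub>R v + t *\<^sub>R w) v) has_real_derivative
      dderiv (\<lambda>y. dderiv f y v) (x + z *\<^sub>R v + t *\<^sub>R w) w) (at t)"
      using C z inS[of z t] by (intro dw[where F="\<lambda>y. dderiv f y v"]) auto
  qed
  then obtain y where y: "0 < y" "y < h" "dderiv f (x + z *\<^sub>R v + h *\<^sub>R w) v - dderiv f (x + z *\<^sub>R v + 0 *\<^sub>R w) v
     = h * dderiv (\<lambda>y. dderiv f y v) (x + z *\<^sub>R v + y *\<^sub>R w) w" by auto
  have "norm (x + z *\<^sub>R v + y *\<^sub>R w - x) \<le> h * (norm v + norm w)"
    using bnd[of z y] z y by (simp add: algebra_simps)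
  moreover have "f (x + h *\<^sub>R v + h *\<^sub>R w) - f (x + h *\<^sub>R v) - f (x + h *\<^sub>R w) + f x
      = h * h * dderiv (\<lambda>y. dderiv f y v) (x + z *\<^sub>R v + y *\<^sub>R w) w"
    using z(3) unfolding y(3) by (simp add: \<phi>_def)
  ultimately show ?thesis by blast
qed

lemma second_derivative_symmetric_real:
  fixes f :: "'a::real_normed_vector \<Rightarrow> real"
  assumes C: "Ck_on (Suc (Suc 0)) S f" and S: "open S" "x \<in> S"
  shows "dderiv (\<lambda>y. dderiv f y v) x w = dderiv (\<lambda>y. dderiv f y w) x v"
proof (rule ccontr)
  define A where "A y = dderiv (\<lambda>y. dderiv f y v) y w" for y
  define B where "B y = dderiv (\<lambda>y. dderiv f y w) y v" for y
  \<comment> \<open>Half the gap: the nearby values \<open>A p\<close> and \<open>B q\<close> will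
    coincide, yet each would lie within less than \<open>e\<close> of \<open>A x\<close> and
    \<open>B x\<close> respectively.\<close>
  define e where "e = \<bar>A x - B x\<bar> / 2"
  assume "dderiv (\<lambda>y. dderiv f y v) x w \<noteq> dderiv (\<lambda>y. dderiv f y w) x v"
  then have e: "e > 0" by (simp add: e_def A_def B_def)
  have "isCont A x" "isCont B x"
    unfolding A_def B_def using C S by (auto simp: continuous_on_eq_continuous_at)
  moreover have "\<exists>d>0. \<forall>y. norm (y - x) < d \<longrightarrow> \<bar>F y - F x\<bar> < e" if "isCont F x" for F :: "'a \<Rightarrow> real"
    using that[unfolded continuous_at_eps_delta dist_norm real_norm_def, rule_format, OF e] .
  ultimately obtain d1 d2 where d: "d1 > 0" "\<And>y. norm (y - x) < d1 \<Longrightarrow> \<bar>A y - A x\<bar> < e"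
    "d2 > 0" "\<And>y. norm (y - x) < d2 \<Longrightarrow> \<bar>B y - B x\<bar> < e" by meson
  obtain d3 where d3: "d3 > 0" "ball x d3 \<subseteq> S" using S open_contains_ball by blast
  define r where "r = min d1 (min d2 d3)"
  \<comment> \<open>Keeps the intermediate points within \<open>r / 2\<close> of \<open>x\<close>;
    the summand 1 covers the case that both directions are zero.\<close>
  define h where "h = (r / 2) / (norm v + norm w + 1)"
  have r: "r > 0" using d d3 by (simp add: r_def)
  have n: "norm v + norm w + 1 > 0" by (simp add: add_nonneg_pos)
  have h: "h > 0" using r n by (simp add: h_def)
  have "h * (norm v + norm w) \<le> h * (norm v + norm w + 1)" using h by simp
  also have "\<dots> = r / 2" unfolding h_def using n by (intro nonzero_eq_divide_eq[THEN iffD1, OF _ refl]) simp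
  also have "\<dots> < r" using r by simp
  finally have hr: "h * (norm v + norm w) < r" .
  have rs: "ball x r \<subseteq> S" using d3 by (auto simp: r_def)
  obtain p where p: "norm (p - x) \<le> h * (norm v + norm w)"
    "f (x + h *\<^sub>R v + h *\<^sub>R w) - f (x + h *\<^sub>R v) - f (x + h *\<^sub>R w) + f x = h * h * A p"
    using second_difference[OF C rs h hr] unfolding A_def by blast
  have hr': "h * (norm w + norm v) < r" using hr by (simp add: add.commute)
  obtain q where q: "norm (q - x) \<le> h * (norm w + norm v)"
    "f (x + h *\<^sub>R w + h *\<^sub>R v) - f (x + h *\<^sub>R w) - f (x + h *\<^sub>R v) + f x = h * h * B q"
    using second_difference[OF C rs h hr'] unfolding B_def by blast
  have "h * h * A p = h * h * B q" using p(2) q(2) by (simp add: algebra_simps)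
  then have "A p = B q" using h by simp
  moreover have "\<bar>A p - A x\<bar> < e" using p(1) hr by (intro d(2)) (auto simp: r_def)
  moreover have "\<bar>B q - B x\<bar> < e" using q(1) hr' by (intro d(4)) (auto simp: r_def)
  moreover have "False" if "a = b" "\<bar>a - c\<bar> < \<bar>c - d\<bar> / 2" "\<bar>b - d\<bar> < \<bar>c - d\<bar> / 2" for a b c d :: real
    using that abs_triangle_ineq[of "c - a" "a - d"] abs_minus_commute[of c a] by (simp del: abs_minus_commute)
  ultimately show False unfolding e_def by blast
qed

lemma second_derivative_symmetric:
  fixes f :: "'a::real_normed_vector \<Rightarrow> 'b::euclidean_space"
  assumes C: "Ck_on (Suc (Suc 0)) S f" and S: "open S" "x \<in> S"
  shows "dderiv (\<lambda>y. dderiv f y v) x w = dderiv (\<lambda>y. dderiv f y w) x v"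
proof (rule euclidean_eqI)
  fix b :: 'b assume "b \<in> Basis"
  have L: "bounded_linear (\<lambda>z. z \<bullet> b)" by (rule bounded_linear_inner_left)
  have d1: "dderiv (\<lambda>y. f y \<bullet> b) y u = dderiv f y u \<bullet> b" if "y \<in> S" for y u
    using C that by (intro dderiv_bounded_linear[OF L]) auto
  have "dderiv (\<lambda>y. dderiv (\<lambda>y. f y \<bullet> b) y u) x u' = dderiv (\<lambda>y. dderiv f y u) x u' \<bullet> b" for u u'
  proof -
    have "dderiv (\<lambda>y. dderiv f y u \<bullet> b) x u' = dderiv (\<lambda>y. dderiv (\<lambda>y. f y \<bullet> b) y u) x u'"
      using C S by (intro dderiv_cong(1)[OF S] differentiable_bounded_linear[OF L]) (auto simp: d1)
    moreover have "dderiv (\<lambda>y. dderiv f y u \<bullet> b) x u' = dderiv (\<lambda>y. dderiv f y u) x u' \<bullet> b"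
      using C S by (intro dderiv_bounded_linear[OF L]) auto
    ultimately show ?thesis by simp
  qed
  then show "dderiv (\<lambda>y. dderiv f y v) x w \<bullet> b = dderiv (\<lambda>y. dderiv f y w) x v \<bullet> b"
    using second_derivative_symmetric_real[OF Ck_on_bounded_linear[OF S(1) L C] S] by metis
qed

subsection \<open>The exterior derivative in coordinates\<close>

definition form_differentiable :: "('a::real_normed_vector \<Rightarrow> 'v cform) \<Rightarrow> 'a \<Rightarrow> bool" where
  "form_differentiable a x \<longleftrightarrow> (\<forall>vs. (\<lambda>y. a y vs) differentiable (at x))"

definition form_dderiv :: "('a::real_normed_vector \<Rightarrow> 'v cform) \<Rightarrow> 'a \<Rightarrow> 'a \<Rightarrow> 'v cform" where
  "form_dderiv a x v = (\<lambda>vs. dderiv (\<lambda>y. a y vs) x v)"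

lemma local_ext_deriv_Nil [simp]: "local_ext_deriv a x [] = 0"
  by (simp add: local_ext_deriv_def)

text \<open>Cartan's formula for a constant vector field, again a recursion on the argument list.\<close>

lemma local_ext_deriv_Cons:
  "local_ext_deriv a x (v # vs) = form_dderiv a x v vs - local_ext_deriv (\<lambda>y. contract v (a y)) x vs"
  unfolding local_ext_deriv_def form_dderiv_def length_Cons sum.lessThan_Suc_shift contract_def
  by (simp add: sum_negf)

lemma contract_local_ext_deriv:
  "contract v (local_ext_deriv a x) = (\<lambda>vs. form_dderiv a x v vs - local_ext_deriv (\<lambda>y. contract v (a y)) x vs)"
  by (simp add: contract_def[of v "local_ext_deriv a x"] local_ext_deriv_Cons)

lemma form_differentiable_contract:
  "form_differentiable a x \<Longrightarrow> form_differentiable (\<lambda>y. contract v (a y)) x"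
  by (simp add: form_differentiable_def contract_def)

lemma form_differentiable_twist:
  "form_differentiable a x \<Longrightarrow> form_differentiable (\<lambda>y. twist (a y)) x"
  by (auto simp: form_differentiable_def twist_def intro!: differentiable_mult)

lemma form_differentiable_wedge:
  assumes "form_differentiable a x" "form_differentiable b x"
  shows "form_differentiable (\<lambda>y. wedge (a y) (b y)) x"
  using assms unfolding form_differentiable_def wedge_def
  by (auto intro!: differentiable_sum differentiable_mult)

lemma local_ext_deriv_cong:
  assumes "open S" "x \<in> S" "\<And>y. y \<in> S \<Longrightarrow> a y = b y" "form_differentiable a x"
  shows "local_ext_deriv a x vs = local_ext_deriv b x vs" "form_differentiable b x"
proof -
  have "dderiv (\<lambda>y. a y ws) x v = dderiv (\<lambda>y. b y ws) x v" "(\<lambda>y. b y ws) differentiable (at x)" for ws v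
    using dderiv_cong[OF assms(1,2), of "\<lambda>y. a y ws" "\<lambda>y. b y ws"] assms(3,4) by (auto simp: form_differentiable_def)
  then show "local_ext_deriv a x vs = local_ext_deriv b x vs" "form_differentiable b x"
    by (auto simp: local_ext_deriv_def form_differentiable_def)
qed

lemma local_ext_deriv_add:
  assumes "form_differentiable a x" "form_differentiable b x"
  shows "local_ext_deriv (\<lambda>y vs. a y vs + b y vs) x vs = local_ext_deriv a x vs + local_ext_deriv b x vs"
  using assms by (simp add: local_ext_deriv_def form_differentiable_def dderiv_add sum.distrib algebra_simps)

lemma local_ext_deriv_sum:
  assumes "\<And>i. i \<in> I \<Longrightarrow> form_differentiable (a i) x"
  shows "local_ext_deriv (\<lambda>y vs. \<Sum>i\<in>I. a i y vs) x vs = (\<Sum>i\<in>I. local_ext_deriv (a i) x vs)"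
proof -
  have "dderiv (\<lambda>y. \<Sum>i\<in>I. a i y ws) x v = (\<Sum>i\<in>I. dderiv (\<lambda>y. a i y ws) x v)" for ws v
    using assms by (intro dderiv_sum) (auto simp: form_differentiable_def)
  then show ?thesis unfolding local_ext_deriv_def by (subst sum.swap) (simp add: sum_distrib_left)
qed

lemma local_ext_deriv_minus:
  assumes "form_differentiable a x"
  shows "local_ext_deriv (\<lambda>y vs. - a y vs) x vs = - local_ext_deriv a x vs"
  using assms by (simp add: local_ext_deriv_def form_differentiable_def dderiv_minus sum_negf)

lemma form_dderiv_twist:
  assumes "form_differentiable a x"
  shows "form_dderiv (\<lambda>y. twist (a y)) x v = twist (form_dderiv a x v)"
  using assms by (simp add: form_dderiv_def twist_def form_differentiable_def dderiv_cmult)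

text \<open>The exterior derivative raises the degree by one and hence anticommutes with the grading
  involution.\<close>

lemma local_ext_deriv_twist:
  assumes "form_differentiable a x"
  shows "local_ext_deriv (\<lambda>y. twist (a y)) x vs = - twist (local_ext_deriv a x) vs"
  using assms
proof (induction vs arbitrary: a)
  case (Cons v vs)
  have c: "form_differentiable (\<lambda>y. contract v (a y)) x" "form_differentiable (\<lambda>y. twist (contract v (a y))) x"
    by (intro form_differentiable_twist form_differentiable_contract Cons.prems)+
  have "local_ext_deriv (\<lambda>y. twist (a y)) x (v # vs) = twist (form_dderiv a x v) vs + local_ext_deriv (\<lambda>y. twist (contract v (a y))) x vs"
    by (simp add: local_ext_deriv_Cons contract_twist local_ext_deriv_minus[OF c(2)] form_dderiv_twist[OF Cons.prems])
  also have "\<dots> = - twist (local_ext_deriv a x) (v # vs)"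
    unfolding Cons.IH[OF c(1)] by (simp add: twist_def local_ext_deriv_Cons algebra_simps)
  finally show ?case .
qed (simp add: twist_def)

lemma form_dderiv_wedge:
  assumes "form_differentiable a x" "form_differentiable b x"
  shows "form_dderiv (\<lambda>y. wedge (a y) (b y)) x v vs = wedge (form_dderiv a x v) (b x) vs + wedge (a x) (form_dderiv b x v) vs"
proof -
  have "dderiv (\<lambda>y. shuffle_sign I m * a y us * b y ws) x v
      = shuffle_sign I m * dderiv (\<lambda>y. a y us) x v * b x ws + shuffle_sign I m * a x us * dderiv (\<lambda>y. b y ws) x v"
    for I m us ws
    using assms by (simp add: form_differentiable_def mult.assoc dderiv_cmult dderiv_mult algebra_simps)
  moreover have "(\<lambda>y. shuffle_sign I m * a y us * b y ws) differentiable (at x)" for I m us ws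
    using assms by (auto simp: form_differentiable_def intro!: differentiable_mult)
  ultimately show ?thesis
    unfolding form_dderiv_def wedge_def by (simp add: dderiv_sum sum.distrib)
qed

text \<open>Both sides satisfy the same recursion, by Cartan's formula and the Leibniz rule for
  contractions. The induction hypothesis is used for \<open>contract v a\<close> with
  \<open>b\<close> and for \<open>twist a\<close> with \<open>contract v b\<close>, hence the
  generality in both factors.\<close>

lemma local_ext_deriv_wedge:
  fixes a b :: "real ^ 'd::finite \<Rightarrow> (real ^ 'd) cform"
  assumes "form_differentiable a x" "form_differentiable b x"
  shows "local_ext_deriv (\<lambda>y. wedge (a y) (b y)) x vs =
    wedge (local_ext_deriv a x) (b x) vs + wedge (twist (a x)) (local_ext_deriv b x) vs"
  using assms
proof (induction vs arbitrary: a b)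
  case Nil show ?case by (simp add: wedge_Nil)
next
  case (Cons v vs)
  note fd = form_differentiable_contract[OF Cons.prems(1), of v] form_differentiable_contract[OF Cons.prems(2), of v]
    form_differentiable_twist[OF Cons.prems(1)]
  have tl: "twist (local_ext_deriv a x) = (\<lambda>vs. - local_ext_deriv (\<lambda>y. twist (a y)) x vs)"
    by (simp add: local_ext_deriv_twist[OF Cons.prems(1)])
  have sub: "wedge (\<lambda>vs. p vs - q vs) c vs = wedge p c vs - wedge q c vs"
    "wedge c (\<lambda>vs. p vs - q vs) vs = wedge c p vs - wedge c q vs" for p q c :: "(real ^ 'd) cform" and vs
    using wedge_add_left[of p "\<lambda>vs. - q vs" c vs] wedge_add_right[of c p "\<lambda>vs. - q vs" vs]
    by (simp_all add: wedge_minus_left wedge_minus_right)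
  have "local_ext_deriv (\<lambda>y. contract v (wedge (a y) (b y))) x vs
      = local_ext_deriv (\<lambda>y. wedge (contract v (a y)) (b y)) x vs + local_ext_deriv (\<lambda>y. wedge (twist (a y)) (contract v (b y))) x vs"
    unfolding contract_wedge by (intro local_ext_deriv_add form_differentiable_wedge fd Cons.prems)
  then show ?case
    unfolding local_ext_deriv_Cons form_dderiv_wedge[OF Cons.prems] wedge_Cons
    by (simp add: Cons.IH[OF fd(1) Cons.prems(2)] Cons.IH[OF fd(3) fd(2)] contract_local_ext_deriv tl
        contract_twist sub wedge_minus_left algebra_simps)
qed

lemma linear_dderiv_family:
  assumes "open S" "x \<in> S" "\<And>y. y \<in> S \<Longrightarrow> linear (\<lambda>v. F v y)" "\<And>v. (\<lambda>y. F v y) differentiable (at x)"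
  shows "linear (\<lambda>v. dderiv (F v) x w :: 'b::real_normed_vector)"
proof (rule linearI)
  fix u v
  have "dderiv (\<lambda>y. F u y + F v y) x w = dderiv (F (u + v)) x w"
    by (rule dderiv_cong(1)[OF assms(1,2) _ differentiable_add[OF assms(4,4)]])
      (simp add: linear_add[OF assms(3)])
  then show "dderiv (F (u + v)) x w = dderiv (F u) x w + dderiv (F v) x w"
    using dderiv_add[OF assms(4,4)] by simp
next
  fix c v
  have "dderiv (\<lambda>y. c *\<^sub>R F v y) x w = dderiv (F (c *\<^sub>R v)) x w"
    by (rule dderiv_cong(1)[OF assms(1,2) _ differentiable_bounded_linear[OF bounded_linear_scaleR_right assms(4)]])
      (simp add: linear_cmul[OF assms(3)])
  then show "dderiv (F (c *\<^sub>R v)) x w = c *\<^sub>R dderiv (F v) x w"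
    using dderiv_bounded_linear[OF bounded_linear_scaleR_right assms(4)] by simp
qed

lemma dderiv_eq_0:
  assumes "open S" "x \<in> S" "\<And>y. y \<in> S \<Longrightarrow> f y = 0" shows "dderiv f x v = 0"
  using dderiv_cong(1)[OF assms(1,2), of "\<lambda>y. 0" f] assms(3) by simp

lemma alternating_form_dderiv:
  fixes a :: "'a::real_normed_vector \<Rightarrow> 'v::real_vector cform"
  assumes S: "open S" "x \<in> S" and a: "\<And>y. y \<in> S \<Longrightarrow> alternating k (a y)" and d: "form_differentiable a x"
  shows "alternating k (form_dderiv a x v)"
  unfolding alternating_def form_dderiv_def
proof (intro conjI allI impI)
  fix vs :: "'v list" assume "length vs \<noteq> k"
  then show "dderiv (\<lambda>y. a y vs) x v = 0"
    by (intro dderiv_eq_0[OF S] alternating_length[OF a])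
next
  fix vs :: "'v list" and i assume "length vs = k" "i < k"
  then show "linear (\<lambda>u. dderiv (\<lambda>y. a y (vs[i := u])) x v)"
    using d by (intro linear_dderiv_family[OF S] alternating_linear[OF a]) (auto simp: form_differentiable_def)
next
  fix vs :: "'v list" and i j assume "length vs = k" "i < j" "j < k" "vs ! i = vs ! j"
  then show "dderiv (\<lambda>y. a y vs) x v = 0"
    by (intro dderiv_eq_0[OF S] alternating_eq[OF a])
qed

lemma alternating_local_ext_deriv:
  fixes a :: "real ^ 'd::finite \<Rightarrow> (real ^ 'd) cform"
  assumes S: "open S" "x \<in> S" and "\<And>y. y \<in> S \<Longrightarrow> alternating k (a y)" "form_differentiable a x"
  shows "alternating (Suc k) (local_ext_deriv a x)"
  using assms(3,4)
proof (induction k arbitrary: a)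
  case 0
  note fd = form_differentiable_contract[OF 0(2)]
  have z: "local_ext_deriv (\<lambda>y. contract v (a y)) x vs = 0" for v vs
  proof -
    have "local_ext_deriv (\<lambda>y. contract v (a y)) x vs = local_ext_deriv (\<lambda>y ws. 0) x vs"
      by (rule local_ext_deriv_cong(1)[OF S _ fd]) (use 0(1) in \<open>auto simp: alternating_0 contract_def\<close>)
    then show ?thesis by (simp add: local_ext_deriv_def)
  qed
  show ?case
  proof (rule alternating_SucI)
    show "alternating 0 (contract v (local_ext_deriv a x))" for v
      using alternating_form_dderiv[OF S 0, of v] by (simp add: contract_local_ext_deriv z)
    show "linear (\<lambda>v. local_ext_deriv a x (v # vs))" for vs
      unfolding local_ext_deriv_Cons z form_dderiv_def
      using 0(2) by (simp add: form_differentiable_def linear_dderiv)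
    show "local_ext_deriv a x (v # v # vs) = 0" for v vs
      using dderiv_eq_0[OF S, of "\<lambda>y. a y (v # vs)" v] 0(1)
      by (simp add: local_ext_deriv_Cons[of a] z form_dderiv_def alternating_0)
  qed simp
next
  case (Suc k)
  note fd = form_differentiable_contract[OF Suc.prems(2)]
  note alt = alternating_contract[OF Suc.prems(1)]
  show ?case
  proof (rule alternating_SucI)
    fix v
    have "alternating (Suc k) (local_ext_deriv (\<lambda>y. contract v (a y)) x)" by (rule Suc.IH[OF alt fd])
    then show "alternating (Suc k) (contract v (local_ext_deriv a x))"
      using alternating_add[OF alternating_form_dderiv[OF S Suc.prems, of v] alternating_minus]
      by (fastforce simp: contract_local_ext_deriv)
  next
    fix vs
    have "linear (\<lambda>v. local_ext_deriv (\<lambda>y. contract v (a y)) x vs)"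
    proof -
      have "linear (\<lambda>v. dderiv (\<lambda>y. a y (v # ws)) x w)" for ws w
        using Suc.prems(2) by (intro linear_dderiv_family[OF S] alternating_linear_head[OF Suc.prems(1)])
          (auto simp: form_differentiable_def)
      moreover have "linear (\<lambda>v. z * f v)" if "linear f" for z and f :: "real ^ 'd \<Rightarrow> complex"
        using linear_compose[OF that bounded_linear.linear[OF bounded_linear_mult_right[of z]]] by (simp add: o_def)
      ultimately show ?thesis unfolding local_ext_deriv_def contract_def
        by (intro linear_compose_sum ballI) auto
    qed
    then show "linear (\<lambda>v. local_ext_deriv a x (v # vs))"
      unfolding local_ext_deriv_Cons form_dderiv_def
      using Suc.prems(2) by (intro linear_compose_sub) (simp_all add: form_differentiable_def linear_dderiv)
  next
    fix v vs
    \<comment> \<open>For a repeated head the two derivative terms of Cartan's formula cancel, and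
      what remains is the exterior derivative of a form contracted twice with
      \<open>v\<close>.\<close>
    have "local_ext_deriv (\<lambda>y. contract v (contract v (a y))) x vs = local_ext_deriv (\<lambda>y ws. 0) x vs"
    proof (rule local_ext_deriv_cong(1)[OF S _ form_differentiable_contract[OF fd]])
      show "contract v (contract v (a y)) = (\<lambda>ws. 0)" if "y \<in> S" for y
        unfolding contract_def using alternating_head_eq[OF Suc.prems(1)[OF that]] by simp
    qed
    then show "local_ext_deriv a x (v # v # vs) = 0"
      by (simp add: local_ext_deriv_Cons form_dderiv_def contract_def) (simp add: local_ext_deriv_def)
  qed simp
qed

section \<open>Forms evaluated on moving arguments\<close>

text \<open>A product rule for evaluation. The moving argument enters linearly, so expanding it in
  \<open>Basis\<close> reduces the claim to products of real coefficients with values of the form at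
  fixed arguments.\<close>

lemma dderiv_head:
  fixes X :: "'a::real_normed_vector \<Rightarrow> 'v::euclidean_space"
  assumes S: "open S" "x \<in> S" and b: "\<And>y. y \<in> S \<Longrightarrow> alternating k (b y)" "form_differentiable b x"
    and X: "X differentiable (at x)"
  shows "dderiv (\<lambda>y. b y (X y # ws)) x w = dderiv (\<lambda>y. b y (X x # ws)) x w + b x (dderiv X x w # ws)"
    "(\<lambda>y. b y (X y # ws)) differentiable (at x)"
proof -
  let ?G = "\<lambda>y. \<Sum>e\<in>Basis. (X y \<bullet> e) *\<^sub>R b y (e # ws)"
  have exp: "b y (v # ws) = (\<Sum>e\<in>Basis. (v \<bullet> e) *\<^sub>R b y (e # ws))" if "y \<in> S" for y v
  proof -
    have "b y ((\<Sum>e\<in>Basis. (v \<bullet> e) *\<^sub>R e) # ws) = (\<Sum>e\<in>Basis. (v \<bullet> e) *\<^sub>R b y (e # ws))"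
      using that by (simp only: alternating_head_sum[OF b(1)] alternating_head_scale[OF b(1)])
    then show ?thesis by (simp add: euclidean_representation)
  qed
  have dX: "(\<lambda>y. X y \<bullet> e) differentiable (at x)" "dderiv (\<lambda>y. X y \<bullet> e) x w = dderiv X x w \<bullet> e" for e
    using differentiable_bounded_linear[OF bounded_linear_inner_left X] dderiv_bounded_linear[OF bounded_linear_inner_left X] by auto
  have db: "(\<lambda>y. b y vs) differentiable (at x)" for vs using b(2) by (simp add: form_differentiable_def)
  have dG: "(\<lambda>y. (X y \<bullet> e) *\<^sub>R b y (e # ws)) differentiable (at x)" for e
    using dderiv_bilinear(2)[OF bounded_bilinear_scaleR dX(1) db] .
  have G: "?G differentiable (at x)" by (intro differentiable_sum) (auto intro: dG)
  show "(\<lambda>y. b y (X y # ws)) differentiable (at x)"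
    by (rule dderiv_cong(2)[OF S _ G]) (simp add: exp)
  have "dderiv (\<lambda>y. b y (X y # ws)) x w = dderiv ?G x w"
    by (rule dderiv_cong(1)[OF S _ G, symmetric]) (simp add: exp)
  also have "\<dots> = (\<Sum>e\<in>Basis. (X x \<bullet> e) *\<^sub>R dderiv (\<lambda>y. b y (e # ws)) x w + (dderiv X x w \<bullet> e) *\<^sub>R b x (e # ws))"
    by (subst dderiv_sum[OF dG]) (simp add: dderiv_bilinear(1)[OF bounded_bilinear_scaleR dX(1) db] dX(2))
  also have "\<dots> = (\<Sum>e\<in>Basis. (X x \<bullet> e) *\<^sub>R dderiv (\<lambda>y. b y (e # ws)) x w) + b x (dderiv X x w # ws)"
    by (simp add: sum.distrib exp[OF S(2), of "dderiv X x w"])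
  also have "(\<Sum>e\<in>Basis. (X x \<bullet> e) *\<^sub>R dderiv (\<lambda>y. b y (e # ws)) x w) = dderiv (\<lambda>y. b y (X x # ws)) x w"
  proof -
    have d: "(\<lambda>y. (X x \<bullet> e) *\<^sub>R b y (e # ws)) differentiable (at x)" for e
      by (rule differentiable_bounded_linear[OF bounded_linear_scaleR_right db])
    have "dderiv (\<lambda>y. b y (X x # ws)) x w = dderiv (\<lambda>y. \<Sum>e\<in>Basis. (X x \<bullet> e) *\<^sub>R b y (e # ws)) x w"
      by (rule dderiv_cong(1)[OF S _ db]) (rule exp)
    then show ?thesis
      by (simp add: dderiv_sum[OF d] dderiv_bounded_linear[OF bounded_linear_scaleR_right db])
  qed
  finally show "dderiv (\<lambda>y. b y (X y # ws)) x w = dderiv (\<lambda>y. b y (X x # ws)) x w + b x (dderiv X x w # ws)" .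
qed

lemma form_differentiable_head:
  fixes X :: "'a::real_normed_vector \<Rightarrow> 'v::euclidean_space"
  assumes S: "open S" "x \<in> S" and b: "\<And>y. y \<in> S \<Longrightarrow> alternating k (b y)" "form_differentiable b x"
    and X: "X differentiable (at x)"
  shows "form_differentiable (\<lambda>y. contract (X y) (b y)) x"
  unfolding form_differentiable_def contract_def using dderiv_head(2)[OF assms] by blast

lemma dderiv_moving_list:
  fixes Xs :: "('a::real_normed_vector \<Rightarrow> 'v::euclidean_space) list"
  assumes S: "open S" "x \<in> S" and "\<And>y. y \<in> S \<Longrightarrow> alternating k (b y)" "form_differentiable b x"
    and "\<And>X. X \<in> set Xs \<Longrightarrow> X differentiable (at x)"
  shows "dderiv (\<lambda>y. b y (map (\<lambda>X. X y) Xs)) x w =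
      dderiv (\<lambda>y. b y (map (\<lambda>X. X x) Xs)) x w + (\<Sum>j<length Xs. b x ((map (\<lambda>X. X x) Xs)[j := dderiv (Xs ! j) x w]))"
    "(\<lambda>y. b y (map (\<lambda>X. X y) Xs)) differentiable (at x)"
  using assms(3-5)
proof (induction Xs arbitrary: b k)
  case Nil
  { case 1 then show ?case by simp }
  { case 2 then show ?case by (simp add: form_differentiable_def) }
next
  case (Cons X Xs)
  have X: "X differentiable (at x)" "\<And>Y. Y \<in> set Xs \<Longrightarrow> Y differentiable (at x)"
    if "\<And>Y. Y \<in> set (X # Xs) \<Longrightarrow> Y differentiable (at x)" using that by auto
  {
    case 1
    note fd = form_differentiable_head[OF S 1(1,2) X(1)[OF 1(3)]]
    note alt = alternating_contract_gen[OF 1(1)]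
    have "dderiv (\<lambda>y. b y (map (\<lambda>X. X y) (X # Xs))) x w = dderiv (\<lambda>y. contract (X y) (b y) (map (\<lambda>X. X y) Xs)) x w"
      by (simp add: contract_def)
    also have "\<dots> = dderiv (\<lambda>y. contract (X y) (b y) (map (\<lambda>X. X x) Xs)) x w
        + (\<Sum>j<length Xs. contract (X x) (b x) ((map (\<lambda>X. X x) Xs)[j := dderiv (Xs ! j) x w]))"
      by (rule Cons.IH(1)[OF alt fd X(2)[OF 1(3)]])
    also have "dderiv (\<lambda>y. contract (X y) (b y) (map (\<lambda>X. X x) Xs)) x w
      = dderiv (\<lambda>y. b y (map (\<lambda>X. X x) (X # Xs))) x w + b x (dderiv X x w # map (\<lambda>X. X x) Xs)"
      using dderiv_head(1)[OF S 1(1,2) X(1)[OF 1(3)]] by (simp add: contract_def)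
    finally show ?case by (simp add: sum.lessThan_Suc_shift contract_def del: sum.lessThan_Suc)
  }
  {
    case 2
    note fd = form_differentiable_head[OF S 2(1,2) X(1)[OF 2(3)]]
    note alt = alternating_contract_gen[OF 2(1)]
    show ?case using Cons.IH(2)[OF alt fd X(2)[OF 2(3)]] by (simp add: contract_def)
  }
qed

text \<open>The terms in which the frame is differentiated cancel since second derivatives of \<open>T\<close> are symmetric.\<close>

lemma local_ext_deriv_moving_frame:
  fixes T :: "real ^ 'd::finite \<Rightarrow> 'v::euclidean_space"
  assumes S: "open S" "x \<in> S" and "\<And>y. y \<in> S \<Longrightarrow> alternating k (b y)" "form_differentiable b x"
    and T: "\<And>v. (\<lambda>y. dderiv T y v) differentiable (at x)"
    and sym: "\<And>v w. dderiv (\<lambda>y. dderiv T y v) x w = dderiv (\<lambda>y. dderiv T y w) x v"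
  shows "local_ext_deriv (\<lambda>y vs. b y (map (dderiv T y) vs)) x vs =
    (\<Sum>i<length vs. (- 1) ^ i * dderiv (\<lambda>y. b y (map (dderiv T x) (take i vs @ drop (Suc i) vs))) x (vs ! i))"
  using assms(3,4)
proof (induction vs arbitrary: b k)
  case (Cons v vs)
  let ?X = "\<lambda>v y. dderiv T y v" and ?N = "map (dderiv T x)"
  let ?b = "\<lambda>y. contract (?X v y) (b y)"
  note fd = form_differentiable_head[OF S Cons.prems T[of v]]
  note alt = alternating_contract_gen[OF Cons.prems(1)]
  have lx: "alternating k (b x)" using Cons.prems(1) S by blast
  have "form_dderiv (\<lambda>y vs. b y (map (dderiv T y) vs)) x v vs
      = dderiv (\<lambda>y. b y (map (\<lambda>X. X y) (map ?X vs))) x v"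
    by (simp add: form_dderiv_def o_def)
  also have "\<dots> = dderiv (\<lambda>y. b y (map (\<lambda>X. X x) (map ?X vs))) x v
      + (\<Sum>j<length (map ?X vs). b x ((map (\<lambda>X. X x) (map ?X vs))[j := dderiv (map ?X vs ! j) x v]))"
    by (rule dderiv_moving_list(1)[OF S Cons.prems]) (use T in auto)
  also have "\<dots> = dderiv (\<lambda>y. b y (?N vs)) x v + (\<Sum>j<length vs. b x ((?N vs)[j := dderiv (?X (vs ! j)) x v]))"
    by (simp add: o_def)
  finally have "form_dderiv (\<lambda>y vs. b y (map (dderiv T y) vs)) x v vs
      = dderiv (\<lambda>y. b y (?N vs)) x v + (\<Sum>j<length vs. b x ((?N vs)[j := dderiv (?X (vs ! j)) x v]))" .
  moreover have "contract v (\<lambda>vs. b y (map (dderiv T y) vs)) = (\<lambda>vs. ?b y (map (dderiv T y) vs))" for y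
    by (simp add: contract_def)
  moreover have "local_ext_deriv (\<lambda>y vs. ?b y (map (dderiv T y) vs)) x vs
     = (\<Sum>i<length vs. (- 1) ^ i * dderiv (\<lambda>y. b y (dderiv T x v # ?N (take i vs @ drop (Suc i) vs))) x (vs ! i))
       + (\<Sum>j<length vs. b x ((?N vs)[j := dderiv (?X (vs ! j)) x v]))"
  proof -
    have "(- 1) ^ i * dderiv (\<lambda>y. ?b y (?N (take i vs @ drop (Suc i) vs))) x (vs ! i)
      = (- 1) ^ i * dderiv (\<lambda>y. b y (dderiv T x v # ?N (take i vs @ drop (Suc i) vs))) x (vs ! i)
        + b x ((?N vs)[i := dderiv (?X (vs ! i)) x v])" if i: "i < length vs" for i
    proof -
      let ?u = "dderiv (?X v) x (vs ! i)"
      \<comment> \<open>Moving the second derivative from the head to position \<open>i\<close>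
        costs exactly the sign that stands in front of it; by symmetry it is then the derivative of
        the frame vector at that position.\<close>
      have "b x (?u # ?N (take i vs @ drop (Suc i) vs)) = (- 1) ^ i * b x ((?N vs)[i := ?u])"
        using alternating_move[OF lx, of i "?N vs" ?u] i by (simp add: take_map drop_map)
      then have "(- 1) ^ i * b x (?u # ?N (take i vs @ drop (Suc i) vs)) = b x ((?N vs)[i := dderiv (?X (vs ! i)) x v])"
        using sym[of v "vs ! i"] by (simp flip: mult.assoc power_add)
      then show ?thesis
        using dderiv_head(1)[OF S Cons.prems T[of v], of "?N (take i vs @ drop (Suc i) vs)" "vs ! i"]
        by (simp add: contract_def distrib_left)
    qed
    moreover have "local_ext_deriv (\<lambda>y vs. ?b y (map (dderiv T y) vs)) x vs
      = (\<Sum>i<length vs. (- 1) ^ i * dderiv (\<lambda>y. ?b y (?N (take i vs @ drop (Suc i) vs))) x (vs ! i))"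
      by (rule Cons.IH[OF alt fd])
    ultimately show ?thesis by (simp add: sum.distrib)
  qed
  ultimately show ?case
    unfolding local_ext_deriv_Cons by (simp add: sum.lessThan_Suc_shift sum_negf del: sum.lessThan_Suc)
qed simp

text \<open>Naturality of the exterior derivative under maps with continuous second derivatives. The
  arguments \<open>dderiv T y\<close> of the pulled back form move with \<open>y\<close>, which is
  where \<open>local_ext_deriv_moving_frame\<close> enters.\<close>

lemma local_ext_deriv_pullback:
  fixes T :: "real ^ 'd::finite \<Rightarrow> real ^ 'd"
  assumes S: "open S" "x \<in> S" and T: "Ck_on (Suc (Suc 0)) S T"
    and U: "open U" "T ` S \<subseteq> U"
    and a: "\<And>z. z \<in> U \<Longrightarrow> alternating k (a z)" "form_differentiable a (T x)"
  shows "local_ext_deriv (\<lambda>y vs. a (T y) (map (dderiv T y) vs)) x vs = local_ext_deriv a (T x) (map (dderiv T x) vs)"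
    "form_differentiable (\<lambda>y vs. a (T y) (map (dderiv T y) vs)) x"
proof -
  have Td: "T differentiable (at x)" using T S by simp
  have alt: "alternating k (a (T y))" if "y \<in> S" for y using a(1) U that by blast
  have d: "(\<lambda>y. a (T y) ws) differentiable (at x)" "dderiv (\<lambda>y. a (T y) ws) x w = dderiv (\<lambda>z. a z ws) (T x) (dderiv T x w)" for ws w
    using a(2) Td differentiable_chain_at[OF Td, of "\<lambda>z. a z ws"] dderiv_compose[OF Td, of "\<lambda>z. a z ws"]
    by (auto simp: form_differentiable_def o_def)
  have fd: "form_differentiable (\<lambda>y. a (T y)) x" using d by (simp add: form_differentiable_def)
  have T2: "(\<lambda>y. dderiv T y v) differentiable (at x)" for v using T S by simp
  have "local_ext_deriv (\<lambda>y vs. a (T y) (map (dderiv T y) vs)) x vs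
     = (\<Sum>i<length vs. (- 1) ^ i * dderiv (\<lambda>y. a (T y) (map (dderiv T x) (take i vs @ drop (Suc i) vs))) x (vs ! i))"
    by (rule local_ext_deriv_moving_frame[OF S alt fd T2 second_derivative_symmetric[OF T S]])
  also have "\<dots> = local_ext_deriv a (T x) (map (dderiv T x) vs)"
    by (simp add: local_ext_deriv_def d(2) take_map drop_map)
  finally show "local_ext_deriv (\<lambda>y vs. a (T y) (map (dderiv T y) vs)) x vs = local_ext_deriv a (T x) (map (dderiv T x) vs)" .
  have "(\<lambda>y. a (T y) (map (\<lambda>X. X y) (map (\<lambda>v y. dderiv T y v) vs))) differentiable (at x)" for vs
    by (rule dderiv_moving_list(2)[OF S alt fd]) (use T2 in auto)
  then show "form_differentiable (\<lambda>y vs. a (T y) (map (dderiv T y) vs)) x"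
    by (simp add: form_differentiable_def o_def)
qed

section \<open>Charts\<close>

lemma is_chartD:
  assumes "is_chart c"
  shows "open (fst c)" "open (chart_image c)" "continuous_on (fst c) (snd c)"
    "continuous_on (chart_image c) (chart_inv c)"
    "p \<in> fst c \<Longrightarrow> chart_inv c (snd c p) = p" "p \<in> fst c \<Longrightarrow> snd c p \<in> chart_image c"
    "x \<in> chart_image c \<Longrightarrow> chart_inv c x \<in> fst c" "x \<in> chart_image c \<Longrightarrow> snd c (chart_inv c x) = x"
  using assms by (auto simp: is_chart_def homeomorphism_def)

definition overlap :: "('m, 'd) chart \<Rightarrow> ('m, 'd) chart \<Rightarrow> (real ^ 'd) set" where
  "overlap c c' = snd c ` (fst c \<inter> fst c')"

lemma overlap_iff:
  assumes "is_chart c" shows "x \<in> overlap c c' \<longleftrightarrow> x \<in> chart_image c \<and> chart_inv c x \<in> fst c'"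
proof
  assume "x \<in> overlap c c'" then show "x \<in> chart_image c \<and> chart_inv c x \<in> fst c'"
    using is_chartD[OF assms] by (auto simp: overlap_def)
next
  assume "x \<in> chart_image c \<and> chart_inv c x \<in> fst c'"
  then show "x \<in> overlap c c'" unfolding overlap_def
    by (intro image_eqI[of _ _ "chart_inv c x"]) (use is_chartD[OF assms] in auto)
qed

lemma open_overlap:
  fixes c :: "('m::topological_space, 'd::finite) chart"
  assumes "is_chart c" "open V" shows "open {x \<in> chart_image c. chart_inv c x \<in> V}"
proof -
  have "{x \<in> chart_image c. chart_inv c x \<in> V} = chart_image c \<inter> chart_inv c -` V" by auto
  then show ?thesis
    using continuous_open_preimage[OF is_chartD(4)[OF assms(1)] is_chartD(2)[OF assms(1)] assms(2)] by simp
qed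

lemma transition_eq: "transition c c' x = snd c' (chart_inv c x)"
  by (simp add: transition_def)

lemma Ck_smooth_on: "smooth_on S f \<Longrightarrow> Ck_on k S f"
  by (simp add: smooth_on_def)

locale atlas =
  fixes A :: "('m::{t2_space,second_countable_topology}, 'd::{finite,wellorder}) chart set"
  assumes atlas: "smooth_atlas A"
begin

lemma atlas_subset_maximal: "A \<subseteq> maximal_atlas A"
  using atlas by (auto simp: smooth_atlas_def maximal_atlas_def)

lemma is_chart: "c \<in> maximal_atlas A \<Longrightarrow> is_chart c"
  by (simp add: maximal_atlas_def)

lemma chart_at: "chart_at A p \<in> A" "p \<in> fst (chart_at A p)"
proof -
  have "p \<in> (\<Union>c\<in>A. fst c)" using atlas by (simp add: smooth_atlas_def)
  then have "\<exists>c. c \<in> A \<and> p \<in> fst c" by blast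
  then show "chart_at A p \<in> A" "p \<in> fst (chart_at A p)"
    unfolding chart_at_def by (metis (mono_tags, lifting) someI_ex)+
qed

lemma chart_at_maximal: "chart_at A p \<in> maximal_atlas A"
  using chart_at atlas_subset_maximal by blast

lemma open_overlap':
  assumes "c \<in> maximal_atlas A" "c' \<in> maximal_atlas A" shows "open (overlap c c')"
proof -
  have "overlap c c' = {x \<in> chart_image c. chart_inv c x \<in> fst c'}"
    using overlap_iff[OF is_chart[OF assms(1)]] by blast
  then show ?thesis
    using open_overlap[OF is_chart[OF assms(1)] is_chartD(1)[OF is_chart[OF assms(2)]]] by simp
qed

lemma smooth_transition:
  assumes "c \<in> maximal_atlas A" "c' \<in> A"
  shows "smooth_on (overlap c c') (transition c c')" "smooth_on (overlap c' c) (transition c' c)"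
  using assms by (auto simp: maximal_atlas_def smooth_compatible_def overlap_def Int_commute)

context
  fixes c x assumes c: "c \<in> maximal_atlas A" and x: "x \<in> chart_image c"
begin

private abbreviation "p \<equiv> chart_inv c x"
private abbreviation "cp \<equiv> chart_at A p"

lemma in_overlap: "x \<in> overlap c cp" "snd cp p \<in> overlap cp c"
  using overlap_iff[OF is_chart[OF c]] x chart_at is_chartD(7)[OF is_chart[OF c] x]
  by (auto simp: overlap_def)

lemma to_tangent_has_derivative: "(transition c cp has_derivative to_tangent A c x) (at x)"
proof -
  have "transition c cp differentiable (at x)"
    using Ck_smooth_on[OF smooth_transition(1)[OF c chart_at(1)], of "Suc 0"] in_overlap(1) by auto
  then show ?thesis unfolding to_tangent_def by (rule has_dderiv)
qed

lemma of_tangent_has_derivative: "(transition cp c has_derivative of_tangent A c x) (at (snd cp p))"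
proof -
  have "transition cp c differentiable (at (snd cp p))"
    using Ck_smooth_on[OF smooth_transition(2)[OF c chart_at(1)], of "Suc 0"] in_overlap(2) by auto
  then show ?thesis unfolding of_tangent_def Let_def by (rule has_dderiv)
qed

lemma linear_to_tangent: "linear (to_tangent A c x)"
  using to_tangent_has_derivative has_derivative_linear by blast

text \<open>The composite is the derivative of the transition from the preferred chart to
  \<open>c\<close> and back, which is the identity near the point.\<close>

lemma to_of_tangent: "to_tangent A c x (of_tangent A c x v) = v"
proof -
  have T: "transition cp c (snd cp p) = x"
    using is_chartD(5)[OF is_chart[OF chart_at_maximal] chart_at(2)] is_chartD(8)[OF is_chart[OF c] x] by (simp add: transition_eq)
  have "((\<lambda>y. transition c cp (transition cp c y)) has_derivative (\<lambda>v. to_tangent A c x (of_tangent A c x v))) (at (snd cp p))"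
    using has_derivative_compose[OF of_tangent_has_derivative, of "transition c cp" "to_tangent A c x"]
      to_tangent_has_derivative by (simp add: T)
  moreover have "transition c cp (transition cp c y) = y" if "y \<in> overlap cp c" for y
    using that overlap_iff[OF is_chart[OF chart_at_maximal]] is_chartD(5)[OF is_chart[OF c]]
      is_chartD(8)[OF is_chart[OF chart_at_maximal]]
    by (auto simp: transition_eq)
  ultimately have "((\<lambda>y. y) has_derivative (\<lambda>v. to_tangent A c x (of_tangent A c x v))) (at (snd cp p))"
    by (rule has_derivative_transform_within_open[OF _ open_overlap'[OF chart_at_maximal c] in_overlap(2)])
  then show ?thesis using has_derivative_unique[OF has_derivative_ident] by metis
qed

end

text \<open>The transition from the preferred chart to itself is the identity on its image, so its
  derivative is too.\<close>

lemma to_tangent_chart_at: "to_tangent A (chart_at A p) (snd (chart_at A p) p) v = v"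
proof -
  let ?c = "chart_at A p"
  note ch = is_chartD[OF is_chart[OF chart_at_maximal]]
  have p: "chart_inv ?c (snd ?c p) = p" using ch(5) chart_at(2) by blast
  have x: "snd ?c p \<in> chart_image ?c" using ch(6) chart_at(2) by blast
  have "(transition ?c ?c has_derivative to_tangent A ?c (snd ?c p)) (at (snd ?c p))"
    using to_tangent_has_derivative[OF chart_at_maximal x] by (simp add: p)
  moreover have "transition ?c ?c y = y" if "y \<in> chart_image ?c" for y
    using ch(8)[OF that] by (simp add: transition_eq)
  ultimately have "((\<lambda>y. y) has_derivative to_tangent A ?c (snd ?c p)) (at (snd ?c p))"
    by (rule has_derivative_transform_within_open[OF _ ch(2) x])
  then show ?thesis using has_derivative_unique[OF has_derivative_ident] by metis
qed

context
  fixes c c' x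
  assumes c: "c \<in> maximal_atlas A" and c': "c' \<in> maximal_atlas A" and x: "x \<in> overlap c c'"
begin

lemma overlap_facts:
  shows "x \<in> chart_image c" "chart_inv c x \<in> fst c'" "transition c c' x \<in> chart_image c'"
    "chart_inv c' (transition c c' x) = chart_inv c x" "transition c c' x \<in> overlap c' c"
    "transition c' c (transition c c' x) = x"
proof -
  show 1: "x \<in> chart_image c" "chart_inv c x \<in> fst c'" using x overlap_iff[OF is_chart[OF c]] by auto
  show 2: "transition c c' x \<in> chart_image c'" "chart_inv c' (transition c c' x) = chart_inv c x"
    using is_chartD(5,6)[OF is_chart[OF c']] 1 by (auto simp: transition_eq)
  show "transition c c' x \<in> overlap c' c"
    using 2 overlap_iff[OF is_chart[OF c']] is_chartD(7)[OF is_chart[OF c]] 1 by auto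
  show "transition c' c (transition c c' x) = x"
    using 2 is_chartD(8)[OF is_chart[OF c]] 1 by (simp add: transition_eq)
qed

text \<open>Charts of the maximal atlas are only required to be compatible with charts of
  \<open>A\<close>. The transition is therefore factored through the preferred chart at the point,
  and its two halves have the derivatives \<open>to_tangent\<close> and
  \<open>of_tangent\<close>.\<close>

lemma transition_has_derivative:
  "(transition c c' has_derivative (\<lambda>v. of_tangent A c' (transition c c' x) (to_tangent A c x v))) (at x)"
proof -
  let ?p = "chart_inv c x" let ?cp = "chart_at A ?p"
  note f = overlap_facts
  have d2: "(transition ?cp c' has_derivative of_tangent A c' (transition c c' x)) (at (transition c ?cp x))"
    using of_tangent_has_derivative[OF c' f(3), unfolded f(4)] by (simp add: transition_eq[of c ?cp x])
  have "((\<lambda>y. transition ?cp c' (transition c ?cp y)) has_derivative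
    (\<lambda>v. of_tangent A c' (transition c c' x) (to_tangent A c x v))) (at x)"
    using has_derivative_compose[OF to_tangent_has_derivative[OF c f(1)] d2] .
  moreover have "transition ?cp c' (transition c ?cp y) = transition c c' y" if "y \<in> overlap c ?cp" for y
    using that overlap_iff[OF is_chart[OF c]] is_chartD(5)[OF is_chart[OF chart_at_maximal]]
    by (auto simp: transition_eq)
  ultimately show ?thesis
    by (rule has_derivative_transform_within_open[OF _ open_overlap'[OF c chart_at_maximal] in_overlap(1)[OF c f(1)]])
qed

lemma dderiv_transition: "dderiv (transition c c') x v = of_tangent A c' (transition c c' x) (to_tangent A c x v)"
  by (rule dderiv_eq[OF transition_has_derivative])

lemma to_tangent_transition: "to_tangent A c' (transition c c' x) (dderiv (transition c c') x v) = to_tangent A c x v"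
  unfolding dderiv_transition using to_of_tangent[OF c' overlap_facts(3)] by (simp add: overlap_facts)

lemma local_form_transition:
  "local_form A c \<alpha> x vs = local_form A c' \<alpha> (transition c c' x) (map (dderiv (transition c c') x) vs)"
  by (simp add: local_form_def to_tangent_transition overlap_facts o_def)

end

end

section \<open>Transfer of regularity between charts\<close>

text \<open>Weaker than \<open>alternating\<close> and free of a degree, so that regularity can be
  transferred for the symmetric \<open>metric_tensor\<close> as well.\<close>

definition multilinear :: "'v::real_vector cform \<Rightarrow> bool" where
  "multilinear a \<longleftrightarrow> (\<forall>us vs. linear (\<lambda>v. a (us @ v # vs)))"

lemma multilinear_contract:
  assumes "multilinear a" shows "multilinear (contract w a)"
  unfolding multilinear_def
proof (intro allI)
  show "linear (\<lambda>v. contract w a (us @ v # vs))" for us vs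
    using assms[unfolded multilinear_def, rule_format, of "w # us" vs] by (simp add: contract_def)
qed

lemma multilinear_map:
  assumes "multilinear a" "linear f" shows "multilinear (\<lambda>vs. a (map f vs))"
  unfolding multilinear_def
proof (intro allI)
  fix us vs
  have "linear (\<lambda>v. a (map f us @ v # map f vs))" using assms(1) by (simp add: multilinear_def)
  from linear_compose[OF assms(2) this] show "linear (\<lambda>v. a (map f (us @ v # vs)))" by (simp add: o_def)
qed

lemma alternating_multilinear: assumes "alternating k a" shows "multilinear a"
  unfolding multilinear_def
proof (intro allI)
  fix us vs
  show "linear (\<lambda>v. a (us @ v # vs))"
  proof (cases "length us + Suc (length vs) = k")
    case True
    then show ?thesis using alternating_linear[OF assms, of "us @ undefined # vs" "length us"] by simp
  next
    case False
    then have "(\<lambda>v. a (us @ v # vs)) = (\<lambda>v. 0)" using alternating_length[OF assms] by auto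
    then show ?thesis by (simp add: linear_zero)
  qed
qed

lemma Ck_on_moving_list:
  fixes b :: "'a::real_normed_vector \<Rightarrow> 'v::euclidean_space cform"
  assumes S: "open S" and "\<And>y. y \<in> S \<Longrightarrow> multilinear (b y)" "\<And>ws. Ck_on k S (\<lambda>y. b y ws)"
    and "\<And>X. X \<in> set Xs \<Longrightarrow> Ck_on k S X"
  shows "Ck_on k S (\<lambda>y. b y (map (\<lambda>X. X y) Xs))"
  using assms(2-4)
proof (induction Xs arbitrary: b)
  case (Cons X Xs)
  have C: "Ck_on k S (\<lambda>y. \<Sum>e\<in>Basis. (X y \<bullet> e) *\<^sub>R contract e (b y) (map (\<lambda>X. X y) Xs))"
  proof (intro Ck_on_sum Ck_on_scaleR S)
    show "Ck_on k S (\<lambda>y. X y \<bullet> e)" for e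
      using Cons.prems(3) by (intro Ck_on_bounded_linear[OF S bounded_linear_inner_left]) auto
    show "Ck_on k S (\<lambda>y. contract e (b y) (map (\<lambda>X. X y) Xs))" for e
    proof (rule Cons.IH)
      show "multilinear (contract e (b y))" if "y \<in> S" for y
        by (rule multilinear_contract[OF Cons.prems(1)[OF that]])
    qed (use Cons.prems(2,3) in \<open>auto simp: contract_def\<close>)
  qed
  have "(\<Sum>e\<in>Basis. (X y \<bullet> e) *\<^sub>R contract e (b y) (map (\<lambda>X. X y) Xs)) = b y (map (\<lambda>X. X y) (X # Xs))"
    if "y \<in> S" for y
  proof -
    let ?ws = "map (\<lambda>X. X y) Xs"
    have lin: "linear (\<lambda>v. b y (v # ?ws))"
      using Cons.prems(1)[OF that, unfolded multilinear_def, rule_format, of "[]" ?ws] by simp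
    have "b y ((\<Sum>e\<in>Basis. (X y \<bullet> e) *\<^sub>R e) # ?ws) = (\<Sum>e\<in>Basis. (X y \<bullet> e) *\<^sub>R b y (e # ?ws))"
      using linear_sum[OF lin, of "\<lambda>e. (X y \<bullet> e) *\<^sub>R e" Basis] linear_cmul[OF lin] by simp
    then show ?thesis by (simp add: euclidean_representation contract_def)
  qed
  then show ?case by (rule Ck_on_cong[OF S _ C])
qed simp

context atlas
begin

lemma local_form_multilinear:
  "c \<in> maximal_atlas A \<Longrightarrow> x \<in> chart_image c \<Longrightarrow> multilinear (\<alpha> (chart_inv c x)) \<Longrightarrow> multilinear (local_form A c \<alpha> x)"
  using multilinear_map[OF _ linear_to_tangent, of "\<alpha> (chart_inv c x)" c x] by (simp add: local_form_def[abs_def])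

lemma local_form_alternating:
  "c \<in> maximal_atlas A \<Longrightarrow> x \<in> chart_image c \<Longrightarrow> alternating k (\<alpha> (chart_inv c x)) \<Longrightarrow> alternating k (local_form A c \<alpha> x)"
  using alternating_map[OF _ linear_to_tangent, of k "\<alpha> (chart_inv c x)" c x] by (simp add: local_form_def[abs_def])

text \<open>The hypothesis concerns charts of \<open>A\<close> only. Near a point the local form in
  \<open>c\<close> is the pullback of the one in the preferred chart at this point, by a smooth
  transition, and being of class \<open>Ck_on k\<close> is a local property.\<close>

lemma Ck_on_local_form:
  assumes m: "\<And>p. multilinear (\<alpha> p)"
    and s: "\<And>c vs. c \<in> A \<Longrightarrow> Ck_on k (chart_image c) (\<lambda>x. local_form A c \<alpha> x vs)"
    and c: "c \<in> maximal_atlas A"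
  shows "Ck_on k (chart_image c) (\<lambda>x. local_form A c \<alpha> x vs)"
proof (rule Ck_on_local)
  fix x assume x: "x \<in> chart_image c"
  let ?c' = "chart_at A (chart_inv c x)" let ?U = "overlap c ?c'" let ?T = "transition c ?c'"
  note c' = chart_at(1) chart_at_maximal
  have op: "open ?U" by (rule open_overlap'[OF c c'(2)])
  have T: "Ck_on l ?U ?T" for l by (rule Ck_smooth_on[OF smooth_transition(1)[OF c c'(1)]])
  have TU: "?T ` ?U \<subseteq> chart_image ?c'" using overlap_facts(3)[OF c c'(2)] by blast
  have "Ck_on k ?U (\<lambda>y. local_form A ?c' \<alpha> (?T y) (map (\<lambda>X. X y) (map (\<lambda>v y. dderiv ?T y v) vs)))"
  proof (rule Ck_on_moving_list[OF op])
    show "multilinear (local_form A ?c' \<alpha> (?T y))" if "y \<in> ?U" for y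
      using TU that by (intro local_form_multilinear c' m) auto
    show "Ck_on k ?U (\<lambda>y. local_form A ?c' \<alpha> (?T y) ws)" for ws
      by (rule Ck_on_compose[OF op is_chartD(2)[OF is_chart[OF c'(2)]] s[OF c'(1)] T TU])
    show "Ck_on k ?U X" if "X \<in> set (map (\<lambda>v y. dderiv ?T y v) vs)" for X
      using that T[of "Suc k"] by auto
  qed
  then have "Ck_on k ?U (\<lambda>x. local_form A c \<alpha> x vs)"
    by (rule Ck_on_cong[OF op, rotated]) (simp add: local_form_transition[OF c c'(2)] o_def)
  then show "\<exists>U. open U \<and> x \<in> U \<and> Ck_on k U (\<lambda>x. local_form A c \<alpha> x vs)"
    using op in_overlap(1)[OF c x] by blast
qed

lemma smooth_form_maximal:
  assumes "smooth_form A k \<alpha>" "c \<in> maximal_atlas A"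
  shows "Ck_on l (chart_image c) (\<lambda>x. local_form A c \<alpha> x vs)"
proof (rule Ck_on_local_form[OF _ _ assms(2)])
  show "multilinear (\<alpha> p)" for p
    using assms(1) alternating_multilinear unfolding smooth_form_def by blast
qed (use assms(1) in \<open>simp add: smooth_form_def smooth_on_def\<close>)

lemma smooth_form_alternating: "smooth_form A k \<alpha> \<Longrightarrow> alternating k (\<alpha> p)"
  by (simp add: smooth_form_def)

lemma form_differentiable_local_form:
  assumes "smooth_form A k \<alpha>" "c \<in> maximal_atlas A" "x \<in> chart_image c"
  shows "form_differentiable (local_form A c \<alpha>) x"
  unfolding form_differentiable_def using smooth_form_maximal[OF assms(1,2), of "Suc 0"] assms(3) by simp

lemma local_form_chart_at: "local_form A (chart_at A p) \<alpha> (snd (chart_at A p) p) = \<alpha> p"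
proof -
  have "to_tangent A (chart_at A p) (snd (chart_at A p) p) = id" using to_tangent_chart_at[of p] by auto
  then show ?thesis
    using is_chartD(5)[OF is_chart[OF chart_at_maximal] chart_at(2)] by (simp add: local_form_def[abs_def])
qed

lemma chart_at_image: "snd (chart_at A p) p \<in> chart_image (chart_at A p)"
  using is_chartD(6)[OF is_chart[OF chart_at_maximal] chart_at(2)] .

lemma alternating_ext_deriv:
  assumes "smooth_form A k \<alpha>" shows "alternating (Suc k) (ext_deriv A \<alpha> p)"
  unfolding ext_deriv_def Let_def
  by (rule alternating_local_ext_deriv[OF is_chartD(2)[OF is_chart[OF chart_at_maximal]] chart_at_image
        local_form_alternating[OF chart_at_maximal] form_differentiable_local_form[OF assms chart_at_maximal chart_at_image]])
    (use assms in \<open>auto simp: smooth_form_def\<close>)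

text \<open>\<open>ext_deriv\<close> is evaluated in another chart at each point. Naturality under
  the transition to that chart shows that the coordinate formula in the single chart
  \<open>c\<close> gives the same values throughout its image.\<close>

lemma local_form_ext_deriv:
  assumes \<alpha>: "smooth_form A k \<alpha>" and c: "c \<in> maximal_atlas A" and x: "x \<in> chart_image c"
  shows "local_form A c (ext_deriv A \<alpha>) x vs = local_ext_deriv (local_form A c \<alpha>) x vs"
proof -
  let ?p = "chart_inv c x" let ?c' = "chart_at A ?p" let ?T = "transition c ?c'"
  note c' = chart_at(1)[of ?p] chart_at_maximal[of ?p]
  have op: "open (overlap c ?c')" by (rule open_overlap'[OF c c'(2)])
  have fd: "form_differentiable (local_form A ?c' \<alpha>) (?T x)"
    using form_differentiable_local_form[OF \<alpha> c'(2) chart_at_image] by (simp add: transition_eq)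
  note pb = local_ext_deriv_pullback[OF op in_overlap(1)[OF c x] Ck_smooth_on[OF smooth_transition(1)[OF c c'(1)]]
      is_chartD(2)[OF is_chart[OF c'(2)]] _ local_form_alternating[OF c'(2) _ smooth_form_alternating[OF \<alpha>]] fd]
  have TU: "?T ` overlap c ?c' \<subseteq> chart_image ?c'" using overlap_facts(3)[OF c c'(2)] by blast
  have "local_form A c (ext_deriv A \<alpha>) x vs = local_ext_deriv (local_form A ?c' \<alpha>) (?T x) (map (dderiv ?T x) vs)"
    by (simp add: local_form_def ext_deriv_def Let_def to_tangent_def transition_eq)
  also have "\<dots> = local_ext_deriv (\<lambda>y vs. local_form A ?c' \<alpha> (?T y) (map (dderiv ?T y) vs)) x vs"
    by (rule pb(1)[OF TU, symmetric])
  also have "\<dots> = local_ext_deriv (local_form A c \<alpha>) x vs"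
    by (rule local_ext_deriv_cong(1)[OF op in_overlap(1)[OF c x] _ pb(2)[OF TU]])
      (auto simp: local_form_transition[OF c c'(2)] fun_eq_iff)
  finally show ?thesis .
qed

lemma local_form_wedge: "local_form A c (form_wedge \<alpha> \<beta>) x = wedge (local_form A c \<alpha> x) (local_form A c \<beta> x)"
  by (simp add: local_form_def[abs_def] form_wedge_def wedge_map fun_eq_iff)

lemma smooth_form_wedge:
  assumes "smooth_form A k \<alpha>" "smooth_form A l \<beta>" shows "smooth_form A (k + l) (form_wedge \<alpha> \<beta>)"
  unfolding smooth_form_def
proof (intro conjI allI ballI)
  show "alternating (k + l) (form_wedge \<alpha> \<beta> p)" for p
    unfolding form_wedge_def using assms by (intro alternating_wedge smooth_form_alternating)
next
  fix c vs assume "c \<in> A"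
  then have c: "c \<in> maximal_atlas A" using atlas_subset_maximal by blast
  have op: "open (chart_image c)" by (rule is_chartD(2)[OF is_chart[OF c]])
  show "smooth_on (chart_image c) (\<lambda>x. local_form A c (form_wedge \<alpha> \<beta>) x vs)"
    unfolding smooth_on_def local_form_wedge wedge_def
    by (intro allI Ck_on_sum Ck_on_mult op Ck_on_const smooth_form_maximal[OF assms(1) c] smooth_form_maximal[OF assms(2) c])
qed

lemma ext_deriv_wedge:
  assumes "smooth_form A k \<alpha>" "smooth_form A l \<beta>"
  shows "ext_deriv A (form_wedge \<alpha> \<beta>) p vs =
    wedge (ext_deriv A \<alpha> p) (\<beta> p) vs + wedge (twist (\<alpha> p)) (ext_deriv A \<beta> p) vs"
  unfolding ext_deriv_def Let_def local_form_wedge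
  using local_ext_deriv_wedge[OF form_differentiable_local_form[OF assms(1) chart_at_maximal chart_at_image]
      form_differentiable_local_form[OF assms(2) chart_at_maximal chart_at_image], of p vs]
  by (simp add: local_form_chart_at)

lemma local_form_one: "local_form A c (\<lambda>p. wedge_one) x = wedge_one"
  by (simp add: local_form_def[abs_def] wedge_one_def)

lemma smooth_form_power:
  assumes "smooth_form A k \<alpha>" shows "smooth_form A (m * k) (form_power \<alpha> m)"
proof (induction m)
  case 0
  show ?case by (simp add: form_power_def smooth_form_def local_form_one smooth_on_def)
next
  case (Suc m)
  have "form_power \<alpha> (Suc m) = form_wedge \<alpha> (form_power \<alpha> m)"
    by (simp add: form_power_def form_wedge_def wedge_power_Suc)
  then show ?case using smooth_form_wedge[OF assms Suc] by simp
qed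

end

section \<open>Bump functions\<close>

text \<open>The member \<open>k = 0\<close> is the standard smooth function that vanishes on the
  negative half line. The powers of \<open>inverse t\<close> are carried along because the
  derivative of \<open>flat k\<close> is a combination of \<open>flat (k + 2)\<close> and
  \<open>flat (k + 1)\<close>.\<close>

definition flat :: "nat \<Rightarrow> real \<Rightarrow> real" where
  "flat k t = (if 0 < t then exp (- inverse t) * inverse t ^ k else 0)"

lemma flat_nonneg: "0 \<le> flat k t" and flat_pos: "0 < t \<Longrightarrow> 0 < flat k t" and flat_neg: "t \<le> 0 \<Longrightarrow> flat k t = 0"
  by (simp_all add: flat_def)

lemma flat_has_derivative: "(flat k has_real_derivative (flat (k + 2) t - real k * flat (k + 1) t)) (at t)"
proof -
  consider "t > 0" | "t < 0" | "t = 0" by linarith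
  then show ?thesis
  proof cases
    case 1
    have i: "(inverse has_real_derivative - (inverse t ^ Suc (Suc 0))) (at t)"
      using DERIV_inverse[of t] 1 by simp
    have e: "((\<lambda>t. exp (- inverse t)) has_real_derivative exp (- inverse t) * inverse t ^ 2) (at t)"
      using DERIV_chain2[OF DERIV_exp DERIV_minus[OF i]] by (simp add: numeral_2_eq_2)
    have p: "((\<lambda>t. inverse t ^ k) has_real_derivative - (real k * inverse t ^ (k + 1))) (at t)"
      using DERIV_power[OF i, of k] by (cases k) (simp_all add: algebra_simps)
    have "((\<lambda>t. exp (- inverse t) * inverse t ^ k) has_real_derivative
       exp (- inverse t) * inverse t ^ (k + 2) - real k * (exp (- inverse t) * inverse t ^ (k + 1))) (at t)"
      using DERIV_mult[OF e p] by (simp add: power2_eq_square algebra_simps)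
    then have "((\<lambda>t. exp (- inverse t) * inverse t ^ k) has_real_derivative (flat (k + 2) t - real k * flat (k + 1) t)) (at t)"
      using 1 by (simp add: flat_def)
    then show ?thesis
      by (rule has_field_derivative_transform_within_open[of _ _ _ "{0<..}"]) (use 1 in \<open>auto simp: flat_def\<close>)
  next
    case 2
    have "((\<lambda>t. 0) has_real_derivative (flat (k + 2) t - real k * flat (k + 1) t)) (at t)"
      using 2 by (simp add: flat_def)
    then show ?thesis
      by (rule has_field_derivative_transform_within_open[of _ _ _ "{..<0}"]) (use 2 in \<open>auto simp: flat_def\<close>)
  next
    case 3
    have "((\<lambda>h. (flat k (0 + h) - flat k 0) / h) \<longlongrightarrow> 0) (at 0)"
    proof (rule filterlim_split_at)
      have "eventually (\<lambda>h. 0 = (flat k (0 + h) - flat k 0) / h) (at_left (0::real))"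
        by (auto simp: eventually_at_filter flat_def)
      then show "((\<lambda>h. (flat k (0 + h) - flat k 0) / h) \<longlongrightarrow> 0) (at_left 0)"
        by (rule Lim_transform_eventually[OF tendsto_const])
      \<comment> \<open>With \<open>u = inverse h\<close> the quotient is
        \<open>u ^ Suc k / exp u\<close>, and \<open>u\<close> tends to infinity as \<open>h\<close>
        decreases to zero.\<close>
      have "((\<lambda>h. inverse h ^ Suc k / exp (inverse h)) \<longlongrightarrow> 0) (at_right (0::real))"
        using filterlim_compose[OF tendsto_power_div_exp_0[of "Suc k"] filterlim_inverse_at_top_right] .
      moreover have "eventually (\<lambda>h. inverse h ^ Suc k / exp (inverse h) = (flat k (0 + h) - flat k 0) / h) (at_right (0::real))"
        by (auto simp: eventually_at_filter flat_def exp_minus divide_inverse)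
      ultimately show "((\<lambda>h. (flat k (0 + h) - flat k 0) / h) \<longlongrightarrow> 0) (at_right 0)"
        by (rule Lim_transform_eventually)
    qed
    then show ?thesis using 3 by (simp add: DERIV_def flat_def)
  qed
qed

lemma Ck_on_flat: "Ck_on m UNIV (flat k)"
proof (induction m arbitrary: k)
  case 0
  show ?case using DERIV_isCont[OF flat_has_derivative] by (simp add: continuous_at_imp_continuous_on)
next
  case (Suc m)
  show ?case
  proof (rule Ck_on_SucI[where f'="\<lambda>t v. v * (flat (k + 2) t + (- real k) * flat (k + 1) t)"])
    show "(flat k has_derivative (\<lambda>v. v * (flat (k + 2) t + (- real k) * flat (k + 1) t))) (at t)" for t
    proof -
      have "(*) (flat (k + 2) t - real k * flat (k + 1) t) = (\<lambda>v. v * (flat (k + 2) t + (- real k) * flat (k + 1) t))"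
        by (rule ext) (simp add: algebra_simps)
      then show ?thesis using flat_has_derivative[of k t] unfolding has_field_derivative_def by (simp only:)
    qed
    show "Ck_on m UNIV (\<lambda>t. v * (flat (k + 2) t + (- real k) * flat (k + 1) t))" for v
      by (intro Ck_on_mult Ck_on_add Ck_on_const Suc open_UNIV)
  qed simp
qed

text \<open>Positive precisely on the open ball of radius \<open>\<bar>r\<bar>\<close> around
  \<open>a\<close>. The squared distance is written as an inner product because this is smooth at
  \<open>a\<close> too.\<close>

definition bump :: "'a::euclidean_space \<Rightarrow> real \<Rightarrow> 'a \<Rightarrow> real" where
  "bump a r y = flat 0 (r\<^sup>2 - (y - a) \<bullet> (y - a))"

lemma bump_nonneg: "0 \<le> bump a r y"
  by (simp add: bump_def flat_nonneg)

lemma bump_outside: "0 \<le> r \<Longrightarrow> y \<notin> cball a r \<Longrightarrow> bump a r y = 0"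
  unfolding bump_def
  by (rule flat_neg) (simp add: dist_norm norm_minus_commute power2_norm_eq_inner[symmetric] power_mono less_imp_le)

lemma bump_center: "0 < r \<Longrightarrow> 0 < bump a r a"
  by (simp add: bump_def flat_pos)

lemma Ck_on_bump: "open S \<Longrightarrow> Ck_on k S (bump a r)"
proof -
  assume S: "open S"
  have id: "Ck_on k S (\<lambda>y. y + - a)"
    by (intro Ck_on_add S Ck_on_const Ck_on_linear[OF S bounded_linear_ident])
  have "Ck_on k S (\<lambda>y. r\<^sup>2 + (- 1) * ((y + - a) \<bullet> (y + - a)))"
    by (intro Ck_on_add Ck_on_mult Ck_on_const S Ck_on_bilinear[OF S bounded_bilinear_inner] id)
  then have "Ck_on k S (\<lambda>y. flat 0 (r\<^sup>2 + (- 1) * ((y + - a) \<bullet> (y + - a))))"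
    by (rule Ck_on_compose[OF S open_UNIV Ck_on_flat]) simp
  then show ?thesis by (simp add: bump_def[abs_def])
qed

section \<open>Integrals of compactly supported functions\<close>

lemma absolutely_integrable_compact_support:
  fixes f :: "'a::euclidean_space \<Rightarrow> 'b::euclidean_space"
  assumes "continuous_on S f" "compact K" "K \<subseteq> S" "\<And>x. x \<in> S \<Longrightarrow> x \<notin> K \<Longrightarrow> f x = 0"
  shows "f absolutely_integrable_on S"
proof -
  have "(\<lambda>x. indicator S x *\<^sub>R f x) = (\<lambda>x. indicator K x *\<^sub>R f x)"
    using assms(3,4) by (auto simp: indicator_def fun_eq_iff)
  moreover have "integrable lborel (\<lambda>x. indicator K x *\<^sub>R f x)"
    using borel_integrable_compact[OF assms(2) continuous_on_subset[OF assms(1,3)]] .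
  ultimately show ?thesis unfolding set_integrable_def
    by (simp add: integrable_completion borel_measurable_integrable)
qed

lemma integral_lborel_translate:
  fixes F :: "'a::euclidean_space \<Rightarrow> 'b::euclidean_space"
  assumes "F \<in> borel_measurable borel"
  shows "integral\<^sup>L lborel (\<lambda>x. F (a + x)) = integral\<^sup>L lborel F"
    "integrable lborel F \<Longrightarrow> integrable lborel (\<lambda>x. F (a + x))"
proof -
  have m: "(+) a \<in> measurable lborel borel" by simp
  show "integral\<^sup>L lborel (\<lambda>x. F (a + x)) = integral\<^sup>L lborel F"
    using integral_distr[OF m assms] by (simp add: lborel_distr_plus)
  show "integrable lborel F \<Longrightarrow> integrable lborel (\<lambda>x. F (a + x))"
    using integrable_distr_eq[OF m assms] by (simp add: lborel_distr_plus)
qed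

text \<open>By translation invariance all difference quotients have integral zero.\<close>

lemma has_integral_dderiv_UNIV:
  fixes F :: "'a::euclidean_space \<Rightarrow> 'b::euclidean_space"
  assumes F: "Ck_on (Suc 0) UNIV F" and K: "compact K" "\<And>x. x \<notin> K \<Longrightarrow> F x = 0"
  shows "((\<lambda>x. dderiv F x v) has_integral 0) UNIV"
proof -
  let ?f = "\<lambda>x. dderiv F x v"
  have d: "F differentiable (at x)" and cf: "continuous_on UNIV ?f" for x using F by auto
  have cF: "continuous_on UNIV F" using Ck_on_continuous[OF F] .
  have f0: "?f x = 0" if "x \<notin> K" for x
    using dderiv_eq_0[of "- K" x F v] K that compact_imp_closed[OF K(1)] by auto
  have int: "integrable lborel G" if "continuous_on UNIV G" "\<And>x. x \<notin> K \<Longrightarrow> G x = 0" for G :: "'a \<Rightarrow> 'b"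
  proof -
    have "G = (\<lambda>x. indicator K x *\<^sub>R G x)" using that(2) by (auto simp: indicator_def fun_eq_iff)
    then show ?thesis using borel_integrable_compact[OF K(1) continuous_on_subset[OF that(1)]] by simp
  qed
  have mF: "F \<in> borel_measurable borel" and mf: "?f \<in> borel_measurable borel"
    using cF cf by (auto intro: borel_measurable_continuous_onI)
  have "bounded (?f ` K)"
    using compact_continuous_image[OF continuous_on_subset[OF cf] K(1)] compact_imp_bounded by blast
  then obtain B where B: "B > 0" "\<And>x. x \<in> K \<Longrightarrow> norm (?f x) \<le> B" unfolding bounded_pos by auto
  have fB: "norm (?f x) \<le> B" for x using B f0[of x] by (cases "x \<in> K") auto
  obtain R where "\<forall>x\<in>K. norm x \<le> R" using compact_imp_bounded[OF K(1)] unfolding bounded_iff by blast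
  then have R: "K \<subseteq> cball 0 R" by auto
  \<comment> \<open>The dominating function for the difference quotients: steps have length at most
    \<open>norm v\<close>, so the quotients vanish outside the enlarged ball, and inside they are
    bounded by the derivative.\<close>
  let ?w = "\<lambda>x::'a. indicator (cball 0 (R + norm v)) x *\<^sub>R B"
  define t where "t m = inverse (real (Suc m))" for m
  have t: "t m > 0" "t m \<le> 1" for m by (simp_all add: t_def inverse_le_1_iff)
  define s where "s m x = (F (t m *\<^sub>R v + x) - F x) /\<^sub>R t m" for m x
  have sB: "norm (s m x) \<le> ?w x" for m x
  proof (cases "x \<in> cball 0 (R + norm v)")
    case True
    have deriv: "((\<lambda>r. F (r *\<^sub>R v + x)) has_derivative (\<lambda>k. k *\<^sub>R ?f (r *\<^sub>R v + x))) (at r within {0..t m})" for r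
    proof -
      have "((\<lambda>r. r *\<^sub>R v + x) has_derivative (\<lambda>k. k *\<^sub>R v)) (at r within {0..t m})"
        by (auto intro!: derivative_eq_intros)
      from has_derivative_compose[OF this has_dderiv[OF d]]
      show ?thesis using linear_cmul[OF linear_dderiv[OF d]] by simp
    qed
    have "norm (F (t m *\<^sub>R v + x) - F (0 *\<^sub>R v + x)) \<le> B * norm (t m - 0)"
    proof (rule differentiable_bound[OF _ deriv])
      show "onorm (\<lambda>k. k *\<^sub>R ?f (r *\<^sub>R v + x)) \<le> B" for r
        using mult_right_mono[OF fB[of "r *\<^sub>R v + x"] abs_ge_zero] by (intro onorm_le) (simp add: mult.commute)
    qed (use t[of m] in auto)
    then have "norm (s m x) \<le> inverse (t m) * (B * t m)"
      unfolding s_def norm_scaleR using t[of m] by (intro mult_mono) auto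
    also have "\<dots> = B" using t(1)[of m] by simp
    finally show ?thesis using True by simp
  next
    case False
    then have x: "norm x > R + norm v" by simp
    have "norm (t m *\<^sub>R v) \<le> norm v" using t[of m] by (simp add: mult_left_le_one_le)
    then have "norm (t m *\<^sub>R v + x) > R" using x norm_diff_ineq[of x "t m *\<^sub>R v"] by (simp add: add.commute)
    then have "t m *\<^sub>R v + x \<notin> K" "x \<notin> K"
      using subsetD[OF R, of "t m *\<^sub>R v + x"] subsetD[OF R, of x] x norm_ge_zero[of v] by auto
    then show ?thesis using K(2) False by (simp add: s_def)
  qed
  have lim: "(\<lambda>m. s m x) \<longlonglongrightarrow> ?f x" for x
  proof -
    have "((\<lambda>r. r *\<^sub>R v + x) has_derivative (\<lambda>k. k *\<^sub>R v)) (at 0)"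
      by (auto intro!: derivative_eq_intros)
    from has_derivative_compose[OF this, of F "frechet_derivative F (at x)"] has_dderiv[OF d[of x]]
    have "((\<lambda>r. F (r *\<^sub>R v + x)) has_derivative (\<lambda>k. k *\<^sub>R ?f x)) (at 0)"
      using linear_cmul[OF linear_dderiv[OF d]] by simp
    then have "((\<lambda>r. norm (F (r *\<^sub>R v + x) - F x - r *\<^sub>R ?f x) / norm r) \<longlongrightarrow> 0) (at 0)"
      by (simp add: has_derivative_at)
    moreover have "eventually (\<lambda>r. norm (F (r *\<^sub>R v + x) - F x - r *\<^sub>R ?f x) / norm r
        = norm ((F (r *\<^sub>R v + x) - F x) /\<^sub>R r - ?f x)) (at 0)"
      unfolding eventually_at_filter
    proof (intro always_eventually allI impI)
      fix r :: real assume "r \<noteq> 0"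
      then have "(F (r *\<^sub>R v + x) - F x) /\<^sub>R r - ?f x = (F (r *\<^sub>R v + x) - F x - r *\<^sub>R ?f x) /\<^sub>R r"
        by (simp add: scaleR_diff_right)
      then show "norm (F (r *\<^sub>R v + x) - F x - r *\<^sub>R ?f x) / norm r
        = norm ((F (r *\<^sub>R v + x) - F x) /\<^sub>R r - ?f x)" by (simp add: divide_inverse_commute)
    qed
    ultimately have "((\<lambda>r. norm ((F (r *\<^sub>R v + x) - F x) /\<^sub>R r - ?f x)) \<longlongrightarrow> 0) (at 0)"
      by (rule Lim_transform_eventually)
    then have l: "((\<lambda>r. (F (r *\<^sub>R v + x) - F x) /\<^sub>R r) \<longlongrightarrow> ?f x) (at 0)"
      using Lim_null tendsto_norm_zero_iff by blast
    have "filterlim t (at 0) sequentially"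
      unfolding filterlim_at t_def using LIMSEQ_inverse_real_of_nat by auto
    from filterlim_compose[OF l this] show ?thesis by (simp add: s_def)
  qed
  have sm: "s m \<in> borel_measurable lborel" for m
  proof -
    have "continuous_on UNIV (s m)"
      unfolding s_def by (intro continuous_intros continuous_on_compose2[OF cF]) auto
    then show ?thesis using borel_measurable_continuous_onI by simp
  qed
  have "(\<lambda>m. integral\<^sup>L lborel (s m)) \<longlonglongrightarrow> integral\<^sup>L lborel ?f"
  proof (rule integral_dominated_convergence[where w="?w"])
    show "integrable lborel ?w" by (rule borel_integrable_compact) auto
  qed (use sm mf lim sB in auto)
  moreover have "integral\<^sup>L lborel (s m) = 0" for m
    unfolding s_def
    using int[OF cF K(2)] integral_lborel_translate[OF mF, of "t m *\<^sub>R v"] by simp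
  ultimately have "integral\<^sup>L lborel ?f = 0" by (simp add: LIMSEQ_const_iff)
  then show ?thesis using has_integral_integral_lborel[OF int[OF cf f0]] by simp
qed

text \<open>Extension by zero keeps the function continuously differentiable, since \<open>S\<close>
  and the complement of \<open>K\<close> are open and cover the space.\<close>

lemma has_integral_dderiv:
  fixes f :: "'a::euclidean_space \<Rightarrow> 'b::euclidean_space"
  assumes S: "open S" and f: "Ck_on (Suc 0) S f" and K: "compact K" "K \<subseteq> S" "\<And>x. x \<in> S \<Longrightarrow> x \<notin> K \<Longrightarrow> f x = 0"
  shows "((\<lambda>x. dderiv f x v) has_integral 0) S"
proof -
  define F where "F x = (if x \<in> S then f x else 0)" for x
  have oK: "open (- K)" using K(1) compact_imp_closed by auto
  have "Ck_on (Suc 0) UNIV F"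
  proof (rule Ck_on_local)
    fix x
    show "\<exists>U. open U \<and> x \<in> U \<and> Ck_on (Suc 0) U F"
    proof (cases "x \<in> S")
      case True
      have "Ck_on (Suc 0) S F" by (rule Ck_on_cong[OF S _ f]) (simp add: F_def)
      then show ?thesis using S True by blast
    next
      case False
      have "Ck_on (Suc 0) (- K) F" by (rule Ck_on_cong[OF oK _ Ck_on_const[of _ _ 0]]) (use K in \<open>auto simp: F_def\<close>)
      then show ?thesis using oK False K by blast
    qed
  qed
  then have "((\<lambda>x. dderiv F x v) has_integral 0) UNIV"
    by (rule has_integral_dderiv_UNIV[OF _ K(1)]) (use K in \<open>auto simp: F_def\<close>)
  moreover have "dderiv F x v = (if x \<in> S then dderiv f x v else 0)" for x
  proof (cases "x \<in> S")
    case True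
    have "dderiv f x v = dderiv F x v" by (rule dderiv_cong(1)[OF S True]) (use f True in \<open>auto simp: F_def\<close>)
    then show ?thesis using True by simp
  next
    case False
    have "dderiv F x v = 0" by (rule dderiv_eq_0[OF oK]) (use False K in \<open>auto simp: F_def\<close>)
    then show ?thesis using False by simp
  qed
  ultimately show ?thesis using has_integral_restrict_UNIV[of S "\<lambda>x. dderiv f x v" 0] by simp
qed

lemma change_of_variables_complex:
  fixes f :: "real ^ 'd::{finite,wellorder} \<Rightarrow> complex" and g :: "real ^ 'd::_ \<Rightarrow> real ^ 'd::_"
  assumes S: "S \<in> sets lebesgue" and g: "\<And>x. x \<in> S \<Longrightarrow> (g has_derivative g' x) (at x within S)" "inj_on g S"
    and i: "(\<lambda>x. \<bar>det (matrix (g' x))\<bar> *\<^sub>R f (g x)) absolutely_integrable_on S"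
  shows "f absolutely_integrable_on (g ` S)"
    "integral (g ` S) f = integral S (\<lambda>x. \<bar>det (matrix (g' x))\<bar> *\<^sub>R f (g x))"
proof -
  \<comment> \<open>The change of variables is carried out for the pair of real and imaginary parts
    as a vector of \<open>real ^ 2\<close>; the linear map \<open>W\<close> undoes
    \<open>V\<close>.\<close>
  define V :: "complex \<Rightarrow> real ^ 2" where "V z = (\<chi> i. if i = 1 then Re z else Im z)" for z
  define W :: "real ^ 2 \<Rightarrow> complex" where "W u = Complex (u $ 1) (u $ 2)" for u
  have WV: "W (V z) = z" for z by (simp add: V_def W_def)
  have V: "bounded_linear V"
    by (intro linear_conv_bounded_linear[THEN iffD1] linearI) (auto simp: V_def vec_eq_iff)
  have W: "bounded_linear W"
    by (intro linear_conv_bounded_linear[THEN iffD1] linearI) (auto simp: W_def complex_eq_iff)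
  let ?h = "\<lambda>x. \<bar>det (matrix (g' x))\<bar> *\<^sub>R f (g x)"
  have Vh: "V \<circ> ?h = (\<lambda>x. \<bar>det (matrix (g' x))\<bar> *\<^sub>R (V \<circ> f) (g x))"
    using linear_cmul[OF bounded_linear.linear[OF V]] by (simp add: fun_eq_iff)
  have "(V \<circ> ?h) absolutely_integrable_on S" by (rule absolutely_integrable_linear[OF i V])
  then have *: "(V \<circ> f) absolutely_integrable_on (g ` S)" "integral (g ` S) (V \<circ> f) = integral S (V \<circ> ?h)"
    unfolding Vh using has_absolute_integral_change_of_variables[OF S g, of "V \<circ> f" "integral S (V \<circ> ?h)"] Vh by auto
  have WVf: "W \<circ> (V \<circ> f) = f" by (simp add: fun_eq_iff WV)
  show ai: "f absolutely_integrable_on (g ` S)"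
    using absolutely_integrable_linear[OF *(1) W] by (simp add: WVf)
  have "integral (g ` S) f = W (integral (g ` S) (V \<circ> f))"
    using integral_linear[OF _ W, of "V \<circ> f" "g ` S"] *(1) by (simp add: WVf set_lebesgue_integral_eq_integral(1))
  also have "\<dots> = W (V (integral S ?h))"
    using integral_linear[OF _ V, of ?h S] i *(2) by (simp add: set_lebesgue_integral_eq_integral(1))
  finally show "integral (g ` S) f = integral S ?h" by (simp add: WV)
qed

section \<open>Hermitian manifolds\<close>

locale hermitian_manifold = atlas A
  for A :: "('m::{t2_space,second_countable_topology}, 'd::{finite,wellorder}) chart set" +
  fixes J :: "('m, 'd) endo_field" and g :: "('m, 'd) metric_field" and n :: nat
  assumes compact_manifold: "compact (UNIV :: 'm set)"
    and dimension: "CARD('d) = 2 * n"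
    and J: "almost_complex A J"
    and g: "hermitian_metric A J g"
begin

lemma hermitian_inner: "hermitian_inner (J p) (g p)"
  using J g by (simp add: hermitian_inner_def almost_complex_def hermitian_metric_def)

abbreviation "\<omega> \<equiv> fundamental_form J g"

lemma dim_positive: "0 < n"
  using dimension by (metis finite_UNIV_card_ge_0 finite_code mult_0_right neq0_conv)

lemma J_to_tangent:
  assumes "c \<in> maximal_atlas A" "x \<in> chart_image c"
  shows "J (chart_inv c x) (to_tangent A c x u) = to_tangent A c x (local_endo A c J x u)"
  by (simp add: local_endo_def to_of_tangent[OF assms])

lemma smooth_fundamental_form: "smooth_form A 2 \<omega>"
  unfolding smooth_form_def
proof (intro conjI allI ballI)
  show "alternating 2 (\<omega> p)" for p
    unfolding fundamental_form_eq by (rule alternating_fundamental[OF hermitian_inner])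
next
  fix c vs assume cA: "c \<in> A"
  then have c: "c \<in> maximal_atlas A" using atlas_subset_maximal by blast
  have op: "open (chart_image c)" by (rule is_chartD(2)[OF is_chart[OF c]])
  show "smooth_on (chart_image c) (\<lambda>x. local_form A c \<omega> x vs)"
  proof (cases "length vs = 2")
    case False
    then show ?thesis by (simp add: local_form_def fundamental_form_def smooth_on_def)
  next
    case True
    then obtain u v where vs: "vs = [u, v]" by (metis (no_types, lifting) One_nat_def Suc_1 length_0_conv length_Suc_conv)
    let ?g = "\<lambda>u v x. g (chart_inv c x) (to_tangent A c x u) (to_tangent A c x v)"
    have eq: "local_form A c \<omega> x vs = complex_of_real (\<Sum>e\<in>Basis. (local_endo A c J x u \<bullet> e) * ?g e v x)"
      if x: "x \<in> chart_image c" for x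
    proof -
      let ?h = "\<lambda>w. ?g w v x"
      have "bilinear (g (chart_inv c x))" using hermitian_inner by (simp add: hermitian_inner_def)
      then have "linear (\<lambda>w. g (chart_inv c x) w (to_tangent A c x v))" by (simp add: bilinear_def)
      then have lin: "linear ?h" using linear_compose[OF linear_to_tangent[OF c x]] by (simp add: o_def)
      have "local_form A c \<omega> x vs = complex_of_real (?h (local_endo A c J x u))"
        using J_to_tangent[OF c x] by (simp add: vs local_form_def fundamental_form_def)
      also have "?h (local_endo A c J x u) = ?h (\<Sum>e\<in>Basis. (local_endo A c J x u \<bullet> e) *\<^sub>R e)"
        by (simp add: euclidean_representation)
      also have "\<dots> = (\<Sum>e\<in>Basis. (local_endo A c J x u \<bullet> e) * ?h e)"
        using linear_sum[OF lin, of "\<lambda>e. (local_endo A c J x u \<bullet> e) *\<^sub>R e" Basis] linear_cmul[OF lin] by simp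
      finally show ?thesis .
    qed
    have C: "Ck_on k (chart_image c) (\<lambda>x. complex_of_real (\<Sum>e\<in>Basis. (local_endo A c J x u \<bullet> e) * ?g e v x))" for k
      using J g cA
      by (intro Ck_on_bounded_linear[OF op bounded_linear_of_real] Ck_on_sum op Ck_on_mult
          Ck_on_bounded_linear[OF op bounded_linear_inner_left] Ck_smooth_on)
        (auto simp: almost_complex_def hermitian_metric_def)
    show ?thesis unfolding smooth_on_def
      by (intro allI Ck_on_cong[OF op eq[symmetric] C])
  qed
qed

section \<open>The volume form and orientation\<close>

definition volume :: "('m, 'd) form" where
  "volume = form_power \<omega> n"

lemma volume_eq: "volume p = wedge_power (fundamental_cform (J p) (g p)) n"
  by (simp add: volume_def form_power_def fundamental_form_eq)

lemma smooth_volume: "smooth_form A CARD('d) volume"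
  using smooth_form_power[OF smooth_fundamental_form, of n] dimension by (simp add: volume_def mult.commute)

lemma alternating_volume: "alternating CARD('d) (volume p)"
  using smooth_volume by (simp add: smooth_form_def)

lemma unitary_frame:
  obtains us where "length us = n" "J_orthogonal (J p) (g p) us" "\<forall>u\<in>set us. g p u u = 1"
proof -
  have "2 * n \<le> DIM((real, 'd) vec)" using dimension by simp
  then show ?thesis using J_orthogonal_exists[OF hermitian_inner[of p]] that by metis
qed

text \<open>The coefficient of the volume form in the coordinates of \<open>c\<close>. Its sign
  encodes the orientation of the chart, and being continuous it can be controlled on open
  sets.\<close>

definition density :: "('m, 'd) chart \<Rightarrow> (real, 'd) vec \<Rightarrow> real" where
  "density c x = Re (local_form A c volume x standard_frame)"

lemma volume_J_frame:
  assumes "length us = n"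
  shows "\<exists>r\<ge>0. volume p (J_frame (J p) us) = complex_of_real r"
  using fundamental_power_nonneg[OF hermitian_inner[of p], of us] assms by (simp add: volume_eq)

lemma volume_unitary_frame:
  assumes "length us = n" "J_orthogonal (J p) (g p) us"
  shows "\<exists>r>0. volume p (J_frame (J p) us) = complex_of_real r"
  using volume_J_frame[OF assms(1), of p] fundamental_power_orthogonal[OF hermitian_inner assms(2)] assms(1)
  by (auto simp: volume_eq order_less_le)

context
  fixes c x assumes c: "c \<in> maximal_atlas A" and x: "x \<in> chart_image c"
begin

lemma local_volume_frame:
  assumes "length vs = CARD('d)"
  shows "local_form A c volume x vs = frame_det vs *\<^sub>R local_form A c volume x standard_frame"
  by (rule top_frame_det[OF local_form_alternating[OF c x alternating_volume] assms])

lemma J_frame_to_tangent: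
  "map (to_tangent A c x) (J_frame (local_endo A c J x) us) = J_frame (J (chart_inv c x)) (map (to_tangent A c x) us)"
  by (induction us) (auto simp: J_to_tangent[OF c x])

text \<open>On the \<open>J_frame\<close> of a unitary basis the volume form takes a positive real
  value, which is also a determinant times the coefficient of the volume form. So this coefficient
  is real and does not vanish.\<close>

lemma coordinate_unitary_frame:
  obtains us r where "length us = n" "r > 0"
    "r = frame_det (J_frame (local_endo A c J x) us) * density c x"
    "local_form A c volume x standard_frame = complex_of_real (density c x)" "density c x \<noteq> 0"
proof -
  let ?p = "chart_inv c x"
  obtain ws where ws: "length ws = n" "J_orthogonal (J ?p) (g ?p) ws" using unitary_frame by blast
  define us where "us = map (of_tangent A c x) ws"
  have "map (to_tangent A c x) us = ws"
    unfolding us_def by (simp add: o_def to_of_tangent[OF c x])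
  moreover obtain r where r: "r > 0" "volume ?p (J_frame (J ?p) ws) = complex_of_real r"
    using volume_unitary_frame[OF ws] by blast
  ultimately have val: "local_form A c volume x (J_frame (local_endo A c J x) us) = complex_of_real r"
    by (simp add: local_form_def J_frame_to_tangent)
  have "length (J_frame (local_endo A c J x) us) = CARD('d)" by (simp add: us_def ws dimension)
  from local_volume_frame[OF this] have eq: "frame_det (J_frame (local_endo A c J x) us) *\<^sub>R local_form A c volume x standard_frame = complex_of_real r"
    unfolding val by simp
  have "frame_det (J_frame (local_endo A c J x) us) * density c x = r"
    using arg_cong[OF eq, of Re] by (simp add: density_def)
  moreover have "frame_det (J_frame (local_endo A c J x) us) * Im (local_form A c volume x standard_frame) = 0"
    using arg_cong[OF eq, of Im] by simp
  ultimately have *: "density c x \<noteq> 0" "Im (local_form A c volume x standard_frame) = 0"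
    "frame_det (J_frame (local_endo A c J x) us) * density c x = r"
    using r(1) by auto
  show ?thesis
    by (rule that[of us r]) (use * r(1) ws(1) in \<open>simp_all add: us_def density_def complex_eq_iff\<close>)
qed

lemma local_volume: "local_form A c volume x standard_frame = complex_of_real (density c x)"
  and density_nonzero: "density c x \<noteq> 0"
  using coordinate_unitary_frame by blast+

end

text \<open>A single frame decides the sign at a point, because the volume form is nonnegative on
  every \<open>J_frame\<close> and positive on those of unitary bases.\<close>

lemma positive_chart_iff:
  assumes c: "c \<in> maximal_atlas A"
  shows "positive_chart A J c \<longleftrightarrow> (\<forall>x\<in>chart_image c. density c x > 0)"
proof
  assume p: "positive_chart A J c"
  show "\<forall>x\<in>chart_image c. density c x > 0"
  proof
    fix x assume x: "x \<in> chart_image c"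
    obtain us where us: "2 * length us = CARD('d)" "0 < frame_det (J_frame (local_endo A c J x) us)"
      using p x unfolding positive_chart_def J_frame_def by blast
    obtain r where "r \<ge> 0" "local_form A c volume x (J_frame (local_endo A c J x) us) = complex_of_real r"
      using volume_J_frame[of "map (to_tangent A c x) us" "chart_inv c x"] us(1) dimension
      by (auto simp: local_form_def J_frame_to_tangent[OF c x])
    then have "frame_det (J_frame (local_endo A c J x) us) * density c x \<ge> 0"
      using local_volume_frame[OF c x, of "J_frame (local_endo A c J x) us"] us(1)
      by (simp add: local_volume[OF c x] flip: of_real_mult) (simp add: scaleR_conv_of_real flip: of_real_mult)
    then show "density c x > 0"
      using us(2) density_nonzero[OF c x] by (simp add: zero_le_mult_iff)
  qed
next
  assume d: "\<forall>x\<in>chart_image c. density c x > 0"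
  show "positive_chart A J c" unfolding positive_chart_def J_frame_def[symmetric]
  proof
    fix x assume x: "x \<in> chart_image c"
    obtain us r where "length us = n" "r > 0" "r = frame_det (J_frame (local_endo A c J x) us) * density c x"
      using coordinate_unitary_frame[OF c x] by blast
    then show "\<exists>us. 2 * length us = CARD('d) \<and> 0 < frame_det (J_frame (local_endo A c J x) us)"
      using d x dimension by (intro exI[of _ us]) (auto simp: zero_less_mult_iff)
  qed
qed

lemma density_transition:
  assumes c: "c \<in> maximal_atlas A" "c' \<in> maximal_atlas A" and x: "x \<in> overlap c c'"
  shows "density c x = det (matrix (dderiv (transition c c') x)) * density c' (transition c c' x)"
proof -
  note f = overlap_facts[OF c x]
  have "linear (frechet_derivative (transition c c') (at x))"
    using transition_has_derivative[OF c x] by (intro linear_dderiv) (auto simp: differentiable_def)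
  then have "local_form A c volume x standard_frame
     = det (matrix (dderiv (transition c c') x)) *\<^sub>R local_form A c' volume (transition c c' x) standard_frame"
    unfolding local_form_transition[OF c x, of volume]
    by (intro top_map_det local_form_alternating[OF c(2) f(3)] alternating_volume)
  then show ?thesis by (simp add: density_def)
qed

lemma det_transition_pos:
  assumes "c \<in> maximal_atlas A" "c' \<in> maximal_atlas A" "x \<in> overlap c c'" "positive_chart A J c" "positive_chart A J c'"
  shows "0 < det (matrix (dderiv (transition c c') x))"
  using density_transition[OF assms(1-3)] overlap_facts[OF assms(1-3)] assms(4,5) positive_chart_iff assms(1,2)
  by (metis zero_less_mult_pos2)

lemma continuous_on_density: "c \<in> maximal_atlas A \<Longrightarrow> continuous_on (chart_image c) (density c)"
  unfolding density_def
  by (intro continuous_on_Re Ck_on_continuous[OF smooth_form_maximal[OF smooth_volume]])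

subsection \<open>Positive charts\<close>

text \<open>\<open>L\<close> is its own inverse, so the transitions of the new chart are those of
  \<open>c\<close> composed with \<open>L\<close> on one side. This is used to correct the
  orientation of a chart.\<close>

lemma restricted_chart:
  assumes c: "c \<in> A" and U: "open U" "U \<subseteq> fst c" and L: "linear L" "\<And>x. L (L x) = x"
  defines "c' \<equiv> (U, L \<circ> snd c)"
  shows "c' \<in> maximal_atlas A" "\<And>y. y \<in> chart_image c' \<Longrightarrow> y \<in> overlap c' c \<and> transition c' c y = L y"
proof -
  have cm: "c \<in> maximal_atlas A" using c atlas_subset_maximal by blast
  note ch = is_chartD[OF is_chart[OF cm]]
  have bl: "bounded_linear L" using L(1) linear_conv_bounded_linear by blast
  have cL: "continuous_on X L" for X using bl linear_continuous_on by blast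
  have openL: "open (L ` X)" if "open X" for X
  proof -
    have "L ` X = L -` X"
    proof (intro set_eqI iffI)
      fix z assume "z \<in> L -` X"
      then show "z \<in> L ` X" by (intro image_eqI[of _ _ "L z"]) (simp_all add: L(2))
    qed (auto simp: L(2))
    then show ?thesis using open_vimage[OF that cL[of UNIV]] by simp
  qed
  have img: "chart_image c' = L ` (snd c ` U)" by (auto simp: chart_image_def c'_def)
  have "snd c ` U = {x \<in> chart_image c. chart_inv c x \<in> U}"
    using ch(5-8) U(2) by (force simp: image_iff)
  then have oU: "open (snd c ` U)" using open_overlap[OF is_chart[OF cm] U(1)] by simp
  have inv: "chart_inv c' y = chart_inv c (L y)" "L y \<in> chart_image c" "chart_inv c (L y) \<in> U"
    if y: "y \<in> chart_image c'" for y
  proof -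
    obtain q where q: "q \<in> U" "y = L (snd c q)" using y img by auto
    have inj: "inj_on (L \<circ> snd c) U"
      by (rule inj_onI) (metis L(2) U(2) ch(5) comp_apply subsetD)
    have "chart_inv c' y = q" unfolding chart_inv_def c'_def using inj q by (simp add: inv_into_f_eq)
    moreover have "chart_inv c (L y) = q" using q U(2) ch(5) L(2) by auto
    ultimately show "chart_inv c' y = chart_inv c (L y)" "chart_inv c (L y) \<in> U" using q by auto
    show "L y \<in> chart_image c" using q U(2) ch(6) L(2) by auto
  qed
  have Linv: "L (snd c (chart_inv c (L y))) = y" if "y \<in> chart_image c'" for y
    using inv(2)[OF that] ch(8) L(2) by simp
  have chart: "is_chart c'"
    unfolding is_chart_def homeomorphism_def
  proof (intro conjI ballI)
    show "open (fst c')" "open (chart_image c')" using U oU openL img by (auto simp: c'_def)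
    show "continuous_on (fst c') (snd c')"
      using continuous_on_subset[OF ch(3) U(2)]
      by (auto simp: c'_def o_def intro: continuous_on_compose2[OF cL[of UNIV]])
    have "continuous_on (chart_image c') (\<lambda>y. chart_inv c (L y))"
      using inv(2) by (intro continuous_on_compose2[OF ch(4) cL]) auto
    then show "continuous_on (chart_image c') (chart_inv c')" using inv(1) continuous_on_cong by force
    show "snd c' ` fst c' = chart_image c'" by (simp add: chart_image_def)
    have *: "chart_inv c' (snd c' q) = q" if "q \<in> fst c'" for q
    proof -
      have "snd c' q \<in> chart_image c'" using that by (auto simp: chart_image_def)
      from inv(1)[OF this] show ?thesis using that ch(5) U(2) L(2) by (auto simp: c'_def)
    qed
    then show "chart_inv c' (snd c' q) = q" if "q \<in> fst c'" for q using that .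
    show "snd c' (chart_inv c' y) = y" if "y \<in> chart_image c'" for y
      using inv[OF that] Linv[OF that] by (simp add: c'_def)
    show "chart_inv c' ` chart_image c' = fst c'"
      using * inv by (force simp: c'_def chart_image_def)
  qed
  have tr: "y \<in> overlap c' c \<and> transition c' c y = L y" if "y \<in> chart_image c'" for y
    using inv[OF that] that U(2) ch(8) by (auto simp: overlap_iff[OF chart] transition_eq)
  show "\<And>y. y \<in> chart_image c' \<Longrightarrow> y \<in> overlap c' c \<and> transition c' c y = L y" by (rule tr)
  show "c' \<in> maximal_atlas A"
    unfolding maximal_atlas_def
  proof (intro CollectI conjI ballI chart)
    fix b assume b: "b \<in> A"
    then have bm: "b \<in> maximal_atlas A" using atlas_subset_maximal by blast
    note chb = is_chartD[OF is_chart[OF bm]]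
    have o1: "open (overlap c' b)"
    proof -
      have "overlap c' b = {y \<in> chart_image c'. chart_inv c' y \<in> fst b}" using overlap_iff[OF chart] by blast
      then show ?thesis using open_overlap[OF chart chb(1)] by simp
    qed
    have o2: "open (overlap b c')"
    proof -
      have "overlap b c' = {y \<in> chart_image b. chart_inv b y \<in> fst c'}" using overlap_iff[OF is_chart[OF bm]] by blast
      then show ?thesis using open_overlap[OF is_chart[OF bm]] U(1) by (simp add: c'_def)
    qed
    have "Ck_on k (overlap c' b) (\<lambda>y. transition c b (L y))" for k
    proof (rule Ck_on_compose[where f="transition c b" and g=L, OF o1 open_overlap'[OF cm bm]])
      show "Ck_on k (overlap c b) (transition c b)" by (rule Ck_smooth_on[OF smooth_transition(1)[OF cm b]])
      show "Ck_on k (overlap c' b) L" by (rule Ck_on_linear[OF o1 bl])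
      show "L ` overlap c' b \<subseteq> overlap c b"
        using inv by (auto simp: overlap_iff[OF chart, of _ b] overlap_iff[OF is_chart[OF cm], of _ b])
    qed
    then have "Ck_on k (overlap c' b) (transition c' b)" for k
      by (rule Ck_on_cong[OF o1, rotated]) (use inv overlap_iff[OF chart] in \<open>simp add: transition_eq\<close>)
    moreover have "Ck_on k (overlap b c') (\<lambda>y. L (transition b c y))" for k
      by (rule Ck_on_bounded_linear[OF o2 bl Ck_on_subset[OF Ck_smooth_on[OF smooth_transition(2)[OF cm b]]]])
        (use U(2) in \<open>auto simp: overlap_def c'_def\<close>)
    then have "Ck_on k (overlap b c') (transition b c')" for k
      by (rule Ck_on_cong[OF o2, rotated]) (simp add: transition_eq c'_def)
    ultimately show "smooth_compatible c' b"
      by (auto simp: smooth_compatible_def smooth_on_def overlap_def Int_commute)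
  qed
qed

lemma orientation_map:
  assumes "s \<noteq> 0"
  obtains L :: "(real, 'd) vec \<Rightarrow> (real, 'd) vec" where "linear L" "\<And>x. L (L x) = x" "0 < det (matrix L) * s"
proof (cases "s > 0")
  case True
  then show ?thesis using that[of id] by (simp add: linear_id matrix_id_mat_1)
next
  case False
  \<comment> \<open>Any index will do: reflecting one coordinate is an involution of determinant
    -1.\<close>
  fix k :: 'd
  let ?L = "\<lambda>x::(real, 'd) vec. \<chi> i. (if i = k then - 1 else 1) * x $ i"
  have "linear ?L" by (intro linearI) (auto simp: vec_eq_iff algebra_simps)
  moreover have "?L (?L x) = x" for x by (simp add: vec_eq_iff)
  moreover have "matrix ?L = (\<chi> i j. if i = j then (if i = k then - 1 else 1) else 0)"
    by (auto simp: matrix_def axis_def vec_eq_iff)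
  then have "det (matrix ?L) = (\<Prod>i\<in>UNIV. if i = k then - 1 else 1)" by (simp add: det_diagonal)
  then have "det (matrix ?L) = - 1" by (simp add: prod.delta)
  ultimately show ?thesis using that[of ?L] False assms by simp
qed

lemma positive_chart_exists:
  obtains c where "c \<in> maximal_atlas A" "positive_chart A J c" "p \<in> fst c"
proof -
  let ?b = "chart_at A p" let ?x = "snd ?b p"
  note cm = chart_at_maximal[of p]
  note ch = is_chartD[OF is_chart[OF cm]]
  define s where "s = density ?b ?x"
  have "s \<noteq> 0" unfolding s_def by (rule density_nonzero[OF cm chart_at_image])
  then obtain L :: "(real, 'd) vec \<Rightarrow> (real, 'd) vec" where L: "linear L" "\<And>x. L (L x) = x" "0 < det (matrix L) * s" by (rule orientation_map) blast
  \<comment> \<open>The part of the chart on which the density has the same sign as at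
    \<open>p\<close>. The density has no zeros, but a chart domain may be disconnected, so its sign
    can vary.\<close>
  define W where "W = {x \<in> chart_image ?b. 0 < density ?b x * s}"
  have "W = chart_image ?b \<inter> (\<lambda>x. density ?b x * s) -` {0<..}" by (auto simp: W_def)
  then have oW: "open W"
    using continuous_open_preimage[OF continuous_on_mult_right[OF continuous_on_density[OF cm]] ch(2)] by simp
  define U where "U = {q \<in> fst ?b. snd ?b q \<in> W}"
  have "U = fst ?b \<inter> snd ?b -` W" by (auto simp: U_def)
  then have oU: "open U" using continuous_open_preimage[OF ch(3) ch(1) oW] by simp
  have UU: "U \<subseteq> fst ?b" by (auto simp: U_def)
  note rc = restricted_chart[OF chart_at(1) oU UU L(1,2)]
  let ?c = "(U, L \<circ> snd ?b)"
  have "positive_chart A J ?c"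
    unfolding positive_chart_iff[OF rc(1)]
  proof
    fix y assume y: "y \<in> chart_image ?c"
    note t = rc(2)[OF y]
    have "(transition ?c ?b has_derivative L) (at y)"
    proof (rule has_derivative_transform_within_open[OF linear_imp_has_derivative[OF L(1)] is_chartD(2)[OF is_chart[OF rc(1)]] y])
      show "L z = transition ?c ?b z" if "z \<in> chart_image ?c" for z using rc(2)[OF that] by simp
    qed
    then have "frechet_derivative (transition ?c ?b) (at y) = L" using frechet_derivative_at by metis
    then have eq: "density ?c y = det (matrix L) * density ?b (L y)"
      using density_transition[OF rc(1) cm, of y] t by simp
    obtain q where "q \<in> U" "y = L (snd ?b q)" using y by (auto simp: chart_image_def)
    then have "0 < density ?b (L y) * s" using L(2) by (simp add: U_def W_def)
    from mult_pos_pos[OF L(3) this]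
    have "0 < (det (matrix L) * density ?b (L y)) * (s * s)" by (simp only: mult_ac)
    moreover have "0 < s * s" using \<open>s \<noteq> 0\<close> by (auto simp: zero_less_mult_iff linorder_neq_iff)
    ultimately show "density ?c y > 0" unfolding eq by (rule zero_less_mult_pos2)
  qed
  moreover have "p \<in> U"
    using chart_at(2) chart_at_image \<open>s \<noteq> 0\<close> by (auto simp: U_def W_def s_def zero_less_mult_iff linorder_neq_iff)
  ultimately show ?thesis using that[OF rc(1)] by simp
qed

subsection \<open>Partitions of unity\<close>

lemma bump_function_exists:
  obtains c \<psi> W where "c \<in> maximal_atlas A" "positive_chart A J c" "smooth_function A \<psi>" "\<And>q. 0 \<le> \<psi> q"
    "closure {q. \<psi> q \<noteq> 0} \<subseteq> fst c" "open W" "p \<in> W" "\<And>q. q \<in> W \<Longrightarrow> 0 < \<psi> q"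
proof -
  obtain c where c: "c \<in> maximal_atlas A" "positive_chart A J c" "p \<in> fst c" using positive_chart_exists .
  note ch = is_chartD[OF is_chart[OF c(1)]]
  define a where "a = snd c p"
  obtain r where r: "r > 0" "cball a r \<subseteq> chart_image c"
    using ch(2,6) c(3) open_contains_cball unfolding a_def by blast
  define \<psi> where "\<psi> q = (if q \<in> fst c then bump a r (snd c q) else 0)" for q
  define K where "K = chart_inv c ` cball a r"
  \<comment> \<open>In a Hausdorff space this makes \<open>K\<close> closed. Its complement is then
    open, and together with the chart domain it covers the manifold, so extension by zero is
    smooth.\<close>
  have "compact K" unfolding K_def by (rule compact_continuous_image[OF continuous_on_subset[OF ch(4) r(2)] compact_cball])
  then have K: "closed K" by (rule compact_imp_closed)
  have KU: "K \<subseteq> fst c" using r(2) ch(7) by (auto simp: K_def)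
  have out: "\<psi> q = 0" if "q \<notin> K" for q
  proof (cases "q \<in> fst c")
    case True
    then have "snd c q \<notin> cball a r" using that ch(5)[OF True] unfolding K_def by (metis image_eqI)
    then show ?thesis using bump_outside[of r "snd c q" a] r(1) by (simp add: \<psi>_def)
  qed (simp add: \<psi>_def)
  have "closure {q. \<psi> q \<noteq> 0} \<subseteq> K" by (rule closure_minimal[OF _ K]) (use out in auto)
  then have cl: "closure {q. \<psi> q \<noteq> 0} \<subseteq> fst c" using KU by blast
  have "smooth_function A \<psi>"
    unfolding smooth_function_def smooth_on_def
  proof (intro ballI allI Ck_on_local)
    fix b k y assume b: "b \<in> A" and y: "y \<in> chart_image b"
    have bm: "b \<in> maximal_atlas A" using b atlas_subset_maximal by blast
    show "\<exists>U. open U \<and> y \<in> U \<and> Ck_on k U (\<psi> \<circ> chart_inv b)"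
    proof (cases "chart_inv b y \<in> fst c")
      case True
      have o: "open (overlap b c)" by (rule open_overlap'[OF bm c(1)])
      have "Ck_on k (overlap b c) (\<lambda>y. bump a r (transition b c y))"
        by (rule Ck_on_compose[OF o open_UNIV Ck_on_bump[OF open_UNIV] Ck_smooth_on[OF smooth_transition(2)[OF c(1) b]]]) simp
      then have "Ck_on k (overlap b c) (\<psi> \<circ> chart_inv b)"
        by (rule Ck_on_cong[OF o, rotated]) (use overlap_iff[OF is_chart[OF bm]] in \<open>auto simp: \<psi>_def transition_eq\<close>)
      then show ?thesis using o True y overlap_iff[OF is_chart[OF bm]] by blast
    next
      case False
      let ?V = "{z \<in> chart_image b. chart_inv b z \<in> - K}"
      have o: "open ?V" by (rule open_overlap[OF is_chart[OF bm]]) (use K in auto)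
      have "Ck_on k ?V (\<psi> \<circ> chart_inv b)"
        by (rule Ck_on_cong[OF o _ Ck_on_const[of _ _ 0]]) (use out in auto)
      then show ?thesis using o False KU y by blast
    qed
  qed
  moreover define W where "W = fst c \<inter> snd c -` {x. 0 < bump a r x}"
  have "open {x. 0 < bump a r x}"
    using Ck_on_continuous[OF Ck_on_bump[OF open_UNIV]] by (intro open_Collect_less continuous_on_const)
  then have "open W" unfolding W_def by (rule continuous_open_preimage[OF ch(3) ch(1)])
  moreover have "p \<in> W" using c(3) bump_center[OF r(1), of a] by (simp add: W_def a_def)
  moreover have "0 < \<psi> q" if "q \<in> W" for q using that by (simp add: W_def \<psi>_def)
  moreover have "0 \<le> \<psi> q" for q by (simp add: \<psi>_def bump_nonneg)
  ultimately show ?thesis using that[OF c(1,2) _ _ cl] by blast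
qed

text \<open>Without existence the choice in \<open>form_integral\<close> would be arbitrary.
  Compactness leaves finitely many bump functions whose sum is positive everywhere, and dividing by
  this sum normalizes them.\<close>

lemma partition_of_unity_exists: "\<exists>P. partition_of_unity A J P"
proof -
  have "\<forall>p. \<exists>c \<psi> W. c \<in> maximal_atlas A \<and> positive_chart A J c \<and> smooth_function A \<psi> \<and> (\<forall>q. 0 \<le> \<psi> q) \<and>
    closure {q. \<psi> q \<noteq> 0} \<subseteq> fst c \<and> open W \<and> p \<in> W \<and> (\<forall>q\<in>W. 0 < \<psi> q)"
  proof
    fix p
    show "\<exists>c \<psi> W. c \<in> maximal_atlas A \<and> positive_chart A J c \<and> smooth_function A \<psi> \<and> (\<forall>q. 0 \<le> \<psi> q) \<and>
      closure {q. \<psi> q \<noteq> 0} \<subseteq> fst c \<and> open W \<and> p \<in> W \<and> (\<forall>q\<in>W. 0 < \<psi> q)"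
      by (rule bump_function_exists[of p]) blast
  qed
  then obtain c \<psi> W where f: "\<And>p. c p \<in> maximal_atlas A" "\<And>p. positive_chart A J (c p)" "\<And>p. smooth_function A (\<psi> p)"
    "\<And>p q. 0 \<le> \<psi> p q" "\<And>p. closure {q. \<psi> p q \<noteq> 0} \<subseteq> fst (c p)" "\<And>p. open (W p)" "\<And>p. p \<in> W p"
    "\<And>p q. q \<in> W p \<Longrightarrow> 0 < \<psi> p q" by metis
  obtain C where C: "C \<subseteq> UNIV" "finite C" "UNIV \<subseteq> (\<Union>p\<in>C. W p)"
    by (rule compactE_image[OF compact_manifold, of UNIV W]) (use f(6,7) in auto)
  define Q where "Q = (\<lambda>p. (c p, \<psi> p)) ` C"
  have fQ: "finite Q" using C(2) by (simp add: Q_def)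
  define S where "S q = (\<Sum>(c, \<phi>)\<in>Q. \<phi> q)" for q
  have S: "S q > 0" for q
  proof -
    obtain p where p: "p \<in> C" "q \<in> W p" using C(3) by blast
    have "0 < \<psi> p q" using f(8) p by blast
    also have "\<psi> p q = (case (c p, \<psi> p) of (c, \<phi>) \<Rightarrow> \<phi> q)" by simp
    also have "\<dots> \<le> S q" unfolding S_def
      by (rule member_le_sum[OF _ _ fQ]) (use p f(4) in \<open>auto simp: Q_def\<close>)
    finally show ?thesis .
  qed
  let ?N = "\<lambda>(c, \<phi>). (c, \<lambda>q. \<phi> q / S q)"
  \<comment> \<open>A partition is a set of pairs, so normalization must not merge two of them, or
    the sum would lose a summand.\<close>
  have inj: "inj_on ?N Q"
  proof (rule inj_onI)
    fix u v assume "?N u = ?N v"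
    then have "fst u = fst v" "\<And>q. snd u q / S q = snd v q / S q" by (auto simp: case_prod_beta fun_eq_iff)
    moreover have "S q \<noteq> 0" for q using S[of q] by simp
    ultimately show "u = v" by (intro prod_eqI ext) auto
  qed
  have "partition_of_unity A J (?N ` Q)"
    unfolding partition_of_unity_def
  proof (intro conjI ballI allI)
    show "finite (?N ` Q)" using fQ by simp
    show "(\<Sum>(c, \<rho>)\<in>?N ` Q. \<rho> q) = 1" for q
    proof -
      have "(\<Sum>(c, \<rho>)\<in>?N ` Q. \<rho> q) = (\<Sum>(c, \<phi>)\<in>Q. \<phi> q / S q)"
        unfolding sum.reindex[OF inj] by (simp add: case_prod_beta)
      also have "\<dots> = (\<Sum>(c, \<phi>)\<in>Q. \<phi> q) / S q" by (simp add: sum_divide_distrib case_prod_beta)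
      also have "\<dots> = 1" using S[of q] by (simp flip: S_def)
      finally show ?thesis .
    qed
  next
    fix u assume "u \<in> ?N ` Q"
    then obtain p where p: "p \<in> C" "u = (c p, \<lambda>q. \<psi> p q / S q)" by (auto simp: Q_def)
    have "{q. \<psi> p q / S q \<noteq> 0} = {q. \<psi> p q \<noteq> 0}" using S by (auto simp: less_le)
    then have cl: "closure {q. \<psi> p q / S q \<noteq> 0} \<subseteq> fst (c p)" using f(5) by simp
    have "smooth_function A (\<lambda>q. \<psi> p q / S q)"
      unfolding smooth_function_def smooth_on_def
    proof (intro ballI allI)
      fix b k assume b: "b \<in> A"
      then have o: "open (chart_image b)" using is_chartD(2)[OF is_chart] atlas_subset_maximal by blast
      have C\<psi>: "Ck_on k (chart_image b) (\<lambda>y. \<psi> p (chart_inv b y))" for p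
        using f(3)[of p] b by (auto simp: smooth_function_def smooth_on_def o_def)
      have CS: "Ck_on k (chart_image b) (\<lambda>y. S (chart_inv b y))"
        unfolding S_def by (rule Ck_on_sum[OF o]) (auto simp: Q_def intro: C\<psi>)
      have "Ck_on k (chart_image b) (\<lambda>y. inverse (S (chart_inv b y)))"
        by (rule Ck_on_inverse[OF o CS]) (metis S less_irrefl)
      from Ck_on_mult[OF o C\<psi>[of p] this]
      show "Ck_on k (chart_image b) ((\<lambda>q. \<psi> p q / S q) \<circ> chart_inv b)" by (simp add: o_def divide_inverse)
    qed
    then show "case u of (c, \<rho>) \<Rightarrow> c \<in> maximal_atlas A \<and> positive_chart A J c \<and> smooth_function A \<rho> \<and>
        (\<forall>p. 0 \<le> \<rho> p) \<and> closure {p. \<rho> p \<noteq> 0} \<subseteq> fst c"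
      using p f(1,2,4) S cl by (simp add: less_imp_le)
  qed
  then show ?thesis by blast
qed

end

section \<open>Stokes' theorem\<close>

lemma integral_zero_outside:
  assumes "S \<subseteq> T" "\<And>x. x \<in> T \<Longrightarrow> x \<notin> S \<Longrightarrow> f x = 0"
  shows "integral S f = integral T (f :: 'a::euclidean_space \<Rightarrow> 'b::euclidean_space)"
proof -
  have "(\<lambda>x. if x \<in> S then f x else 0) = (\<lambda>x. if x \<in> T then f x else 0)" using assms by (auto simp: fun_eq_iff)
  then show ?thesis using integral_restrict_UNIV[of S f] integral_restrict_UNIV[of T f] by simp
qed

definition scale_form :: "('m \<Rightarrow> real) \<Rightarrow> ('m, 'd) form \<Rightarrow> ('m, 'd) form" where
  "scale_form \<rho> \<alpha> = (\<lambda>p vs. complex_of_real (\<rho> p) * \<alpha> p vs)"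

lemma local_form_scale: "local_form A c (scale_form \<rho> \<alpha>) x vs = complex_of_real (\<rho> (chart_inv c x)) * local_form A c \<alpha> x vs"
  by (simp add: local_form_def scale_form_def)

lemma local_form_sum: "local_form A c (\<lambda>p vs. \<Sum>i\<in>I. a i p vs) x vs = (\<Sum>i\<in>I. local_form A c (a i) x vs)"
  by (simp add: local_form_def)

definition chart_integral ::
  "('m, 'd::{finite,wellorder}) chart set \<Rightarrow> ('m, 'd) chart \<Rightarrow> ('m, 'd) form \<Rightarrow> complex" where
  "chart_integral A c \<beta> = integral (chart_image c) (\<lambda>x. local_form A c \<beta> x standard_frame)"

context atlas
begin

text \<open>Functions are treated as forms of degree 0, so that smoothness of their multiples of a
  form is a case of \<open>smooth_form_wedge\<close>.\<close>

lemma smooth_function_form: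
  assumes "smooth_function A \<rho>" shows "smooth_form A 0 (scale_form \<rho> (\<lambda>p. wedge_one))"
  unfolding smooth_form_def
proof (intro conjI allI ballI)
  show "alternating 0 (scale_form \<rho> (\<lambda>p. wedge_one) p)" for p
    by (simp add: alternating_0 scale_form_def wedge_one_def)
next
  fix c vs assume cA: "c \<in> A"
  then have op: "open (chart_image c)" using is_chartD(2)[OF is_chart] atlas_subset_maximal by blast
  have "Ck_on k (chart_image c) (\<lambda>x. \<rho> (chart_inv c x))" for k
    using assms cA by (auto simp: smooth_function_def smooth_on_def o_def)
  then show "smooth_on (chart_image c) (\<lambda>x. local_form A c (scale_form \<rho> (\<lambda>p. wedge_one)) x vs)"
    unfolding smooth_on_def local_form_scale local_form_one
    by (intro allI Ck_on_mult[OF op] Ck_on_bounded_linear[OF op bounded_linear_of_real] Ck_on_const)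
qed

lemma scale_form_wedge: "scale_form \<rho> \<alpha> = form_wedge (scale_form \<rho> (\<lambda>p. wedge_one)) \<alpha>"
  by (simp add: scale_form_def form_wedge_def wedge_scale_left fun_eq_iff)

lemma smooth_scale_form:
  assumes "smooth_function A \<rho>" "smooth_form A k \<alpha>" shows "smooth_form A k (scale_form \<rho> \<alpha>)"
  using smooth_form_wedge[OF smooth_function_form[OF assms(1)] assms(2)] by (simp flip: scale_form_wedge)

lemma continuous_on_function:
  assumes "smooth_function A \<rho>" "c \<in> maximal_atlas A"
  shows "continuous_on (chart_image c) (\<lambda>x. complex_of_real (\<rho> (chart_inv c x)))"
  using Ck_on_continuous[OF smooth_form_maximal[OF smooth_function_form[OF assms(1)] assms(2), where vs="[]" and l=0]]
  by (simp add: local_form_scale local_form_one) (simp add: wedge_one_def)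

lemma continuous_on_local_ext_deriv:
  assumes "smooth_form A k \<alpha>" "c \<in> maximal_atlas A"
  shows "continuous_on (chart_image c) (\<lambda>x. local_form A c (ext_deriv A \<alpha>) x vs)"
proof -
  have "continuous_on (chart_image c) (\<lambda>x. local_ext_deriv (local_form A c \<alpha>) x vs)"
    unfolding local_ext_deriv_def
    using smooth_form_maximal[OF assms, of "Suc 0"] by (intro continuous_intros) auto
  then show ?thesis using local_form_ext_deriv[OF assms] by simp
qed

lemma ext_deriv_zero_outside:
  assumes \<alpha>: "smooth_form A k \<alpha>" and K: "closed K" "\<And>p vs. p \<notin> K \<Longrightarrow> \<alpha> p vs = 0" and p: "p \<notin> K"
  shows "ext_deriv A \<alpha> p vs = 0"
proof -
  let ?c = "chart_at A p" let ?x = "snd ?c p"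
  let ?V = "{y \<in> chart_image ?c. chart_inv ?c y \<in> - K}"
  have o: "open ?V" by (rule open_overlap[OF is_chart[OF chart_at_maximal]]) (use K in auto)
  have x: "?x \<in> ?V"
    using p chart_at_image is_chartD(5)[OF is_chart[OF chart_at_maximal] chart_at(2)] by auto
  have "local_ext_deriv (local_form A ?c \<alpha>) ?x vs = local_ext_deriv (\<lambda>y vs. 0) ?x vs"
    by (rule local_ext_deriv_cong(1)[OF o x _ form_differentiable_local_form[OF \<alpha> chart_at_maximal chart_at_image]])
      (use K(2) in \<open>auto simp: local_form_def fun_eq_iff\<close>)
  then show ?thesis by (simp add: ext_deriv_def Let_def) (simp add: local_ext_deriv_def)
qed

lemma ext_deriv_sum:
  assumes a: "\<And>i. i \<in> I \<Longrightarrow> smooth_form A k (a i)" and eq: "\<alpha> = (\<lambda>p vs. \<Sum>i\<in>I. a i p vs)"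
  shows "ext_deriv A \<alpha> p vs = (\<Sum>i\<in>I. ext_deriv A (a i) p vs)"
proof -
  have "local_form A c \<alpha> = (\<lambda>y vs. \<Sum>i\<in>I. local_form A c (a i) y vs)" for c
    unfolding eq local_form_sum by (simp add: local_form_sum fun_eq_iff)
  then show ?thesis
    unfolding ext_deriv_def Let_def
    using local_ext_deriv_sum[of I "\<lambda>i. local_form A (chart_at A p) (a i)"]
      form_differentiable_local_form[OF a chart_at_maximal chart_at_image] by simp
qed

end

section \<open>Integrals over single charts and their comparison\<close>

context hermitian_manifold
begin

lemma compact_coordinate_image:
  assumes "c \<in> maximal_atlas A" "closed K" "K \<subseteq> fst c"
  shows "compact (snd c ` K)" "snd c ` K \<subseteq> chart_image c"
proof -
  have "compact K" using compact_Int_closed[OF compact_manifold assms(2)] by simp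
  then show "compact (snd c ` K)"
    using compact_continuous_image continuous_on_subset[OF is_chartD(3)[OF is_chart[OF assms(1)]] assms(3)] by blast
  show "snd c ` K \<subseteq> chart_image c" using assms(3) by (auto simp: chart_image_def)
qed

lemma local_form_supported:
  assumes "c \<in> maximal_atlas A" "\<And>p vs. p \<notin> K \<Longrightarrow> \<beta> p vs = 0" "x \<in> chart_image c" "x \<notin> snd c ` K"
  shows "local_form A c \<beta> x vs = 0"
proof -
  have "chart_inv c x \<notin> K" using assms(3,4) is_chartD(8)[OF is_chart[OF assms(1)]] by (metis image_eqI)
  then show ?thesis using assms(2) by (simp add: local_form_def)
qed

lemma supported_integrable:
  assumes c: "c \<in> maximal_atlas A" and K: "closed K" "K \<subseteq> fst c" "\<And>p vs. p \<notin> K \<Longrightarrow> \<beta> p vs = 0"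
    and cont: "continuous_on (chart_image c) (\<lambda>x. local_form A c \<beta> x vs)"
  shows "(\<lambda>x. local_form A c \<beta> x vs) absolutely_integrable_on chart_image c"
proof (rule absolutely_integrable_compact_support[OF cont compact_coordinate_image[OF c K(1,2)]])
  show "local_form A c \<beta> x vs = 0" if "x \<in> chart_image c" "x \<notin> snd c ` K" for x
    by (rule local_form_supported[OF c K(3) that])
qed

text \<open>Both integrals live on the overlap, and there the change of variables formula applies.
  The transition of two positive charts has positive determinant, so the absolute value in that
  formula agrees with the factor by which top forms transform.\<close>

lemma chart_integral_swap:
  assumes c: "c \<in> maximal_atlas A" "positive_chart A J c" and c': "c' \<in> maximal_atlas A" "positive_chart A J c'"
    and alt: "\<And>p. alternating CARD('d) (\<beta> p)"
    and supp: "\<And>p vs. p \<notin> fst c \<or> p \<notin> fst c' \<Longrightarrow> \<beta> p vs = 0"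
    and int: "(\<lambda>x. local_form A c \<beta> x standard_frame) absolutely_integrable_on chart_image c"
  shows "chart_integral A c \<beta> = chart_integral A c' \<beta>"
proof -
  let ?T = "transition c c'" let ?S = "overlap c c'"
  have op: "open ?S" by (rule open_overlap'[OF c(1) c'(1)])
  then have S: "?S \<in> sets lebesgue" by auto
  have sub: "?S \<subseteq> chart_image c" "overlap c' c \<subseteq> chart_image c'"
    by (auto simp: overlap_iff[OF is_chart[OF c(1)], of _ c'] overlap_iff[OF is_chart[OF c'(1)], of _ c])
  note f = overlap_facts[OF c(1) c'(1)]
  have im: "?T ` ?S = overlap c' c"
  proof
    show "?T ` ?S \<subseteq> overlap c' c" using f(5) by blast
    show "overlap c' c \<subseteq> ?T ` ?S"
    proof
      fix y assume y: "y \<in> overlap c' c"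
      then show "y \<in> ?T ` ?S"
        using overlap_facts(5,6)[OF c'(1) c(1) y] by (intro image_eqI[of _ _ "transition c' c y"]) auto
    qed
  qed
  have inj: "inj_on ?T ?S" by (rule inj_on_inverseI[where g="transition c' c"]) (rule f(6))
  have der: "(?T has_derivative frechet_derivative ?T (at x)) (at x within ?S)" if "x \<in> ?S" for x
    by (rule has_derivative_at_withinI[OF has_dderiv[OF differentiableI[OF transition_has_derivative[OF c(1) c'(1) that]]]])
  have eq: "\<bar>det (matrix (frechet_derivative ?T (at x)))\<bar> *\<^sub>R local_form A c' \<beta> (?T x) standard_frame
      = local_form A c \<beta> x standard_frame" if x: "x \<in> ?S" for x
  proof -
    have "linear (frechet_derivative ?T (at x))" using der[OF x] has_derivative_linear by blast
    then have "local_form A c \<beta> x standard_frame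
       = det (matrix (frechet_derivative ?T (at x))) *\<^sub>R local_form A c' \<beta> (?T x) standard_frame"
      unfolding local_form_transition[OF c(1) c'(1) x, of \<beta>]
      by (intro top_map_det local_form_alternating[OF c'(1) f(3)[OF x]] alt)
    then show ?thesis using det_transition_pos[OF c(1) c'(1) x c(2) c'(2)] by simp
  qed
  have int': "(\<lambda>x. \<bar>det (matrix (frechet_derivative ?T (at x)))\<bar> *\<^sub>R local_form A c' \<beta> (?T x) standard_frame)
      absolutely_integrable_on ?S"
    by (subst set_integrable_cong[OF refl refl eq]) (use set_integrable_subset[OF int S sub(1)] in auto)
  have "integral (chart_image c) (\<lambda>x. local_form A c \<beta> x standard_frame) = integral ?S (\<lambda>x. local_form A c \<beta> x standard_frame)"
    by (rule integral_zero_outside[OF sub(1), symmetric])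
      (use supp overlap_iff[OF is_chart[OF c(1)]] in \<open>auto simp: local_form_def\<close>)
  also have "\<dots> = integral ?S (\<lambda>x. \<bar>det (matrix (frechet_derivative ?T (at x)))\<bar> *\<^sub>R local_form A c' \<beta> (?T x) standard_frame)"
    by (rule integral_cong) (simp add: eq)
  also have "\<dots> = integral (?T ` ?S) (\<lambda>x. local_form A c' \<beta> x standard_frame)"
    by (rule change_of_variables_complex(2)[OF S der inj int', symmetric])
  also have "\<dots> = integral (chart_image c') (\<lambda>x. local_form A c' \<beta> x standard_frame)"
    unfolding im by (rule integral_zero_outside[OF sub(2)])
      (use supp overlap_iff[OF is_chart[OF c'(1)]] in \<open>auto simp: local_form_def\<close>)
  finally show ?thesis by (simp add: chart_integral_def)
qed

definition unity :: "(('m, 'd) chart \<times> ('m \<Rightarrow> real)) set" where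
  "unity = (SOME P. partition_of_unity A J P)"

lemma unity: "partition_of_unity A J unity"
  unfolding unity_def using someI_ex[OF partition_of_unity_exists] .

lemma finite_unity: "finite unity"
  and sum_unity: "(\<Sum>u\<in>unity. snd u p) = 1"
  using unity by (auto simp: partition_of_unity_def case_prod_beta)

lemma unityD:
  assumes "u \<in> unity"
  shows "fst u \<in> maximal_atlas A" "positive_chart A J (fst u)" "smooth_function A (snd u)" "0 \<le> snd u p"
    "closure {p. snd u p \<noteq> 0} \<subseteq> fst (fst u)"
  using unity assms by (auto simp: partition_of_unity_def case_prod_beta)

lemma form_integral_unity:
  "form_integral A J \<beta> = (\<Sum>u\<in>unity. chart_integral A (fst u) (scale_form (snd u) \<beta>))"
  unfolding form_integral_def unity_def[symmetric] chart_integral_def local_form_scale case_prod_beta ..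

lemma unity_outside: "p \<notin> closure {p. snd u p \<noteq> 0} \<Longrightarrow> snd u p = 0"
  using closure_subset[of "{p. snd u p \<noteq> 0}"] by auto

text \<open>Every term of the coordinate formula is, up to sign, a directional derivative of a
  function with compact support in the chart image.\<close>

lemma chart_integral_exact:
  assumes c: "c \<in> maximal_atlas A" and \<beta>: "smooth_form A k \<beta>"
    and K: "closed K" "K \<subseteq> fst c" "\<And>p vs. p \<notin> K \<Longrightarrow> \<beta> p vs = 0"
  shows "chart_integral A c (ext_deriv A \<beta>) = 0"
proof -
  have op: "open (chart_image c)" by (rule is_chartD(2)[OF is_chart[OF c]])
  have "((\<lambda>x. dderiv (\<lambda>y. local_form A c \<beta> y vs) x v) has_integral 0) (chart_image c)" for vs v
  proof (rule has_integral_dderiv[OF op smooth_form_maximal[OF \<beta> c] compact_coordinate_image[OF c K(1,2)]])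
    show "local_form A c \<beta> x vs = 0" if "x \<in> chart_image c" "x \<notin> snd c ` K" for x
      by (rule local_form_supported[OF c K(3) that])
  qed
  then have "((\<lambda>x. (- 1) ^ i * dderiv (\<lambda>y. local_form A c \<beta> y vs) x v) has_integral (- 1) ^ i * 0) (chart_image c)" for i vs v
    by (rule has_integral_mult_right)
  then have "((\<lambda>x. local_ext_deriv (local_form A c \<beta>) x standard_frame) has_integral (\<Sum>i<length (standard_frame :: (real, 'd) vec list). (- 1) ^ i * 0)) (chart_image c)"
    unfolding local_ext_deriv_def by (intro has_integral_sum) auto
  then have "integral (chart_image c) (\<lambda>x. local_ext_deriv (local_form A c \<beta>) x standard_frame) = 0"
    by (simp add: integral_unique)
  moreover have "integral (chart_image c) (\<lambda>x. local_form A c (ext_deriv A \<beta>) x standard_frame)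
    = integral (chart_image c) (\<lambda>x. local_ext_deriv (local_form A c \<beta>) x standard_frame)"
    by (rule integral_cong) (rule local_form_ext_deriv[OF \<beta> c])
  ultimately show ?thesis by (simp add: chart_integral_def)
qed

text \<open>Write \<open>\<alpha>\<close> as the sum of the forms \<open>\<rho> \<alpha>\<close>; each of these is supported in one chart, where its
  exterior derivative integrates to zero, and the integral may be computed in that chart alone.\<close>

theorem stokes:
  assumes \<alpha>: "smooth_form A k \<alpha>" and k: "Suc k = CARD('d)"
  shows "form_integral A J (ext_deriv A \<alpha>) = 0"
proof -
  define b where "b u = ext_deriv A (scale_form (snd u) \<alpha>)" for u :: "('m, 'd) chart \<times> ('m \<Rightarrow> real)"
  define K where "K u = closure {p. snd u p \<noteq> 0}" for u :: "('m, 'd) chart \<times> ('m \<Rightarrow> real)"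
  have clK: "closed (K u)" for u by (simp add: K_def)
  have KU: "K u \<subseteq> fst (fst u)" if "u \<in> unity" for u using unityD(5)[OF that] by (simp add: K_def)
  have out: "snd u p = 0" if "p \<notin> K u" for u p using that unity_outside[of p u] by (simp add: K_def)
  have sm: "smooth_form A k (scale_form (snd u) \<alpha>)" if "u \<in> unity" for u
    by (rule smooth_scale_form[OF unityD(3)[OF that] \<alpha>])
  have b0: "b u p vs = 0" if "u \<in> unity" "p \<notin> K u" for u p vs
    unfolding b_def by (rule ext_deriv_zero_outside[OF sm[OF that(1)] clK _ that(2)]) (simp add: scale_form_def out)
  have "\<alpha> = (\<lambda>p vs. \<Sum>u\<in>unity. scale_form (snd u) \<alpha> p vs)"
    by (simp add: scale_form_def fun_eq_iff sum_unity flip: sum_distrib_right of_real_sum)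
  then have d\<alpha>: "ext_deriv A \<alpha> p vs = (\<Sum>u\<in>unity. b u p vs)" for p vs
    unfolding b_def by (rule ext_deriv_sum[rotated, where k=k]) (rule sm)
  have cont: "continuous_on (chart_image c) (\<lambda>x. local_form A c (scale_form (snd u') (b u)) x vs)"
    if "u \<in> unity" "u' \<in> unity" "c \<in> maximal_atlas A" for u u' c vs
    unfolding local_form_scale b_def
    by (intro continuous_on_mult continuous_on_function[OF unityD(3)[OF that(2)] that(3)]
        continuous_on_local_ext_deriv[OF sm[OF that(1)] that(3)])
  have int: "(\<lambda>x. local_form A (fst u) (scale_form (snd u') (b u)) x vs) absolutely_integrable_on chart_image (fst u)"
    "(\<lambda>x. local_form A (fst u') (scale_form (snd u') (b u)) x vs) absolutely_integrable_on chart_image (fst u')"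
    if u: "u \<in> unity" "u' \<in> unity" for u u' vs
  proof -
    show "(\<lambda>x. local_form A (fst u) (scale_form (snd u') (b u)) x vs) absolutely_integrable_on chart_image (fst u)"
      by (rule supported_integrable[OF unityD(1)[OF u(1)] clK KU[OF u(1)] _ cont[OF u unityD(1)[OF u(1)]]])
        (simp add: scale_form_def b0[OF u(1)])
    show "(\<lambda>x. local_form A (fst u') (scale_form (snd u') (b u)) x vs) absolutely_integrable_on chart_image (fst u')"
      by (rule supported_integrable[OF unityD(1)[OF u(2)] clK KU[OF u(2)] _ cont[OF u unityD(1)[OF u(2)]]])
        (simp add: scale_form_def out)
  qed
  have swap: "chart_integral A (fst u) (scale_form (snd u') (b u)) = chart_integral A (fst u') (scale_form (snd u') (b u))"
    if u: "u \<in> unity" "u' \<in> unity" for u u'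
  proof (rule chart_integral_swap[OF unityD(1,2)[OF u(1)] unityD(1,2)[OF u(2)] _ _ int(1)[OF u]])
    show "alternating CARD('d) (scale_form (snd u') (b u) p)" for p
      using alternating_scale[OF alternating_ext_deriv[OF sm[OF u(1)]]] unfolding scale_form_def b_def k by blast
    show "scale_form (snd u') (b u) p vs = 0" if "p \<notin> fst (fst u) \<or> p \<notin> fst (fst u')" for p vs
      using that b0[OF u(1), of p vs] out[of p u'] KU[OF u(1)] KU[OF u(2)] by (auto simp: scale_form_def)
  qed
  \<comment> \<open>The index \<open>u'\<close> stems from the partition inside the integral,
    \<open>u\<close> from splitting \<open>\<alpha>\<close>. Each summand is supported in both
    charts, so it may be moved from the chart of \<open>u'\<close> to that of \<open>u\<close>,
    where the weights of all \<open>u'\<close> add up to 1.\<close>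
  have "form_integral A J (ext_deriv A \<alpha>) = (\<Sum>u'\<in>unity. \<Sum>u\<in>unity. chart_integral A (fst u') (scale_form (snd u') (b u)))"
    unfolding form_integral_unity
  proof (rule sum.cong[OF refl])
    fix u' assume u': "u' \<in> unity"
    have "local_form A (fst u') (scale_form (snd u') (ext_deriv A \<alpha>)) x standard_frame
      = (\<Sum>u\<in>unity. local_form A (fst u') (scale_form (snd u') (b u)) x standard_frame)" for x
      by (simp add: local_form_def scale_form_def d\<alpha> sum_distrib_left)
    then show "chart_integral A (fst u') (scale_form (snd u') (ext_deriv A \<alpha>))
      = (\<Sum>u\<in>unity. chart_integral A (fst u') (scale_form (snd u') (b u)))"
      unfolding chart_integral_def using int(2)[OF _ u'] finite_unity
      by (simp add: integral_sum set_lebesgue_integral_eq_integral(1))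
  qed
  also have "\<dots> = (\<Sum>u\<in>unity. \<Sum>u'\<in>unity. chart_integral A (fst u) (scale_form (snd u') (b u)))"
    by (subst sum.swap) (simp add: swap)
  also have "\<dots> = (\<Sum>u\<in>unity. chart_integral A (fst u) (b u))"
  proof (rule sum.cong[OF refl])
    fix u assume u: "u \<in> unity"
    have "local_form A (fst u) (b u) x standard_frame
      = (\<Sum>u'\<in>unity. local_form A (fst u) (scale_form (snd u') (b u)) x standard_frame)" for x
      by (simp add: local_form_scale sum_unity flip: sum_distrib_right of_real_sum)
    then show "(\<Sum>u'\<in>unity. chart_integral A (fst u) (scale_form (snd u') (b u))) = chart_integral A (fst u) (b u)"
      unfolding chart_integral_def using int(1)[OF u] finite_unity
      by (simp add: integral_sum set_lebesgue_integral_eq_integral(1))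
  qed
  also have "\<dots> = 0"
  proof (rule sum.neutral, rule ballI)
    fix u assume u: "u \<in> unity"
    show "chart_integral A (fst u) (b u) = 0"
      unfolding b_def
      by (rule chart_integral_exact[OF unityD(1)[OF u] sm[OF u] clK KU[OF u]]) (simp add: scale_form_def out)
  qed
  finally show ?thesis .
qed

end

section \<open>Harmonic forms are closed\<close>

lemma nths_Cons_image:
  "nths (e # es) (insert 0 (Suc ` I)) = e # nths es I" "nths (e # es) (Suc ` I) = nths es I"
  by (simp_all add: nths_Cons inj_image_mem_iff)

lemma sum_nths_degree_0:
  fixes F :: "'v list \<Rightarrow> complex"
  assumes "\<And>ws. ws \<noteq> [] \<Longrightarrow> F ws = 0"
  shows "(\<Sum>I\<in>Pow {..<length es}. F (nths es I)) = F []"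
  using assms
proof (induction es arbitrary: F)
  case (Cons e es)
  then show ?case by (simp add: sum_Pow_lessThan_Suc nths_Cons_image del: Pow_iff)
qed simp

lemma sum_nths_degree_1:
  fixes F :: "'v list \<Rightarrow> complex"
  assumes "\<And>ws. length ws \<noteq> 1 \<Longrightarrow> F ws = 0"
  shows "(\<Sum>I\<in>Pow {..<length es}. F (nths es I)) = (\<Sum>v\<leftarrow>es. F [v])"
proof (induction es)
  case Nil then show ?case using assms[of "[]"] by simp
next
  case (Cons e es)
  have "(\<Sum>I\<in>Pow {..<length es}. F (e # nths es I)) = F [e]"
    by (rule sum_nths_degree_0[of "\<lambda>ws. F (e # ws)"]) (use assms in auto)
  then show ?case using Cons by (simp add: sum_Pow_lessThan_Suc nths_Cons_image)
qed

text \<open>\<open>cform_inner\<close> sums over sublists of every length. For 2-forms only pairs in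
  increasing position survive, and the full double sum meets each of them twice.\<close>

lemma sum_nths_degree_2:
  fixes F :: "'v list \<Rightarrow> complex"
  assumes l: "\<And>ws. length ws \<noteq> 2 \<Longrightarrow> F ws = 0" and sym: "\<And>u v. F [u, v] = F [v, u]" and diag: "\<And>u. F [u, u] = 0"
  shows "2 * (\<Sum>I\<in>Pow {..<length es}. F (nths es I)) = (\<Sum>u\<leftarrow>es. \<Sum>v\<leftarrow>es. F [u, v])"
proof (induction es)
  case Nil then show ?case using l[of "[]"] by simp
next
  case (Cons e es)
  have "(\<Sum>I\<in>Pow {..<length es}. F (e # nths es I)) = (\<Sum>v\<leftarrow>es. F [e, v])"
    by (rule sum_nths_degree_1[of "\<lambda>ws. F (e # ws)"]) (use l in auto)
  then have "2 * (\<Sum>I\<in>Pow {..<length (e # es)}. F (nths (e # es) I)) =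
      2 * (\<Sum>v\<leftarrow>es. F [e, v]) + (\<Sum>u\<leftarrow>es. \<Sum>v\<leftarrow>es. F [u, v])"
    using Cons by (simp add: sum_Pow_lessThan_Suc nths_Cons_image algebra_simps)
  also have "\<dots> = (\<Sum>u\<leftarrow>e # es. \<Sum>v\<leftarrow>e # es. F [u, v])"
    using sym[of _ e] by (simp add: diag sum_list_addf)
  finally show ?case .
qed

lemma idx_map: "length es = CARD('d) \<Longrightarrow> map (\<lambda>k. es ! card {j. j < k}) (idx :: 'd::{finite,wellorder} list) = es"
proof (rule nth_equalityI)
  fix l assume "length es = CARD('d)" "l < length (map (\<lambda>k. es ! card {j. j < k}) (idx :: 'd list))"
  then have l: "l < CARD('d)" by simp
  have "card {j. j < (idx ! l :: 'd)} < CARD('d)" by (rule psubset_card_mono) auto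
  then have "card {j. j < (idx ! l :: 'd)} = l"
    using l idx_nth_card[of "idx ! l :: 'd"] nth_eq_iff_index_eq[of "idx :: 'd list" "card {j. j < (idx ! l :: 'd)}" l] by simp
  then show "map (\<lambda>k. es ! card {j. j < k}) (idx :: 'd list) ! l = es ! l" using l by simp
qed simp

lemma sum_list_frame:
  fixes F :: "'v \<Rightarrow> 'b::comm_monoid_add"
  assumes "length es = CARD('d::{finite,wellorder})"
  shows "(\<Sum>v\<leftarrow>es. F v) = (\<Sum>k\<in>(UNIV :: 'd set). F (es ! card {j. j < k}))"
proof -
  have "(\<Sum>v\<leftarrow>es. F v) = (\<Sum>k\<leftarrow>(idx :: 'd list). F (es ! card {j. j < k}))"
    using arg_cong[OF idx_map[OF assms], of "\<lambda>xs. \<Sum>v\<leftarrow>xs. F v"] by (simp add: o_def)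
  then show ?thesis using sum_list_distinct_conv_sum_set[of "idx :: 'd list"] by simp
qed

section \<open>Orthonormal frames and the Gram matrix\<close>

lemma linear_axis_expand:
  fixes L :: "real ^ 'd::finite \<Rightarrow> complex"
  assumes "linear L" shows "L v = (\<Sum>a\<in>UNIV. of_real (v $ a) * L (axis a 1))"
proof -
  have "L v = L (\<Sum>a\<in>UNIV. v $ a *\<^sub>R axis a 1)"
    using basis_expansion[of v] by (simp add: scalar_mult_eq_scaleR)
  then show ?thesis
    using linear_sum[OF assms, of "\<lambda>a. v $ a *\<^sub>R axis a 1" UNIV] linear_cmul[OF assms] by (simp add: scaleR_conv_of_real)
qed

lemma matrix_inv_inverse:
  assumes "invertible (M :: real ^ 'd ^ 'd)" shows "matrix_inv M ** M = mat 1" "M ** matrix_inv M = mat 1"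
  using someI_ex[OF assms[unfolded invertible_def]] unfolding matrix_inv_def by auto

text \<open>The inverse Gram matrix depends continuously on the point, although the orthonormal frame in
  \<open>cform_inner\<close> is chosen separately at each point.\<close>

lemma sum_orthonormal_frame:
  fixes f :: "'d::finite \<Rightarrow> real ^ 'd" and L M :: "real ^ 'd \<Rightarrow> complex"
  assumes h: "bilinear h" and G: "\<And>a b. G $ a $ b = h (axis a 1) (axis b 1)"
    and on: "\<And>k l. h (f k) (f l) = (if k = l then 1 else 0)"
    and lin: "linear L" "linear M"
  shows "(\<Sum>k\<in>UNIV. L (f k) * cnj (M (f k))) = (\<Sum>a\<in>UNIV. \<Sum>b\<in>UNIV. of_real (matrix_inv G $ a $ b) * L (axis a 1) * cnj (M (axis b 1)))"
    "det G \<noteq> 0" "v = (\<Sum>k\<in>UNIV. h (f k) v *\<^sub>R f k)"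
proof -
  \<comment> \<open>The frame as columns of a matrix. Orthonormality reads
    \<open>transpose E ** G ** E = mat 1\<close>, hence \<open>E ** transpose E\<close> is the
    inverse of \<open>G\<close>, in which the frame no longer appears. Read in the other order, the
    same equation expands a vector in the frame.\<close>
  define E :: "real ^ 'd ^ 'd" where "E = (\<chi> a k. f k $ a)"
  have hexp: "h u v = (\<Sum>a\<in>UNIV. \<Sum>b\<in>UNIV. u $ a * (G $ a $ b * v $ b))" for u v
  proof -
    have "h u v = h (\<Sum>a\<in>UNIV. u $ a *\<^sub>R axis a 1) (\<Sum>b\<in>UNIV. v $ b *\<^sub>R axis b 1)"
      using basis_expansion[of u] basis_expansion[of v] by (simp add: scalar_mult_eq_scaleR)
    also have "\<dots> = (\<Sum>a\<in>UNIV. \<Sum>b\<in>UNIV. h (u $ a *\<^sub>R axis a 1) (v $ b *\<^sub>R axis b 1))"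
      unfolding bilinear_sum[OF h] sum.cartesian_product[symmetric] ..
    also have "\<dots> = (\<Sum>a\<in>UNIV. \<Sum>b\<in>UNIV. u $ a * (G $ a $ b * v $ b))"
      by (simp add: bilinear_lmul[OF h] bilinear_rmul[OF h] G mult_ac)
    finally show ?thesis .
  qed
  have "(transpose E ** (G ** E)) $ k $ l = h (f k) (f l)" for k l
    by (simp add: matrix_matrix_mult_def transpose_def E_def hexp sum_distrib_left)
  then have "transpose E ** (G ** E) = mat 1" by (simp add: vec_eq_iff mat_def on)
  then have "(transpose E ** G) ** E = mat 1" by (simp add: matrix_mul_assoc)
  then have "E ** (transpose E ** G) = mat 1" using matrix_left_right_inverse by blast
  then have "E *v ((transpose E ** G) *v v) = v" by (simp add: matrix_vector_mul_assoc)
  moreover have "((transpose E ** G) *v v) $ k = h (f k) v" for k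
    by (simp add: matrix_vector_mult_def matrix_matrix_mult_def transpose_def E_def hexp sum_distrib_right mult.assoc)
      (rule sum.swap)
  ultimately show "v = (\<Sum>k\<in>UNIV. h (f k) v *\<^sub>R f k)"
    by (simp add: vec_eq_iff matrix_vector_mult_def E_def mult.commute)
  have "E ** (transpose E ** G) = mat 1" by fact
  then have EE: "(E ** transpose E) ** G = mat 1" by (simp add: matrix_mul_assoc)
  then have GE: "G ** (E ** transpose E) = mat 1" using matrix_left_right_inverse by blast
  have "invertible G" unfolding invertible_def using EE GE by blast
  then show "det G \<noteq> 0" using invertible_det_nz by blast
  have "matrix_inv G = matrix_inv G ** (G ** (E ** transpose E))" using GE by simp
  also have "\<dots> = E ** transpose E"
    using matrix_inv_inverse(1)[OF \<open>invertible G\<close>] by (simp add: matrix_mul_assoc)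
  finally have H: "matrix_inv G $ a $ b = (\<Sum>k\<in>UNIV. f k $ a * f k $ b)" for a b
    by (simp add: matrix_matrix_mult_def transpose_def E_def)
  have "(\<Sum>k\<in>UNIV. L (f k) * cnj (M (f k)))
    = (\<Sum>k\<in>UNIV. \<Sum>a\<in>UNIV. \<Sum>b\<in>UNIV. of_real (f k $ a * f k $ b) * L (axis a 1) * cnj (M (axis b 1)))"
    by (subst linear_axis_expand[OF lin(1)], subst linear_axis_expand[OF lin(2)])
      (simp add: sum_product mult_ac)
  also have "\<dots> = (\<Sum>a\<in>UNIV. \<Sum>b\<in>UNIV. \<Sum>k\<in>UNIV. of_real (f k $ a * f k $ b) * L (axis a 1) * cnj (M (axis b 1)))"
    by (subst sum.swap) (rule sum.cong[OF refl], rule sum.swap)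
  finally show "(\<Sum>k\<in>UNIV. L (f k) * cnj (M (f k)))
    = (\<Sum>a\<in>UNIV. \<Sum>b\<in>UNIV. of_real (matrix_inv G $ a $ b) * L (axis a 1) * cnj (M (axis b 1)))"
    by (simp add: H sum_distrib_right)
qed

lemma continuous_on_det:
  fixes M :: "'a::topological_space \<Rightarrow> real ^ 'd ^ 'd::finite"
  assumes "\<And>i j. continuous_on S (\<lambda>x. M x $ i $ j)" shows "continuous_on S (\<lambda>x. det (M x))"
  unfolding det_def by (intro continuous_intros assms)

text \<open>Cramer's rule presents each entry as a quotient of two determinants.\<close>

lemma continuous_on_matrix_inv:
  fixes M :: "'a::topological_space \<Rightarrow> real ^ 'd ^ 'd::finite"
  assumes c: "\<And>i j. continuous_on S (\<lambda>x. M x $ i $ j)" and d: "\<And>x. x \<in> S \<Longrightarrow> det (M x) \<noteq> 0"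
  shows "continuous_on S (\<lambda>x. matrix_inv (M x) $ a $ b)"
proof -
  let ?N = "\<lambda>x. \<chi> i j. if j = a then axis b 1 $ i else M x $ i $ j"
  have "matrix_inv (M x) $ a $ b = det (?N x) / det (M x)" if "x \<in> S" for x
  proof -
    have inv: "invertible (M x)" using d[OF that] invertible_det_nz by blast
    have "M x *v (matrix_inv (M x) *v axis b 1) = axis b 1"
      by (simp add: matrix_vector_mul_assoc matrix_inv_inverse(2)[OF inv])
    then have "matrix_inv (M x) *v axis b 1 = (\<chi> k. det (\<chi> i j. if j = k then axis b 1 $ i else M x $ i $ j) / det (M x))"
      using cramer[OF d[OF that]] by blast
    moreover have "(matrix_inv (M x) *v axis b 1) $ a = matrix_inv (M x) $ a $ b"
      by (simp add: matrix_vector_mult_basis column_def)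
    ultimately show ?thesis by simp
  qed
  moreover have "continuous_on S (\<lambda>x. det (?N x) / det (M x))"
  proof (intro continuous_on_divide continuous_on_det)
    show "continuous_on S (\<lambda>x. ?N x $ i $ j)" for i j by (cases "j = a") (simp_all add: c)
  qed (use c d in auto)
  ultimately show ?thesis using continuous_on_cong[of S S] by simp
qed

text \<open>No integrability is assumed: where it fails, both sides are the default value zero.
  Conjugation symmetry and nonnegativity of \<open>L2_inner\<close> thus hold without any regularity
  of the forms.\<close>

lemma integral_of_real_complex: "integral S (\<lambda>x. complex_of_real (r x)) = complex_of_real (integral S r)"
proof (cases "r integrable_on S")
  case True
  then show ?thesis using integral_linear[OF True bounded_linear_of_real] by (simp add: o_def)
next
  case False
  have "\<not> (\<lambda>x. complex_of_real (r x)) integrable_on S"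
  proof
    assume "(\<lambda>x. complex_of_real (r x)) integrable_on S"
    from integrable_linear[OF this bounded_linear_Re] show False using False by (simp add: o_def)
  qed
  then show ?thesis using False by (simp add: not_integrable_integral)
qed

lemma integral_cnj_complex: "integral S (\<lambda>x. cnj (f x)) = cnj (integral S f)"
proof (cases "f integrable_on S")
  case True
  then show ?thesis using integral_linear[OF True bounded_linear_cnj] by (simp add: o_def)
next
  case False
  have "\<not> (\<lambda>x. cnj (f x)) integrable_on S"
  proof
    assume "(\<lambda>x. cnj (f x)) integrable_on S"
    from integrable_linear[OF this bounded_linear_cnj] show False using False by (simp add: o_def)
  qed
  then show ?thesis using False by (simp add: not_integrable_integral)
qed

lemma integral_nonneg_real: "(\<And>x. x \<in> S \<Longrightarrow> 0 \<le> f x) \<Longrightarrow> 0 \<le> integral S (f :: 'a::euclidean_space \<Rightarrow> real)"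
  by (cases "f integrable_on S") (auto simp: not_integrable_integral intro: integral_nonneg)

lemma integral_zero_imp_zero:
  fixes f :: "'a::euclidean_space \<Rightarrow> real"
  assumes S: "open S" and c: "continuous_on S f" and nn: "\<And>x. x \<in> S \<Longrightarrow> 0 \<le> f x"
    and i: "f integrable_on S" "integral S f = 0" and x: "x \<in> S"
  shows "f x = 0"
proof -
  obtain a b where ab: "x \<in> box a b" "cbox a b \<subseteq> S"
    using open_contains_cbox[OF S x] by metis
  have ci: "f integrable_on cbox a b" by (rule integrable_continuous[OF continuous_on_subset[OF c ab(2)]])
  have "integral (cbox a b) f \<le> integral S f"
    by (rule integral_subset_le[OF ab(2) ci i(1)]) (use nn in auto)
  moreover have "0 \<le> integral (cbox a b) f" by (rule integral_nonneg_real) (use nn ab in auto)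
  ultimately have "integral (cbox a b) f = 0" using i(2) by simp
  then have hi: "(f has_integral 0) (cbox a b)" using integrable_integral[OF ci] by simp
  show ?thesis
    by (rule has_integral_0_cbox_imp_0[OF continuous_on_subset[OF c ab(2)] _ hi])
      (use nn ab box_subset_cbox[of a b] in auto)
qed

lemma cform_inner_cnj: "cform_inner h b a = cnj (cform_inner h a b)"
  by (simp add: cform_inner_def Let_def mult.commute)

text \<open>Whatever list the choice operator returns, the value is a sum of squared moduli.\<close>

lemma cform_inner_self: "\<exists>r\<ge>0. cform_inner h a a = complex_of_real r"
proof -
  have "cform_inner h a a =
      complex_of_real (\<Sum>I\<in>Pow {..<CARD('a)}. (norm (a (nths (SOME es. orthonormal_frame h es) I)))\<^sup>2)"
    by (simp only: cform_inner_def Let_def of_real_sum complex_norm_square)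
  then show ?thesis by (intro exI[of _ "\<Sum>I\<in>Pow {..<CARD('a)}. (norm (a (nths (SOME es. orthonormal_frame h es) I)))\<^sup>2"])
    (simp add: sum_nonneg)
qed

section \<open>Continuity and definiteness of the inner product on 2-forms\<close>

context hermitian_manifold
begin

lemma orthonormal_frame_exists: "\<exists>es. orthonormal_frame (g p) es"
proof -
  obtain us where us: "length us = n" "J_orthogonal (J p) (g p) us" "\<forall>u\<in>set us. g p u u = 1"
    using unitary_frame by blast
  have "orthonormal_frame (g p) (J_frame (J p) us)"
    unfolding orthonormal_frame_def
    using J_frame_inner[OF hermitian_inner us(2,3)] us(1) dimension by simp
  then show ?thesis by blast
qed

text \<open>The metric in the format of a form, though symmetric, so that
  \<open>Ck_on_local_form\<close> carries its continuity from charts of \<open>A\<close> to charts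
  of the maximal atlas.\<close>

definition metric_tensor :: "('m, 'd) form" where
  "metric_tensor p vs = (if length vs = 2 then complex_of_real (g p (vs ! 0) (vs ! 1)) else 0)"

lemma bilinear_metric: "bilinear (g p)"
  using hermitian_inner by (simp add: hermitian_inner_def)

lemma multilinear_metric_tensor: "multilinear (metric_tensor p)"
  unfolding multilinear_def
proof (intro allI)
  fix us vs :: "(real, 'd) vec list"
  note b = bilinear_ladd[OF bilinear_metric] bilinear_radd[OF bilinear_metric]
    bilinear_lmul[OF bilinear_metric] bilinear_rmul[OF bilinear_metric]
  consider "length us + length vs \<noteq> 1" | w where "us = []" "vs = [w]" | w where "us = [w]" "vs = []"
    by (cases us; cases vs) (auto simp: length_Suc_conv)
  then show "linear (\<lambda>v. metric_tensor p (us @ v # vs))"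
  proof cases
    case 1 then show ?thesis by (simp add: metric_tensor_def linear_zero)
  next
    case 2 then show ?thesis by (intro linearI) (simp_all add: metric_tensor_def b, simp_all add: scaleR_conv_of_real)
  next
    case 3 then show ?thesis by (intro linearI) (simp_all add: metric_tensor_def b, simp_all add: scaleR_conv_of_real)
  qed
qed

definition gram :: "('m, 'd) chart \<Rightarrow> (real, 'd) vec \<Rightarrow> ((real, 'd) vec, 'd) vec" where
  "gram c x = (\<chi> a b. g (chart_inv c x) (to_tangent A c x (axis a 1)) (to_tangent A c x (axis b 1)))"

lemma continuous_on_gram:
  assumes c: "c \<in> maximal_atlas A" shows "continuous_on (chart_image c) (\<lambda>x. gram c x $ a $ b)"
proof -
  have "Ck_on 0 (chart_image c) (\<lambda>x. local_form A c metric_tensor x [axis a 1, axis b 1])"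
  proof (rule Ck_on_local_form[OF multilinear_metric_tensor _ c])
    fix c vs assume cA: "c \<in> A"
    then have op: "open (chart_image c)" using is_chartD(2)[OF is_chart] atlas_subset_maximal by blast
    show "Ck_on 0 (chart_image c) (\<lambda>x. local_form A c metric_tensor x vs)"
    proof (cases "length vs = 2")
      case True
      have "Ck_on 0 (chart_image c) (\<lambda>x. complex_of_real (g (chart_inv c x) (to_tangent A c x (vs ! 0)) (to_tangent A c x (vs ! 1))))"
        using g cA by (intro Ck_on_bounded_linear[OF op bounded_linear_of_real] Ck_smooth_on) (simp add: hermitian_metric_def)
      then show ?thesis using True by (simp add: local_form_def metric_tensor_def)
    next
      case False
      then show ?thesis by (simp add: local_form_def metric_tensor_def)
    qed
  qed
  then have "continuous_on (chart_image c) (\<lambda>x. Re (local_form A c metric_tensor x [axis a 1, axis b 1]))"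
    by (intro continuous_on_Re) simp
  then show ?thesis by (simp add: local_form_def metric_tensor_def gram_def)
qed

text \<open>Exposes the frame chosen inside \<open>cform_inner\<close>, moved to the coordinates of
  \<open>c\<close> and indexed by \<open>'d\<close> instead of by positions, ready for matrix
  computations.\<close>

lemma cform_inner_frame:
  assumes \<sigma>: "\<And>p. alternating 2 (\<sigma> p)" and c: "c \<in> maximal_atlas A" and x: "x \<in> chart_image c"
  obtains f :: "'d \<Rightarrow> (real, 'd) vec" where
    "\<And>k l. g (chart_inv c x) (to_tangent A c x (f k)) (to_tangent A c x (f l)) = (if k = l then 1 else 0)"
    "2 * cform_inner (g (chart_inv c x)) (\<sigma> (chart_inv c x)) (\<sigma> (chart_inv c x)) =
      (\<Sum>k\<in>UNIV. \<Sum>l\<in>UNIV. local_form A c \<sigma> x [f k, f l] * cnj (local_form A c \<sigma> x [f k, f l]))"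
proof -
  let ?p = "chart_inv c x" let ?\<tau> = "to_tangent A c x"
  define es where "es = (SOME es. orthonormal_frame (g ?p) es)"
  have es: "orthonormal_frame (g ?p) es" unfolding es_def using someI_ex[OF orthonormal_frame_exists] .
  then have len: "length es = CARD('d)" by (simp add: orthonormal_frame_def)
  define f where "f k = of_tangent A c x (es ! card {j. j < k})" for k :: 'd
  have \<tau>f: "?\<tau> (f k) = es ! card {j. j < k}" for k by (simp add: f_def to_of_tangent[OF c x])
  have pos: "card {j. j < (k :: 'd)} < CARD('d)" for k by (rule psubset_card_mono) auto
  have pos_eq: "card {j. j < k} = card {j. j < l} \<longleftrightarrow> k = l" for k l :: 'd
    using idx_nth_card[of k] idx_nth_card[of l] by metis
  have on: "g ?p (?\<tau> (f k)) (?\<tau> (f l)) = (if k = l then 1 else 0)" for k l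
    using es pos[of k] pos[of l] pos_eq[of k l] by (simp add: \<tau>f orthonormal_frame_def)
  define F where "F ws = \<sigma> ?p ws * cnj (\<sigma> ?p ws)" for ws
  have F1: "F ws = 0" if "length ws \<noteq> 2" for ws using alternating_length[OF \<sigma> that] by (simp add: F_def)
  have F2: "F [u, v] = F [v, u]" for u v using alternating_swap_head[OF \<sigma>[of ?p], of u v "[]"] by (simp add: F_def)
  have F3: "F [u, u] = 0" for u using alternating_head_eq[OF \<sigma>[of ?p], of u "[]"] by (simp add: F_def)
  have "2 * cform_inner (g ?p) (\<sigma> ?p) (\<sigma> ?p) = 2 * (\<Sum>I\<in>Pow {..<length es}. F (nths es I))"
    by (simp add: cform_inner_def Let_def es_def[symmetric] F_def len)
  also have "\<dots> = (\<Sum>u\<leftarrow>es. \<Sum>v\<leftarrow>es. F [u, v])" by (rule sum_nths_degree_2[where F=F, OF F1 F2 F3])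
  also have "\<dots> = (\<Sum>k\<in>UNIV. \<Sum>l\<in>UNIV. F [?\<tau> (f k), ?\<tau> (f l)])"
    unfolding sum_list_frame[OF len] \<tau>f ..
  finally show ?thesis using that[OF on] by (simp add: F_def local_form_def)
qed

lemma bilinear_local_metric:
  assumes "c \<in> maximal_atlas A" "x \<in> chart_image c"
  shows "bilinear (\<lambda>u v. g (chart_inv c x) (to_tangent A c x u) (to_tangent A c x v))"
  using bilinear_metric[of "chart_inv c x"] linear_compose[OF linear_to_tangent[OF assms]]
  unfolding bilinear_def by (auto simp: o_def)

lemma linear_two_form:
  assumes "alternating 2 T" shows "linear (\<lambda>u. T [u, v])" "linear (\<lambda>v. T [u, v])"
  using alternating_linear_head[OF assms] alternating_linear[OF assms, of "[u, undefined]" 1] by simp_all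

text \<open>Applying \<open>sum_orthonormal_frame\<close> once in each argument of the 2-form
  replaces both occurrences of the frame by the inverse Gram matrix; what is left depends
  continuously on \<open>x\<close>.\<close>

lemma cform_inner_gram:
  assumes \<sigma>: "\<And>p. alternating 2 (\<sigma> p)" and c: "c \<in> maximal_atlas A" and x: "x \<in> chart_image c"
  defines "s a b \<equiv> local_form A c \<sigma> x [axis a 1, axis b 1]"
  shows "cform_inner (g (chart_inv c x)) (\<sigma> (chart_inv c x)) (\<sigma> (chart_inv c x)) =
    (1 / 2) * (\<Sum>b\<in>UNIV. \<Sum>d\<in>UNIV. of_real (matrix_inv (gram c x) $ b $ d) *
      (\<Sum>a\<in>UNIV. \<Sum>e\<in>UNIV. of_real (matrix_inv (gram c x) $ a $ e) * s a b * cnj (s e d)))"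
    "det (gram c x) \<noteq> 0"
proof -
  let ?p = "chart_inv c x" let ?H = "matrix_inv (gram c x)"
  define S where "S u v = local_form A c \<sigma> x [u, v]" for u v
  obtain f :: "'d \<Rightarrow> (real, 'd) vec" where on: "\<And>k l. g ?p (to_tangent A c x (f k)) (to_tangent A c x (f l)) = (if k = l then 1 else 0)"
    and eq: "2 * cform_inner (g ?p) (\<sigma> ?p) (\<sigma> ?p) = (\<Sum>k\<in>UNIV. \<Sum>l\<in>UNIV. S (f k) (f l) * cnj (S (f k) (f l)))"
    unfolding S_def by (rule cform_inner_frame[where \<sigma>=\<sigma>, OF \<sigma> c x]) blast
  note h = bilinear_local_metric[OF c x]
  have G: "gram c x $ a $ b = g ?p (to_tangent A c x (axis a 1)) (to_tangent A c x (axis b 1))" for a b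
    by (simp add: gram_def)
  have lin1: "linear (\<lambda>u. S u v)" and lin2: "linear (\<lambda>v. S u v)" for u v
    unfolding S_def by (rule linear_two_form[OF local_form_alternating[OF c x \<sigma>]])+
  note eq
  also have "(\<Sum>k\<in>UNIV. \<Sum>l\<in>UNIV. S (f k) (f l) * cnj (S (f k) (f l)))
     = (\<Sum>k\<in>UNIV. \<Sum>b\<in>UNIV. \<Sum>d\<in>UNIV. of_real (?H $ b $ d) * (S (f k) (axis b 1) * cnj (S (f k) (axis d 1))))"
    by (simp add: sum_orthonormal_frame(1)[OF h G on lin2 lin2] mult.assoc)
  also have "\<dots> = (\<Sum>b\<in>UNIV. \<Sum>d\<in>UNIV. \<Sum>k\<in>UNIV. of_real (?H $ b $ d) * (S (f k) (axis b 1) * cnj (S (f k) (axis d 1))))"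
    by (subst sum.swap) (rule sum.cong[OF refl], rule sum.swap)
  also have "\<dots> = (\<Sum>b\<in>UNIV. \<Sum>d\<in>UNIV. of_real (?H $ b $ d) * (\<Sum>k\<in>UNIV. S (f k) (axis b 1) * cnj (S (f k) (axis d 1))))"
    by (simp add: sum_distrib_left)
  also have "\<dots> = (\<Sum>b\<in>UNIV. \<Sum>d\<in>UNIV. of_real (?H $ b $ d) *
      (\<Sum>a\<in>UNIV. \<Sum>e\<in>UNIV. of_real (?H $ a $ e) * s a b * cnj (s e d)))"
    by (simp add: sum_orthonormal_frame(1)[OF h G on lin1 lin1]) (simp add: s_def S_def)
  finally have "2 * cform_inner (g ?p) (\<sigma> ?p) (\<sigma> ?p) = (\<Sum>b\<in>UNIV. \<Sum>d\<in>UNIV. of_real (?H $ b $ d) *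
      (\<Sum>a\<in>UNIV. \<Sum>e\<in>UNIV. of_real (?H $ a $ e) * s a b * cnj (s e d)))" .
  moreover have "x = (1 / 2) * y" if "2 * x = y" for x y :: complex using that by auto
  ultimately show "cform_inner (g ?p) (\<sigma> ?p) (\<sigma> ?p) =
    (1 / 2) * (\<Sum>b\<in>UNIV. \<Sum>d\<in>UNIV. of_real (?H $ b $ d) *
      (\<Sum>a\<in>UNIV. \<Sum>e\<in>UNIV. of_real (?H $ a $ e) * s a b * cnj (s e d)))" by blast
  show "det (gram c x) \<noteq> 0" by (rule sum_orthonormal_frame(2)[OF h G on lin1 lin1])
qed

lemma continuous_on_cform_inner:
  assumes \<sigma>: "smooth_form A 2 \<sigma>" and c: "c \<in> maximal_atlas A"
  shows "continuous_on (chart_image c) (\<lambda>x. cform_inner (g (chart_inv c x)) (\<sigma> (chart_inv c x)) (\<sigma> (chart_inv c x)))"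
proof -
  have alt: "alternating 2 (\<sigma> p)" for p by (rule smooth_form_alternating[OF \<sigma>])
  let ?s = "\<lambda>x a b. local_form A c \<sigma> x [axis a 1, axis b 1]"
  let ?H = "\<lambda>x. matrix_inv (gram c x)"
  have cs: "continuous_on (chart_image c) (\<lambda>x. ?s x a b)" for a b
    by (rule Ck_on_continuous[OF smooth_form_maximal[OF \<sigma> c, where l=0]])
  have cH: "continuous_on (chart_image c) (\<lambda>x. ?H x $ a $ b)" for a b
    by (rule continuous_on_matrix_inv[OF continuous_on_gram[OF c] cform_inner_gram(2)[of \<sigma>, OF alt c]])
  have "continuous_on (chart_image c) (\<lambda>x. (1 / 2) * (\<Sum>b\<in>UNIV. \<Sum>d\<in>UNIV. of_real (?H x $ b $ d) *
      (\<Sum>a\<in>UNIV. \<Sum>e\<in>UNIV. of_real (?H x $ a $ e) * ?s x a b * cnj (?s x e d))))"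
    by (intro continuous_intros cs cH)
  then show ?thesis by (subst continuous_on_cong[OF refl cform_inner_gram(1)[of \<sigma>, OF alt c]])
qed

lemma cform_inner_self_zero:
  assumes \<sigma>: "\<And>p. alternating 2 (\<sigma> p)" and z: "cform_inner (g p) (\<sigma> p) (\<sigma> p) = 0"
  shows "\<sigma> p vs = 0"
proof (cases "length vs = 2")
  case True
  then obtain u v where vs: "vs = [u, v]" by (metis (no_types, lifting) One_nat_def Suc_1 length_0_conv length_Suc_conv)
  \<comment> \<open>In the preferred chart \<open>to_tangent\<close> is the identity at
    \<open>p\<close>, so the coordinate frame is a frame of the tangent space itself.\<close>
  let ?c = "chart_at A p" let ?x = "snd ?c p"
  note c = chart_at_maximal[of p] chart_at_image[of p]
  have p: "chart_inv ?c ?x = p" using is_chartD(5)[OF is_chart[OF chart_at_maximal] chart_at(2)] .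
  have id: "to_tangent A ?c ?x w = w" for w by (rule to_tangent_chart_at)
  obtain f :: "'d \<Rightarrow> (real, 'd) vec" where on: "\<And>k l. g p (f k) (f l) = (if k = l then 1 else 0)"
    and eq: "2 * cform_inner (g p) (\<sigma> p) (\<sigma> p) = (\<Sum>k\<in>UNIV. \<Sum>l\<in>UNIV. \<sigma> p [f k, f l] * cnj (\<sigma> p [f k, f l]))"
    by (rule cform_inner_frame[where \<sigma>=\<sigma>, OF \<sigma> c, unfolded p id local_form_chart_at]) blast
  have "(\<Sum>k\<in>UNIV. \<Sum>l\<in>UNIV. complex_of_real ((norm (\<sigma> p [f k, f l]))\<^sup>2)) = 0"
    using eq z by (simp only: complex_norm_square) simp
  then have "complex_of_real (\<Sum>k\<in>UNIV. \<Sum>l\<in>UNIV. (norm (\<sigma> p [f k, f l]))\<^sup>2) = 0" by simp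
  then have "(\<Sum>k\<in>UNIV. \<Sum>l\<in>UNIV. (norm (\<sigma> p [f k, f l]))\<^sup>2) = 0" by (simp only: of_real_eq_0_iff)
  then have zero: "\<sigma> p [f k, f l] = 0" for k l
    by (simp add: sum_nonneg_eq_0_iff sum_nonneg)
  note lin = linear_two_form[OF \<sigma>[of p]]
  have G: "(\<chi> a b. g p (axis a 1) (axis b 1)) $ a $ b = g p (axis a 1) (axis b 1)" for a b :: 'd by simp
  have ex: "w = (\<Sum>k\<in>UNIV. g p (f k) w *\<^sub>R f k)" for w
    by (rule sum_orthonormal_frame(3)[OF bilinear_metric G on lin(1) lin(1)])
  have "\<sigma> p [f k, v] = 0" for k
    using arg_cong[OF ex[of v], of "\<lambda>w. \<sigma> p [f k, w]"]
      linear_sum[OF lin(2)[of "f k"], of "\<lambda>l. g p (f l) v *\<^sub>R f l" UNIV] linear_cmul[OF lin(2)] by (simp add: zero)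
  then show ?thesis
    using arg_cong[OF ex[of u], of "\<lambda>w. \<sigma> p [w, v]"]
      linear_sum[OF lin(1)[of v], of "\<lambda>l. g p (f l) u *\<^sub>R f l" UNIV] linear_cmul[OF lin(1)] by (simp add: vs)
next
  case False then show ?thesis using alternating_length[OF \<sigma>] by blast
qed

subsection \<open>The inner product of forms\<close>

definition pairing :: "('m, 'd) form \<Rightarrow> ('m, 'd) form \<Rightarrow> ('m, 'd) form" where
  "pairing \<alpha> \<beta> = (\<lambda>p vs. cform_inner (g p) (\<alpha> p) (\<beta> p) * (volume p vs / fact n))"

lemma L2_inner_pairing: "L2_inner A J g \<alpha> \<beta> = form_integral A J (pairing \<alpha> \<beta>)"
  using dimension by (simp add: L2_inner_def pairing_def volume_def Let_def)

lemma local_pairing: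
  assumes "c \<in> maximal_atlas A" "x \<in> chart_image c"
  shows "local_form A c (scale_form \<rho> (pairing \<alpha> \<beta>)) x standard_frame =
    complex_of_real (\<rho> (chart_inv c x) * density c x / fact n) * cform_inner (g (chart_inv c x)) (\<alpha> (chart_inv c x)) (\<beta> (chart_inv c x))"
  using local_volume[OF assms] by (simp add: local_form_def scale_form_def pairing_def)

lemma chart_integral_pairing:
  assumes "c \<in> maximal_atlas A"
  shows "chart_integral A c (scale_form \<rho> (pairing \<alpha> \<beta>)) = integral (chart_image c)
    (\<lambda>x. complex_of_real (\<rho> (chart_inv c x) * density c x / fact n) * cform_inner (g (chart_inv c x)) (\<alpha> (chart_inv c x)) (\<beta> (chart_inv c x)))"
  unfolding chart_integral_def by (rule integral_cong) (rule local_pairing[OF assms])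

lemma L2_inner_cnj: "L2_inner A J g \<beta> \<alpha> = cnj (L2_inner A J g \<alpha> \<beta>)"
  unfolding L2_inner_pairing form_integral_unity cnj_sum
proof (rule sum.cong[OF refl])
  fix u assume u: "u \<in> unity"
  show "chart_integral A (fst u) (scale_form (snd u) (pairing \<beta> \<alpha>)) = cnj (chart_integral A (fst u) (scale_form (snd u) (pairing \<alpha> \<beta>)))"
    unfolding chart_integral_pairing[OF unityD(1)[OF u]] integral_cnj_complex[symmetric]
    by (simp add: cform_inner_cnj[of _ "\<beta> _" "\<alpha> _"])
qed

lemma L2_inner_minus: "L2_inner A J g (\<lambda>p vs. - \<alpha> p vs) \<beta> = - L2_inner A J g \<alpha> \<beta>"
  unfolding L2_inner_pairing form_integral_unity sum_negf[symmetric]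
proof (rule sum.cong[OF refl])
  fix u assume u: "u \<in> unity"
  have "cform_inner h (\<lambda>vs. - a vs) b = - cform_inner h a b" for h and a b :: "(real, 'd) vec cform"
    by (simp add: cform_inner_def Let_def sum_negf)
  then show "chart_integral A (fst u) (scale_form (snd u) (pairing (\<lambda>p vs. - \<alpha> p vs) \<beta>)) = - chart_integral A (fst u) (scale_form (snd u) (pairing \<alpha> \<beta>))"
    unfolding chart_integral_pairing[OF unityD(1)[OF u]] by simp
qed

lemma pairing_weight_nonneg:
  assumes "u \<in> unity" "x \<in> chart_image (fst u)"
  shows "0 \<le> snd u (chart_inv (fst u) x) * density (fst u) x / fact n"
  using unityD[OF assms(1)] positive_chart_iff[OF unityD(1)[OF assms(1)]] assms(2) by (simp add: less_imp_le)

lemma cform_inner_self_Re: "cform_inner h a a = complex_of_real (Re (cform_inner h a a))" "0 \<le> Re (cform_inner h a a)"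
  using cform_inner_self[of h a] by auto

definition pairing_density :: "('m, 'd) chart \<times> ('m \<Rightarrow> real) \<Rightarrow> ('m, 'd) form \<Rightarrow> (real, 'd) vec \<Rightarrow> real" where
  "pairing_density u \<alpha> x = snd u (chart_inv (fst u) x) * density (fst u) x / fact n *
    Re (cform_inner (g (chart_inv (fst u) x)) (\<alpha> (chart_inv (fst u) x)) (\<alpha> (chart_inv (fst u) x)))"

lemma pairing_density_nonneg:
  "u \<in> unity \<Longrightarrow> x \<in> chart_image (fst u) \<Longrightarrow> 0 \<le> pairing_density u \<alpha> x"
  unfolding pairing_density_def by (intro mult_nonneg_nonneg pairing_weight_nonneg cform_inner_self_Re(2))

lemma chart_integral_pairing_self:
  assumes u: "u \<in> unity"
  shows "chart_integral A (fst u) (scale_form (snd u) (pairing \<alpha> \<alpha>)) =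
    complex_of_real (integral (chart_image (fst u)) (pairing_density u \<alpha>))"
  unfolding chart_integral_pairing[OF unityD(1)[OF u]] integral_of_real_complex[symmetric] pairing_density_def
  by (rule integral_cong) (subst cform_inner_self_Re(1), simp)

lemma L2_inner_self_sum:
  "L2_inner A J g \<alpha> \<alpha> = complex_of_real (\<Sum>u\<in>unity. integral (chart_image (fst u)) (pairing_density u \<alpha>))"
  unfolding L2_inner_pairing form_integral_unity by (simp add: chart_integral_pairing_self)

lemma pairing_density_integral_nonneg:
  "u \<in> unity \<Longrightarrow> 0 \<le> integral (chart_image (fst u)) (pairing_density u \<alpha>)"
  by (intro integral_nonneg_real pairing_density_nonneg)

lemma L2_inner_self: "\<exists>r\<ge>0. L2_inner A J g \<alpha> \<alpha> = complex_of_real r"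
  unfolding L2_inner_self_sum
  by (intro exI[of _ "\<Sum>u\<in>unity. integral (chart_image (fst u)) (pairing_density u \<alpha>)"] conjI refl
      sum_nonneg pairing_density_integral_nonneg)

text \<open>The product is a finite sum of nonnegative integrals, so each of them is zero. Some
  function of the partition is nonzero at \<open>p\<close>; in its chart the integrand is continuous
  and nonnegative, hence zero at \<open>p\<close>, and the positive density can be divided
  out.\<close>

lemma L2_inner_self_zero:
  assumes \<sigma>: "smooth_form A 2 \<sigma>" and z: "L2_inner A J g \<sigma> \<sigma> = 0"
  shows "\<sigma> p vs = 0"
proof -
  let ?f = "\<lambda>u. pairing_density u \<sigma>"
  have alt: "alternating 2 (\<sigma> p)" for p by (rule smooth_form_alternating[OF \<sigma>])
  have "(\<Sum>u\<in>unity. integral (chart_image (fst u)) (?f u)) = 0" (is "sum ?I unity = 0")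
    using z unfolding L2_inner_self_sum by (simp only: of_real_eq_0_iff)
  then have int0: "integral (chart_image (fst u)) (?f u) = 0" if "u \<in> unity" for u
    using iffD1[OF sum_nonneg_eq_0_iff[OF finite_unity, of ?I, OF pairing_density_integral_nonneg]] that by blast
  obtain u where u: "u \<in> unity" "snd u p \<noteq> 0"
    using sum_unity[of p] by (metis sum.neutral zero_neq_one)
  let ?c = "fst u"
  note c = unityD(1)[OF u(1)]
  have pU: "p \<in> fst ?c" using unity_outside[of p u] u(2) unityD(5)[OF u(1)] by blast
  define x where "x = snd ?c p"
  have x: "x \<in> chart_image ?c" "chart_inv ?c x = p"
    using is_chartD(5,6)[OF is_chart[OF c] pU] by (simp_all add: x_def)
  have cont: "continuous_on (chart_image ?c) (?f u)"
  proof -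
    have "continuous_on (chart_image ?c) (\<lambda>x. Re (complex_of_real (snd u (chart_inv ?c x))))"
      by (intro continuous_on_Re continuous_on_function[OF unityD(3)[OF u(1)] c])
    then have r: "continuous_on (chart_image ?c) (\<lambda>x. snd u (chart_inv ?c x))" by simp
    show ?thesis unfolding pairing_density_def[abs_def]
      by (intro continuous_on_mult continuous_on_divide continuous_on_const continuous_on_Re r continuous_on_density[OF c]
          continuous_on_cform_inner[OF \<sigma> c]) auto
  qed
  have cl: "closed (closure {p. snd u p \<noteq> 0})" by simp
  have "?f u absolutely_integrable_on chart_image ?c"
  proof (rule absolutely_integrable_compact_support[OF cont compact_coordinate_image[OF c cl unityD(5)[OF u(1)]]])
    fix y assume y: "y \<in> chart_image ?c" "y \<notin> snd ?c ` closure {p. snd u p \<noteq> 0}"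
    then have "chart_inv ?c y \<notin> closure {p. snd u p \<noteq> 0}"
      using is_chartD(8)[OF is_chart[OF c] y(1)] by (metis image_eqI)
    from unity_outside[OF this] show "?f u y = 0" by (simp add: pairing_density_def)
  qed
  then have int: "?f u integrable_on chart_image ?c" by (rule set_lebesgue_integral_eq_integral(1))
  have "?f u x = 0"
    by (rule integral_zero_imp_zero[OF is_chartD(2)[OF is_chart[OF c]] cont pairing_density_nonneg[OF u(1)] int int0[OF u(1)] x(1)])
  moreover have "density ?c x \<noteq> 0" by (rule density_nonzero[OF c x(1)])
  ultimately have "Re (cform_inner (g p) (\<sigma> p) (\<sigma> p)) = 0" using u(2) by (simp add: x(2) pairing_density_def)
  then have "cform_inner (g p) (\<sigma> p) (\<sigma> p) = 0" using cform_inner_self_Re(1)[of "g p" "\<sigma> p"] by simp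
  then show ?thesis using cform_inner_self_zero[of \<sigma>, OF alt] by blast
qed

text \<open>If \<open>\<gamma>\<close> and \<open>\<delta>\<close> are the adjoints in the definition of a harmonic form, then
  \<open>\<langle>\<sigma>, \<sigma>\<rangle> = \<langle>\<eta>, \<delta>\<rangle>\<close> for the derivative \<open>\<sigma>\<close> of \<open>\<eta>\<close>, and \<open>\<langle>\<delta>, \<eta>\<rangle> = - \<langle>\<gamma>, \<gamma>\<rangle>\<close>.\<close>

lemma harmonic_delbar_closed:
  assumes "\<eta> \<in> delbar_harmonic A J g 0 1" shows "delbar A J 0 1 \<eta> p vs = 0"
proof -
  obtain \<gamma> \<delta> where \<eta>: "\<eta> \<in> forms_pq A J 0 1" and adj: "is_delbar_adjoint A J g 0 0 \<eta> \<gamma>"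
    "is_delbar_adjoint A J g 0 1 (delbar A J 0 1 \<eta>) \<delta>"
    and sum: "(\<lambda>x vs. delbar A J 0 0 \<gamma> x vs + \<delta> x vs) = zero_form"
    using assms by (auto simp: delbar_harmonic_def)
  let ?\<sigma> = "delbar A J 0 1 \<eta>"
  \<comment> \<open>The adjoint relation already contains that \<open>?\<sigma>\<close> is a smooth
    form of type (0, 2), so the regularity of \<open>component\<close> need not be examined.\<close>
  have "smooth_form A (nat (0 + (1 + 1))) ?\<sigma>"
    using adj(2) unfolding is_delbar_adjoint_def forms_pq_def by blast
  then have \<sigma>: "smooth_form A 2 ?\<sigma>" by simp
  have \<delta>: "\<delta> = (\<lambda>p vs. - delbar A J 0 0 \<gamma> p vs)"
    using sum by (simp add: zero_form_def fun_eq_iff eq_neg_iff_add_eq_0 add.commute)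
  have "L2_inner A J g ?\<sigma> ?\<sigma> = L2_inner A J g \<eta> \<delta>"
    using adj(2) \<eta> by (simp add: is_delbar_adjoint_def)
  also have "\<dots> = cnj (L2_inner A J g \<delta> \<eta>)" by (rule L2_inner_cnj)
  also have "L2_inner A J g \<delta> \<eta> = - L2_inner A J g (delbar A J 0 0 \<gamma>) \<eta>"
    unfolding \<delta> by (rule L2_inner_minus)
  also have "L2_inner A J g (delbar A J 0 0 \<gamma>) \<eta> = L2_inner A J g \<gamma> \<gamma>"
    using adj(1) by (simp add: is_delbar_adjoint_def)
  finally have eq: "L2_inner A J g ?\<sigma> ?\<sigma> = - cnj (L2_inner A J g \<gamma> \<gamma>)" by simp
  obtain r r' where "r \<ge> 0" "L2_inner A J g ?\<sigma> ?\<sigma> = complex_of_real r" "r' \<ge> 0" "L2_inner A J g \<gamma> \<gamma> = complex_of_real r'"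
    using L2_inner_self by metis
  \<comment> \<open>A nonnegative number equals minus another nonnegative number, so both are
    zero.\<close>
  moreover from this eq have "complex_of_real r = complex_of_real (- r')" by simp
  then have "r = - r'" by (simp only: of_real_eq_iff)
  ultimately have "L2_inner A J g ?\<sigma> ?\<sigma> = 0" by simp
  then show ?thesis by (rule L2_inner_self_zero[OF \<sigma>])
qed

end

context atlas
begin

lemma smooth_form_diff:
  assumes "smooth_form A k \<alpha>" "smooth_form A k \<beta>" shows "smooth_form A k (\<lambda>p vs. \<alpha> p vs - \<beta> p vs)"
  unfolding smooth_form_def
proof (intro conjI allI ballI)
  show "alternating k (\<lambda>vs. \<alpha> p vs - \<beta> p vs)" for p
    using alternating_add[OF smooth_form_alternating[OF assms(1)] alternating_minus[OF smooth_form_alternating[OF assms(2)]]] by simp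
next
  fix c vs assume "c \<in> A"
  then have c: "c \<in> maximal_atlas A" using atlas_subset_maximal by blast
  have op: "open (chart_image c)" by (rule is_chartD(2)[OF is_chart[OF c]])
  have "Ck_on l (chart_image c) (\<lambda>x. local_form A c \<alpha> x vs + - local_form A c \<beta> x vs)" for l
    by (intro Ck_on_add[OF op] smooth_form_maximal[OF assms(1) c]
        Ck_on_bounded_linear[OF op bounded_linear_minus[OF bounded_linear_ident]] smooth_form_maximal[OF assms(2) c])
  then show "smooth_on (chart_image c) (\<lambda>x. local_form A c (\<lambda>p vs. \<alpha> p vs - \<beta> p vs) x vs)"
    by (simp add: smooth_on_def local_form_def)
qed

lemma ext_deriv_diff:
  assumes "smooth_form A k \<alpha>" "smooth_form A k \<beta>"
  shows "ext_deriv A (\<lambda>p vs. \<alpha> p vs - \<beta> p vs) p vs = ext_deriv A \<alpha> p vs - ext_deriv A \<beta> p vs"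
proof -
  let ?c = "chart_at A p" let ?x = "snd ?c p"
  note fd = form_differentiable_local_form[OF assms(1) chart_at_maximal chart_at_image, of p]
    form_differentiable_local_form[OF assms(2) chart_at_maximal chart_at_image, of p]
  have fm: "form_differentiable (\<lambda>y vs. - local_form A ?c \<beta> y vs) ?x"
    using fd(2) by (simp add: form_differentiable_def)
  have "local_form A ?c (\<lambda>p vs. \<alpha> p vs - \<beta> p vs) = (\<lambda>y vs. local_form A ?c \<alpha> y vs + - local_form A ?c \<beta> y vs)"
    by (simp add: local_form_def fun_eq_iff)
  then show ?thesis
    unfolding ext_deriv_def Let_def by (simp only: local_ext_deriv_add[OF fd(1) fm] local_ext_deriv_minus[OF fd(2)]) simp
qed

end

section \<open>The integrand is exact\<close>

context hermitian_manifold
begin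

lemma J_props: "linear (J p)" "J p (J p v) = - v"
  using hermitian_inner[of p] by (auto simp: hermitian_inner_def)

lemma bidegree_fundamental_power: "smooth_form A (2 * m) (form_power \<omega> m)" "alternating (2 * m) (form_power \<omega> m p)"
  "weight (J p) 0 (form_power \<omega> m p)"
proof -
  show *: "smooth_form A (2 * m) (form_power \<omega> m)" using smooth_form_power[OF smooth_fundamental_form, of m] by (simp add: mult.commute)
  show "alternating (2 * m) (form_power \<omega> m p)" by (rule smooth_form_alternating[OF *])
  show "weight (J p) 0 (form_power \<omega> m p)"
    using weight_fundamental_power[OF hermitian_inner[of p]] by (simp add: form_power_def fundamental_form_eq)
qed

text \<open>Multiplied by \<open>b\<close>, the part of \<open>a\<close> of bidegree
  \<open>(s, k - s)\<close> gives a top form of weight \<open>2 * s - k + w\<close>, which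
  \<open>top_form_weight\<close> annihilates unless \<open>s = r\<close>. Only the weight of
  \<open>b\<close> matters, not its type.\<close>

lemma top_wedge_component:
  assumes a: "alternating k (a :: (real, 'd) vec cform)" and b: "alternating l b" "weight (J p) w b" "k + l = CARD('d)"
    and r: "2 * r - int k + w = 0" "0 \<le> r" "r \<le> int k"
  shows "wedge a b = wedge (component (J p) r (int k - r) a) b" "wedge b a = wedge b (component (J p) r (int k - r) a)"
proof -
  obtain D where D: "bidegree_parts (J p) k a D"
    and c: "\<And>s t. 0 \<le> s \<Longrightarrow> 0 \<le> t \<Longrightarrow> s + t = int k \<Longrightarrow> component (J p) s t a = D s"
    using component_parts[OF J_props a] by metis
  have Da: "alternating k (D s)" "weight (J p) (2 * s - int k) (D s)" if "s \<in> {0..int k}" for s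
  proof -
    have Ds: "bidegree (J p) s (int k - s) (D s)" using D that by (simp add: bidegree_parts_def)
    show "alternating k (D s)" using bidegree_alternating[OF Ds] by simp
    have "s - (int k - s) = 2 * s - int k" by simp
    then show "weight (J p) (2 * s - int k) (D s)" using bidegree_weight[OF Ds] by metis
  qed
  have z: "wedge (D s) b = (\<lambda>vs. 0)" "wedge b (D s) = (\<lambda>vs. 0)" if s: "s \<in> {0..int k}" "s \<noteq> r" for s
  proof -
    have w0: "2 * s - int k + w \<noteq> 0" "w + (2 * s - int k) \<noteq> 0" using r s by auto
    have "alternating CARD('d) (wedge (D s) b)" "alternating CARD('d) (wedge b (D s))"
      using alternating_wedge[OF Da(1)[OF s(1)] b(1)] alternating_wedge[OF b(1) Da(1)[OF s(1)]] b(3) by (simp_all add: add.commute)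
    then show "wedge (D s) b = (\<lambda>vs. 0)" "wedge b (D s) = (\<lambda>vs. 0)"
      using top_form_weight[OF _ weight_wedge[OF Da(2)[OF s(1)] b(2)] w0(1) J_props(1)]
        top_form_weight[OF _ weight_wedge[OF b(2) Da(2)[OF s(1)]] w0(2) J_props(1)] by blast+
  qed
  have rk: "r \<in> {0..int k}" using r by simp
  have cr: "component (J p) r (int k - r) a = D r" using c r by simp
  have "wedge a b vs = wedge (D r) b vs" "wedge b a vs = wedge b (D r) vs" for vs
  proof -
    have sum: "(\<Sum>s\<in>{0..int k}. F s) = F r" if "\<And>s. s \<in> {0..int k} \<Longrightarrow> s \<noteq> r \<Longrightarrow> F s = 0" for F :: "int \<Rightarrow> complex"
    proof -
      have "(\<Sum>s\<in>{0..int k}. F s) = (\<Sum>s\<in>{0..int k}. if s = r then F r else 0)" by (rule sum.cong) (use that in auto)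
      then show ?thesis using rk by simp
    qed
    have a_eq: "a = (\<lambda>vs. \<Sum>s\<in>{0..int k}. D s vs)" using D by (simp add: bidegree_parts_def)
    show "wedge a b vs = wedge (D r) b vs"
      by (subst a_eq, subst wedge_sum_left, rule sum) (use z in auto)
    show "wedge b a vs = wedge b (D r) vs"
      by (subst a_eq, subst wedge_sum_right, rule sum) (use z in auto)
  qed
  then show "wedge a b = wedge (component (J p) r (int k - r) a) b" "wedge b a = wedge b (component (J p) r (int k - r) a)"
    unfolding cr by auto
qed

lemma integral_del_harmonic:
  assumes \<nu>: "\<nu> \<in> forms_pq A J (int n) (int n - 2)"
    and eq: "del A J (int n - 1) (int n - 1) (form_power \<omega> (n - 1)) = delbar A J (int n) (int n - 2) \<nu>"
    and \<eta>: "\<eta> \<in> delbar_harmonic A J g 0 1"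
  shows "form_integral A J (form_wedge (del A J 0 1 \<eta>) (form_power \<omega> (n - 1))) = 0"
proof -
  let ?W = "form_power \<omega> (n - 1)"
  have n1: "n \<ge> 1" using dim_positive by simp
  have \<eta>01: "\<eta> \<in> forms_pq A J 0 1" using \<eta> by (simp add: delbar_harmonic_def)
  have s\<eta>: "smooth_form A 1 \<eta>" and b\<eta>: "bidegree (J p) 0 1 (\<eta> p)" for p
    using \<eta>01 by (auto simp: forms_pq_def)
  have a\<eta>: "alternating 1 (\<eta> p)" for p by (rule smooth_form_alternating[OF s\<eta>])
  have w\<eta>: "weight (J p) (- 1) (\<eta> p)" for p using bidegree_weight[OF b\<eta>] by simp
  note sW = bidegree_fundamental_power(1)[of "n - 1"] and aW = bidegree_fundamental_power(2)[of "n - 1"]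
    and wW = bidegree_fundamental_power(3)[of _ "n - 1"]
  have ad\<eta>: "alternating 2 (ext_deriv A \<eta> p)" for p
    using alternating_ext_deriv[OF s\<eta>] by (simp add: numeral_2_eq_2)
  have k2: "Suc (2 * (n - 1)) = 2 * n - 1" using n1 by simp
  have adW: "alternating (2 * n - 1) (ext_deriv A ?W p)" for p
    using alternating_ext_deriv[OF sW, of p] k2 by simp
  have tw: "twist (\<eta> p) = (\<lambda>vs. - \<eta> p vs)" for p using alternating_twist[OF a\<eta>] by simp
  have deg: "int (2 * n - 1) - int n = int n - 1" using n1 by simp
  have s\<nu>: "smooth_form A (2 * (n - 1)) \<nu>" and b\<nu>: "bidegree (J p) (int n) (int n - 2) (\<nu> p)" for p
  proof -
    \<comment> \<open>Correct for \<open>n = 1\<close> too: there \<open>\<nu>\<close> has bidegree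
      (1, -1), so it is zero, and its degree is 0. Hence no separate case is needed.\<close>
    have "nat (int n + (int n - 2)) = 2 * (n - 1)" by simp
    then show "smooth_form A (2 * (n - 1)) \<nu>" using \<nu> unfolding forms_pq_def by (metis (mono_tags, lifting) mem_Collect_eq)
    show "bidegree (J p) (int n) (int n - 2) (\<nu> p)" using \<nu> by (simp add: forms_pq_def)
  qed
  have w\<nu>: "weight (J p) 2 (\<nu> p)" for p using bidegree_weight[OF b\<nu>] by simp
  have a\<nu>: "alternating (2 * (n - 1)) (\<nu> p)" for p by (rule smooth_form_alternating[OF s\<nu>])
  have ad\<nu>: "alternating (2 * n - 1) (ext_deriv A \<nu> p)" for p
    using alternating_ext_deriv[OF s\<nu>, of p] k2 by simp
  define \<tau> where "\<tau> p = wedge (\<eta> p) (delbar A J (int n) (int n - 2) \<nu> p)" for p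
  have d1: "ext_deriv A (form_wedge \<eta> ?W) p vs = form_wedge (del A J 0 1 \<eta>) ?W p vs - \<tau> p vs" for p vs
  proof -
    \<comment> \<open>The values of \<open>r\<close> here and below solve
      \<open>2 * r - k + w = 0\<close>. For the derivative of \<open>\<eta>\<close>, with
      \<open>k = 2\<close>, this is 1 against the power of \<open>\<omega>\<close> of weight 0 and 0
      against \<open>\<nu>\<close> of weight 2; for forms of degree \<open>2 * n - 1\<close> against
      \<open>\<eta>\<close> of weight -1 it is \<open>n\<close>.\<close>
    have 1: "wedge (ext_deriv A \<eta> p) (?W p) = wedge (del A J 0 1 \<eta> p) (?W p)"
      using top_wedge_component(1)[OF ad\<eta> aW wW, where r=1] dimension n1 by (simp add: del_def)
    have 2: "wedge (\<eta> p) (ext_deriv A ?W p) = wedge (\<eta> p) (del A J (int n - 1) (int n - 1) ?W p)"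
      using top_wedge_component(2)[OF adW a\<eta> w\<eta>, where r="int n"] dimension n1 by (simp add: del_def deg)
    show ?thesis
      unfolding ext_deriv_wedge[OF s\<eta> sW] tw wedge_minus_left 1 2 eq by (simp add: \<tau>_def form_wedge_def)
  qed
  have d2: "ext_deriv A (form_wedge \<eta> \<nu>) p vs = - \<tau> p vs" for p vs
  proof -
    have "delbar A J 0 1 \<eta> p = (\<lambda>vs. 0)" using harmonic_delbar_closed[OF \<eta>] by auto
    then have 1: "wedge (ext_deriv A \<eta> p) (\<nu> p) = (\<lambda>vs. 0)"
      using top_wedge_component(1)[OF ad\<eta> a\<nu> w\<nu>, where r=0] dimension n1 by (simp add: delbar_def)
    have 2: "wedge (\<eta> p) (ext_deriv A \<nu> p) = wedge (\<eta> p) (delbar A J (int n) (int n - 2) \<nu> p)"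
      using top_wedge_component(2)[OF ad\<nu> a\<eta> w\<eta>, where r="int n"] dimension n1 by (simp add: delbar_def deg)
    show ?thesis
      unfolding ext_deriv_wedge[OF s\<eta> s\<nu>] tw wedge_minus_left 1 2 by (simp add: \<tau>_def)
  qed
  note s1 = smooth_form_wedge[OF s\<eta> sW] and s2 = smooth_form_wedge[OF s\<eta> s\<nu>]
  have "form_wedge (del A J 0 1 \<eta>) ?W = ext_deriv A (\<lambda>p vs. form_wedge \<eta> ?W p vs - form_wedge \<eta> \<nu> p vs)"
    by (intro ext) (simp only: ext_deriv_diff[OF s1 s2] d1 d2, simp)
  moreover have "Suc (1 + 2 * (n - 1)) = CARD('d)" using dimension n1 by simp
  ultimately show ?thesis using stokes[OF smooth_form_diff[OF s1 s2]] by simp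
qed

end

theorem theorem3p4:
  fixes A :: "('m::{t2_space,second_countable_topology}, 'd::{finite,wellorder}) chart set"
    and J :: "('m, 'd) endo_field"
    and g :: "('m, 'd) metric_field"
    and \<eta> :: "('m, 'd) form"
    and n :: nat
  assumes "compact (UNIV :: 'm set)"
    and "CARD('d) = 2 * n"
    and "smooth_atlas A"
    and "almost_complex A J"
    and "strongly_gauduchon A J g n"
    and "\<eta> \<in> delbar_harmonic A J g 0 1"
  shows "form_integral A J
    (form_wedge (del A J 0 1 \<eta>) (form_power (fundamental_form J g) (n - 1))) = 0"
proof -
  have "hermitian_metric A J g" using assms(5) by (simp add: strongly_gauduchon_def gauduchon_def)
  then interpret hermitian_manifold A J g n using assms(1-4) by unfold_locales
  show ?thesis
    using assms(5,6) integral_del_harmonic unfolding strongly_gauduchon_def by blast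
qed

end
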